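(* (1) Let $a: M^n \to S^{n+1}(1) \subseteq \mathbb{R}^{n+2}$ be a hypersurface (immersion of an $n$-dimensional manifold) with unit normal $b$ (normal to the hypersurface and tangent to the sphere). Then the Gauss map $G: M^n \to Q^n: p \mapsto [a(p)+ib(p)]$ is a Lagrangian immersion. Moreover, the map $\hat G: M^n \to V^{2n+1}: p \mapsto \frac{1}{\sqrt 2}(a(p)+ib(p))$ is a horizontal lift of $G$, and if $A$ is the almost product structure along $G$ determined by this horizontal lift, i.e. $AX = -(d\pi)_{\hat G(p)}\big(\overline{\hat X}\big)$ for $X \in T_{G(p)}Q^n$ with horizontal lift $\hat X$ at $\hat G(p)$, then the principal curvatures $\lambda_1,\ldots,\lambda_n$ of $a$, with respect to the shape operator associated to $b$, and the (corresponding) angle functions $\theta_1,\ldots,\theta_n$ of $G$ with respect to $A$ are related by $$\lambda_j = \cot\theta_j, \qquad j=1,\ldots,n.$$ (2) Conversely, let $f: M^n \to Q^n$ be a Lagrangian immersion. Then for every point of $M^n$ there exist an open neighborhood $U$ of that point in $M^n$ and an immersion $a: U \to S^{n+1}(1)$ with Gauss map $f|_U$. This immersion is not unique, nor are its principal curvature functions (that is, around every point there are different such immersions on a common neighborhood, having different principal curvature functions). However, for any choice of such an $a$, a local frame $\{e_1,\ldots,e_n\}$ of principal directions for $a$ is adapted to $f$ in the sense that, for any choice of $A \in \mathcal{A}$ defined at least along the image of $f|_U$, there are local angle functions $\theta_1,\ldots,\theta_n$ with $$A(df)e_j = \cos(2\theta_j)\,(df)e_j - \sin(2\theta_j)\,J(df)e_j,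 \qquad j=1,\ldots,n,$$ and the principal curvature functions $\lambda_1,\ldots,\lambda_n$ of $a$ (with $\lambda_j$ corresponding to $e_j$) are related to the corresponding local angle functions $\theta_1,\ldots,\theta_n$ by $$\cot(\theta_j-\theta_k) = \pm \frac{\lambda_j \lambda_k + 1}{\lambda_j - \lambda_k}$$ for $j,k=1,\ldots,n$ in points where $\lambda_j \neq \lambda_k$. Here the sign $\pm$ reflects that the principal curvatures of $a$ are defined only up to a simultaneous change of sign, according to the choice of the unit normal.
   Context: Ambient spaces. $\mathbb{C}P^{n+1}(4)$ is the complex projective space of complex dimension $n+1$ with the Fubini-Study metric $g_{FS}$ of constant holomorphic sectional curvature $4$, and $\pi: S^{2n+3}(1)\subseteq\mathbb{C}^{n+2} \to \mathbb{C}P^{n+1}(4): z \mapsto [z]$ is the Hopf fibration, a Riemannian submersion with $\ker(d\pi)_z = \mathrm{span}_{\mathbb{R}}\{iz\}$. A tangent vector to $S^{2n+3}(1)$ at $z$ is horizontal if it is orthogonal to $iz$. The complex structure $J$ on $\mathbb{C}P^{n+1}(4)$ is induced by multiplication by $i$. For a nonzero vector $w\in\mathbb{C}^{n+2}$, $[w]=[w/|w|]$. Complex quadric. $Q^n = \{[(z_0,\ldots,z_{n+1})] \in \mathbb{C}P^{n+1}(4) \mid z_0^2+\cdots+z_{n+1}^2=0\}$, with the induced metric $g$ and induced complex structure, again denoted by $J$. Its inverse image under $\pi$ is $V^{2n+1} = \{u+iv \mid u,v\in\mathbb{R}^{n+2},\ \langle u,u\rangle=\langle v,v\rangle=\tfrac12,\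 \langle u,v\rangle=0\}\subseteq S^{2n+3}(1)$, where $\langle\cdot,\cdot\rangle$ is the Euclidean inner product. The set $\mathcal{A}$. $\mathcal{A}$ denotes the set of all shape operators of $Q^n$ in $\mathbb{C}P^{n+1}(4)$ associated with unit normal vector fields $\zeta$ (so $AX$ is minus the tangential part of $\nabla^{\mathbb{C}P^{n+1}(4)}_X\zeta$). Elements of $\mathcal{A}$ may be defined only on a subset of $Q^n$. Every $A\in\mathcal{A}$ is involutive, symmetric and anti-commutes with $J$. Lagrangian immersions and angle functions. An immersion $f: M^n\to Q^n$ of a manifold of real dimension $n$, where $M^n$ carries the induced metric, is Lagrangian if $J$ maps the tangent space to $M^n$ at any point into the normal space at that point and vice versa. Given such an $f$ and an $A\in\mathcal{A}$ defined at least along $f(M^n)$, around any point of $M^n$ there exist an orthonormal frame $\{e_1,\ldots,e_n\}$ on $M^n$ and local angle functions $\theta_1,\ldots,\theta_n$ such that $A(df)e_j = \cos(2\theta_j)(df)e_j - \sin(2\theta_j)J(df)e_j$ for all $j$. The angle functions are defined only up to addition of integer multiples of $\pi$ and depend on the choice of $A$. The displayed relation is unaffected by rescaling the vectors $e_j$. In part (1), "corresponding" means that $\theta_j$ and $\lambda_j$ belong to the same direction $e_j$. Choice of $A$ from a horizontal lift. A horizontal lift of a Lagrangian immersion $f: M^n\to Q^n$ is a map $\hat f: M^n\to V^{2n+1}$ with $\pi\circ\hat f=f$ and with $(d\hat f)_p(v)$ horizontal for all tangent vectors $v$. Given $\hat f$, a unit normal vector field to $Q^n$ in $\mathbb{C}P^{n+1}(4)$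 along $f$ is $\zeta_{f(p)} = (d\pi)_{\hat f(p)}(\overline{\hat f(p)})$, and the corresponding shape operator is $AX=-(d\pi)_{\hat f(p)}(\overline{\hat X})$, where $X$ is tangent to $Q^n$ at $f(p)$ and $\hat X$ is its horizontal lift to $\hat f(p)$. The bar denotes complex conjugation in $\mathbb{C}^{n+2}$. Hypersurfaces of spheres. For a hypersurface $a: M^n\to S^{n+1}(1)$ with unit normal $b$, both $a(p)$ and $b(p)$ are regarded as vectors in $\mathbb{R}^{n+2}$, and the Gauss map of $a$ is $G: M^n\to Q^n: p\mapsto[a(p)+ib(p)]$. The statement that an immersion $a:U\to S^{n+1}(1)$ has Gauss map $f|_U$ means that $f|_U=[a+ib]$ for a unit normal $b$ of $a$. The shape operator $S$ associated to $b$ is determined by $db(X) = -da(SX)$. Its eigenvalues are the principal curvatures and its eigenvectors are the principal directions. Changing $b$ to $-b$ changes the sign of all principal curvatures. *)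

theory Defs
  imports "HOL-Analysis.Analysis"
begin

section \<open>Smooth manifolds\<close>

text \<open>
  \<open>Ck_on k f S\<close> and \<open>smooth_on S f\<close> are meant for open sets \<open>S\<close> only; they then
  depend only on the values of \<open>f\<close> on \<open>S\<close>.
\<close>

primrec Ck_on :: "nat \<Rightarrow> ('a::real_normed_vector \<Rightarrow> 'b::real_normed_vector) \<Rightarrow> 'a set \<Rightarrow> bool" where
  "Ck_on 0 f S \<longleftrightarrow> continuous_on S f"
| "Ck_on (Suc k) f S \<longleftrightarrow>
     (\<forall>x\<in>S. f differentiable (at x)) \<and> (\<forall>v. Ck_on k (\<lambda>x. frechet_derivative f (at x) v) S)"

definition smooth_on :: "'a::real_normed_vector set \<Rightarrow> ('a \<Rightarrow> 'b::real_normed_vector) \<Rightarrow> bool" where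
  "smooth_on S f \<longleftrightarrow> (\<forall>k. Ck_on k f S)"

type_synonym ('a, 'b) chart = "'a set \<times> ('a \<Rightarrow> 'b)"

text \<open>
  A manifold is a topology together with a (not necessarily maximal) smooth atlas; the model
  space is the type \<open>'b\<close>, so the dimension is \<open>DIM('b)\<close>.
\<close>

record ('a, 'b) manifold =
  mtop :: "'a topology"
  charts :: "('a, 'b) chart set"

abbreviation carrier :: "('a, 'b) manifold \<Rightarrow> 'a set" where
  "carrier M \<equiv> topspace (mtop M)"

abbreviation cdom :: "('a, 'b) chart \<Rightarrow> 'a set" where
  "cdom c \<equiv> fst c"

abbreviation cmap :: "('a, 'b) chart \<Rightarrow> 'a \<Rightarrow> 'b" where
  "cmap c \<equiv> snd c"

abbreviation cinv :: "('a, 'b) chart \<Rightarrow> 'b \<Rightarrow> 'a" where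
  "cinv c \<equiv> inv_into (fst c) (snd c)"

definition charts_at :: "('a, 'b) manifold \<Rightarrow> 'a \<Rightarrow> ('a, 'b) chart set" where
  "charts_at M p = {c \<in> charts M. p \<in> cdom c}"

definition smooth_manifold :: "('a, 'b::euclidean_space) manifold \<Rightarrow> bool" where
  "smooth_manifold M \<longleftrightarrow>
     Hausdorff_space (mtop M) \<and>
     (\<exists>\<B>. countable \<B> \<and> (\<forall>B\<in>\<B>. openin (mtop M) B) \<and>
        (\<forall>U x. openin (mtop M) U \<and> x \<in> U \<longrightarrow> (\<exists>B\<in>\<B>. x \<in> B \<and> B \<subseteq> U))) \<and>
     (\<Union>c\<in>charts M. cdom c) = carrier M \<and>
     (\<forall>c\<in>charts M. openin (mtop M) (cdom c) \<and> open (cmap c ` cdom c) \<and>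
        homeomorphic_map (subtopology (mtop M) (cdom c)) (top_of_set (cmap c ` cdom c)) (cmap c)) \<and>
     (\<forall>c\<in>charts M. \<forall>d\<in>charts M. smooth_on (cmap c ` (cdom c \<inter> cdom d)) (cmap d \<circ> cinv c))"

text \<open>
  A tangent vector at \<open>p\<close> is the family of its coordinate representations in all charts around
  \<open>p\<close>, subject to the usual transformation law (and extended by zero to the other charts).
  The vector space operations are the pointwise ones.
\<close>

type_synonym ('a, 'b) tvec = "('a, 'b) chart \<Rightarrow> 'b"

definition tangent_space :: "('a, 'b::euclidean_space) manifold \<Rightarrow> 'a \<Rightarrow> ('a, 'b) tvec set" where
  "tangent_space M p =
     {X. (\<forall>c\<in>charts_at M p. \<forall>d\<in>charts_at M p.
            X d = frechet_derivative (cmap d \<circ> cinv c) (at (cmap c p)) (X c)) \<and>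
         (\<forall>c. c \<notin> charts_at M p \<longrightarrow> X c = 0)}"

definition tzero :: "('a, 'b::euclidean_space) tvec" where
  "tzero = (\<lambda>c. 0)"

definition tscale :: "real \<Rightarrow> ('a, 'b::euclidean_space) tvec \<Rightarrow> ('a, 'b) tvec" where
  "tscale r X = (\<lambda>c. r *\<^sub>R X c)"

text \<open>
  Differentials: \<open>push N h x v\<close> for a map \<open>h\<close> from (an open subset of) a vector space to a
  manifold, \<open>vdiff M f p\<close> for a map from a manifold to a vector space, and \<open>mdiff M N f p\<close>
  for a map between manifolds. On tangent vectors of a smooth manifold, the last two do not
  depend on the choice of the chart.
\<close>

definition push :: "('a, 'b::euclidean_space) manifold \<Rightarrow> ('e::euclidean_space \<Rightarrow> 'a) \<Rightarrow> 'e \<Rightarrow> 'e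
    \<Rightarrow> ('a, 'b) tvec" where
  "push N h x v =
     (\<lambda>d. if d \<in> charts_at N (h x) then frechet_derivative (cmap d \<circ> h) (at x) v else 0)"

definition vdiff :: "('a, 'b::euclidean_space) manifold \<Rightarrow> ('a \<Rightarrow> 'e::euclidean_space) \<Rightarrow> 'a
    \<Rightarrow> ('a, 'b) tvec \<Rightarrow> 'e" where
  "vdiff M f p X = (let c = (SOME c. c \<in> charts_at M p) in
     frechet_derivative (f \<circ> cinv c) (at (cmap c p)) (X c))"

definition mdiff :: "('a, 'b::euclidean_space) manifold \<Rightarrow> ('c, 'd::euclidean_space) manifold
    \<Rightarrow> ('a \<Rightarrow> 'c) \<Rightarrow> 'a \<Rightarrow> ('a, 'b) tvec \<Rightarrow> ('c, 'd) tvec" where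
  "mdiff M N f p X = (let c = (SOME c. c \<in> charts_at M p) in
     push N (f \<circ> cinv c) (cmap c p) (X c))"

definition smooth_fun :: "('a, 'b::euclidean_space) manifold \<Rightarrow> 'a set
    \<Rightarrow> ('a \<Rightarrow> 'e::euclidean_space) \<Rightarrow> bool" where
  "smooth_fun M U f \<longleftrightarrow> (\<forall>c\<in>charts M. smooth_on (cmap c ` (cdom c \<inter> U)) (f \<circ> cinv c))"

definition smooth_map :: "('a, 'b::euclidean_space) manifold \<Rightarrow> ('c, 'd::euclidean_space) manifold
    \<Rightarrow> 'a set \<Rightarrow> ('a \<Rightarrow> 'c) \<Rightarrow> bool" where
  "smooth_map M N U f \<longleftrightarrow>
     (\<forall>p\<in>U. \<exists>c\<in>charts_at M p. \<exists>d\<in>charts_at N (f p). \<exists>W.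
        openin (mtop M) W \<and> p \<in> W \<and> W \<subseteq> U \<inter> cdom c \<and> f ` W \<subseteq> cdom d \<and>
        smooth_on (cmap c ` W) (cmap d \<circ> f \<circ> cinv c))"

definition smooth_curve :: "('a, 'b::euclidean_space) manifold \<Rightarrow> real set \<Rightarrow> (real \<Rightarrow> 'a) \<Rightarrow> bool" where
  "smooth_curve N I \<gamma> \<longleftrightarrow>
     (\<forall>t\<in>I. \<exists>d\<in>charts_at N (\<gamma> t). \<exists>\<delta>>0.
        ball t \<delta> \<subseteq> I \<and> \<gamma> ` ball t \<delta> \<subseteq> cdom d \<and> smooth_on (ball t \<delta>) (cmap d \<circ> \<gamma>))"

definition smooth_field :: "('a, 'b::euclidean_space) manifold \<Rightarrow> 'a set
    \<Rightarrow> ('a \<Rightarrow> ('a, 'b) tvec) \<Rightarrow> bool" where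
  "smooth_field M U Y \<longleftrightarrow>
     (\<forall>p\<in>U. Y p \<in> tangent_space M p) \<and>
     (\<forall>c\<in>charts M. smooth_on (cmap c ` (cdom c \<inter> U)) (\<lambda>x. Y (cinv c x) c))"

definition frame_at :: "('a, 'b::euclidean_space) manifold \<Rightarrow> 'a \<Rightarrow> ('n::finite \<Rightarrow> ('a, 'b) tvec)
    \<Rightarrow> bool" where
  "frame_at M p e \<longleftrightarrow>
     (\<forall>j. e j \<in> tangent_space M p) \<and>
     (\<forall>X\<in>tangent_space M p. \<exists>!r::'n \<Rightarrow> real. X = (\<lambda>c. \<Sum>j\<in>UNIV. r j *\<^sub>R e j c))"

section \<open>The Levi-Civita connection\<close>

type_synonym ('a, 'b) metric = "'a \<Rightarrow> ('a, 'b) tvec \<Rightarrow> ('a, 'b) tvec \<Rightarrow> real"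

text \<open>
  \<open>metric_coeff N g c x u v\<close> is the value at the point with coordinates \<open>x\<close> of the metric
  on the vector fields that have constant components \<open>u\<close> and \<open>v\<close> in the chart \<open>c\<close>.
\<close>

definition metric_coeff :: "('a, 'b::euclidean_space) manifold \<Rightarrow> ('a, 'b) metric \<Rightarrow> ('a, 'b) chart
    \<Rightarrow> 'b \<Rightarrow> 'b \<Rightarrow> 'b \<Rightarrow> real" where
  "metric_coeff N g c x u v = g (cinv c x) (push N (cinv c) x u) (push N (cinv c) x v)"

text \<open>
  \<open>levi_civita N g q X Y\<close> is the covariant derivative at \<open>q\<close>, in the direction of the tangent
  vector \<open>X\<close>, of a vector field \<open>Y\<close> defined near \<open>q\<close>. In coordinates it is the vector \<open>Z\<close> with
  \<open>Z = D\<^bsub>X\<^esub>Y + \<Gamma>(X, Y)\<close>, where the Christoffel symbols are given by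
  \<open>g(\<Gamma>(u, y), w) = 1/2 (\<partial>\<^bsub>u\<^esub> g(y, w) + \<partial>\<^bsub>y\<^esub> g(u, w) - \<partial>\<^bsub>w\<^esub> g(u, y))\<close>.
\<close>

definition levi_civita :: "('a, 'b::euclidean_space) manifold \<Rightarrow> ('a, 'b) metric \<Rightarrow> 'a
    \<Rightarrow> ('a, 'b) tvec \<Rightarrow> ('a \<Rightarrow> ('a, 'b) tvec) \<Rightarrow> ('a, 'b) tvec" where
  "levi_civita N g q X Y = (THE Z. Z \<in> tangent_space N q \<and>
     (\<forall>c\<in>charts_at N q. \<forall>w.
        let x = cmap c q; u = X c; y = Y q c;
            DY = frechet_derivative (\<lambda>x'. Y (cinv c x') c) (at x) u
        in metric_coeff N g c x (Z c - DY) w =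
             (frechet_derivative (\<lambda>x'. metric_coeff N g c x' y w) (at x) u
            + frechet_derivative (\<lambda>x'. metric_coeff N g c x' u w) (at x) y
            - frechet_derivative (\<lambda>x'. metric_coeff N g c x' u y) (at x) w) / 2))"

section \<open>Complex projective space\<close>

text \<open>
  For a finite index type \<open>'k\<close> with \<open>m\<close> elements, \<open>complex ^ 'k option\<close> is the
  complex vector space of dimension \<open>m + 1\<close>, and the complex lines in it form the complex
  projective space of dimension \<open>m\<close>. The line \<open>cline w\<close> is \<open>[w]\<close>; it only depends on
  \<open>w / norm w\<close>.
\<close>

type_synonym 'k cp = "(complex ^ 'k option) set"

definition cline :: "complex ^ 'k option \<Rightarrow> 'k::finite cp" where
  "cline w = range (\<lambda>c. c *s w)"

definition cp_points :: "'k::finite cp set" where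
  "cp_points = cline ` (UNIV - {0})"

text \<open>The affine chart \<open>[z] \<mapsto> (z\<^sub>i / z\<^sub>j)\<close> for \<open>i \<noteq> j\<close>, with \<open>j = \<sigma> None\<close>.\<close>

definition affine_chart :: "('k option \<Rightarrow> 'k option) \<Rightarrow> ('k::finite cp, complex ^ 'k) chart" where
  "affine_chart \<sigma> =
     (cline ` {w. w $ \<sigma> None \<noteq> 0},
      \<lambda>L. let w = (SOME w. w \<in> L \<and> w \<noteq> 0) in (\<chi> i. w $ \<sigma> (Some i) / w $ \<sigma> None))"

text \<open>The topology is the quotient topology of the Hopf map \<open>cline\<close> on the unit sphere.\<close>

definition CP :: "('k::finite cp, complex ^ 'k) manifold" where
  "CP = \<lparr> mtop = topology (\<lambda>V. V \<subseteq> cp_points \<and>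
                    openin (top_of_set (sphere 0 1)) {z \<in> sphere 0 1. cline z \<in> V}),
          charts = {affine_chart \<sigma> |\<sigma>. bij \<sigma>} \<rparr>"

lemma openin_CP:
  "openin (mtop (CP :: ('k::finite cp, complex ^ 'k) manifold)) V \<longleftrightarrow>
     V \<subseteq> cp_points \<and> openin (top_of_set (sphere 0 1)) {z \<in> sphere 0 1. cline z \<in> V}"
proof -
  have *: "{z \<in> sphere 0 1. cline z \<in> S \<inter> T} =
      {z \<in> sphere 0 1. cline z \<in> S} \<inter> {z \<in> sphere 0 1. cline z \<in> T}" for S T :: "'k cp set"
    by auto
  have **: "{z \<in> sphere 0 1. cline z \<in> \<Union> K} = (\<Union>S\<in>K. {z \<in> sphere 0 1. cline z \<in> S})"
    for K :: "'k cp set set"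
    by auto
  have "istopology (\<lambda>V :: 'k cp set. V \<subseteq> cp_points \<and>
      openin (top_of_set (sphere 0 1)) {z \<in> sphere 0 1. cline z \<in> V})"
    unfolding istopology_def * ** by (auto intro: openin_Int openin_Union)
  then show ?thesis
    unfolding CP_def by (simp add: topology_inverse')
qed

text \<open>
  On \<open>complex ^ 'm\<close>, the inner product \<open>\<bullet>\<close> is the real part of the Hermitian one.
  The first condition says that \<open>v\<close> is tangent to the unit sphere at \<open>z\<close>.
\<close>

definition horizontal :: "complex ^ 'm::finite \<Rightarrow> (complex ^ 'm) set" where
  "horizontal z = {v. v \<bullet> z = 0 \<and> v \<bullet> (\<i> *s z) = 0}"

definition dhopf :: "complex ^ 'k::finite option \<Rightarrow> complex ^ 'k option \<Rightarrow> ('k cp, complex ^ 'k) tvec" where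
  "dhopf z v = push CP cline z v"

definition hlift :: "complex ^ 'k::finite option \<Rightarrow> ('k cp, complex ^ 'k) tvec \<Rightarrow> complex ^ 'k option" where
  "hlift z X = (THE v. v \<in> horizontal z \<and> dhopf z v = X)"

definition unit_rep :: "'k::finite cp \<Rightarrow> complex ^ 'k option" where
  "unit_rep q = (SOME z. z \<in> sphere 0 1 \<and> cline z = q)"

text \<open>
  The Fubini-Study metric of constant holomorphic sectional curvature 4 is the one for which
  the Hopf map on the unit sphere is a Riemannian submersion, and the complex structure is induced by
  multiplication by \<open>\<i>\<close>; both are independent of the representative of \<open>q\<close>.
\<close>

definition gFS :: "('k::finite cp, complex ^ 'k) metric" where
  "gFS q X Y = hlift (unit_rep q) X \<bullet> hlift (unit_rep q) Y"

definition cpJ :: "'k::finite cp \<Rightarrow> ('k cp, complex ^ 'k) tvec \<Rightarrow> ('k cp, complex ^ 'k) tvec" where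
  "cpJ q X = dhopf (unit_rep q) (\<i> *s hlift (unit_rep q) X)"

section \<open>The complex quadric and its shape operators\<close>

definition Quadric :: "'k::finite cp set" where
  "Quadric = {cline z |z. z \<in> sphere 0 1 \<and> (\<Sum>j\<in>UNIV. (z $ j)\<^sup>2) = 0}"

definition cvec :: "real ^ 'm \<Rightarrow> real ^ 'm \<Rightarrow> complex ^ 'm" where
  "cvec u v = (\<chi> j. Complex (u $ j) (v $ j))"

definition cconj :: "complex ^ 'm \<Rightarrow> complex ^ 'm" where
  "cconj z = (\<chi> j. cnj (z $ j))"

definition Vset :: "(complex ^ 'm::finite) set" where
  "Vset = {cvec u v |u v. u \<bullet> u = 1/2 \<and> v \<bullet> v = 1/2 \<and> u \<bullet> v = 0}"

text \<open>The quadric is a submanifold; its tangent vectors are the velocities of curves in it.\<close>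

definition quadric_tangent :: "'k::finite cp \<Rightarrow> ('k cp, complex ^ 'k) tvec set" where
  "quadric_tangent q = {push CP \<gamma> 0 (1::real) |\<gamma>. \<gamma> 0 = q \<and>
     (\<exists>\<epsilon>>0. smooth_curve CP {-\<epsilon><..<\<epsilon>} \<gamma> \<and> (\<forall>t\<in>{-\<epsilon><..<\<epsilon>}. \<gamma> t \<in> Quadric))}"

definition tangential :: "'k::finite cp \<Rightarrow> ('k cp, complex ^ 'k) tvec \<Rightarrow> ('k cp, complex ^ 'k) tvec" where
  "tangential q Z = (THE T. T \<in> quadric_tangent q \<and> (\<forall>Y\<in>quadric_tangent q. gFS q (Z - T) Y = 0))"

text \<open>
  A vector field on the open set \<open>W\<close> of the projective space whose restriction to
  \<open>Quadric \<inter> W\<close> is a unit normal vector field of the quadric.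
\<close>

definition unit_normal_field :: "'k::finite cp set \<Rightarrow> ('k cp \<Rightarrow> ('k cp, complex ^ 'k) tvec) \<Rightarrow> bool" where
  "unit_normal_field W \<xi> \<longleftrightarrow>
     openin (mtop CP) W \<and> smooth_field CP W \<xi> \<and>
     (\<forall>q\<in>Quadric \<inter> W. gFS q (\<xi> q) (\<xi> q) = 1 \<and> (\<forall>Y\<in>quadric_tangent q. gFS q (\<xi> q) Y = 0))"

text \<open>
  The set \<open>\<A>\<close>: a pair \<open>(D, A)\<close> is a shape operator \<open>A\<close> of the quadric defined on the subset
  \<open>D\<close>, associated with a smooth unit normal vector field \<open>\<zeta>\<close> on \<open>D\<close>. Since \<open>D\<close> need not be open,
  smoothness means the existence of local smooth extensions \<open>\<xi>\<close> of \<open>\<zeta>\<close>, and these are used to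
  form the covariant derivative; at a point of \<open>D\<close> the operator only depends on the value
  of \<open>\<zeta>\<close> there. The value \<open>A q X\<close> is only relevant for \<open>X\<close> tangent to the quadric at \<open>q \<in> D\<close>.
\<close>

definition shape_operators ::
    "('k::finite cp set \<times> ('k cp \<Rightarrow> ('k cp, complex ^ 'k) tvec \<Rightarrow> ('k cp, complex ^ 'k) tvec)) set" where
  "shape_operators = {(D, A). D \<subseteq> Quadric \<and>
     (\<exists>\<zeta>. \<forall>q\<in>D. \<exists>W \<xi>. q \<in> W \<and> unit_normal_field W \<xi> \<and> (\<forall>x\<in>D \<inter> W. \<xi> x = \<zeta> x) \<and>
        (\<forall>X\<in>quadric_tangent q. A q X = - tangential q (levi_civita CP gFS q X \<xi>)))}"

section \<open>Lagrangian immersions\<close>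

definition immersion_into_quadric ::
    "('a, 'b::euclidean_space) manifold \<Rightarrow> ('a \<Rightarrow> 'k::finite cp) \<Rightarrow> bool" where
  "immersion_into_quadric M f \<longleftrightarrow>
     smooth_map M CP (carrier M) f \<and>
     (\<forall>p\<in>carrier M. f p \<in> Quadric \<and> inj_on (mdiff M CP f p) (tangent_space M p))"

definition normal_space ::
    "('a, 'b::euclidean_space) manifold \<Rightarrow> ('a \<Rightarrow> 'k::finite cp) \<Rightarrow> 'a \<Rightarrow> ('k cp, complex ^ 'k) tvec set" where
  "normal_space M f p =
     {Y \<in> quadric_tangent (f p). \<forall>X\<in>tangent_space M p. gFS (f p) Y (mdiff M CP f p X) = 0}"

definition lagrangian_immersion ::
    "('a, real ^ 'n::finite) manifold \<Rightarrow> ('a \<Rightarrow> 'n option cp) \<Rightarrow> bool" where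
  "lagrangian_immersion M f \<longleftrightarrow>
     immersion_into_quadric M f \<and>
     (\<forall>p\<in>carrier M.
        cpJ (f p) ` mdiff M CP f p ` tangent_space M p \<subseteq> normal_space M f p \<and>
        cpJ (f p) ` normal_space M f p \<subseteq> mdiff M CP f p ` tangent_space M p)"

definition horizontal_lift ::
    "('a, 'b::euclidean_space) manifold \<Rightarrow> ('a \<Rightarrow> 'k::finite cp) \<Rightarrow> ('a \<Rightarrow> complex ^ 'k option) \<Rightarrow> bool" where
  "horizontal_lift M f fh \<longleftrightarrow>
     smooth_fun M (carrier M) fh \<and>
     (\<forall>p\<in>carrier M. fh p \<in> Vset \<and> cline (fh p) = f p \<and>
        vdiff M fh p ` tangent_space M p \<subseteq> horizontal (fh p))"

definition lift_shape_operator ::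
    "complex ^ 'k::finite option \<Rightarrow> ('k cp, complex ^ 'k) tvec \<Rightarrow> ('k cp, complex ^ 'k) tvec" where
  "lift_shape_operator z X = - dhopf z (cconj (hlift z X))"

text \<open>The number \<open>\<theta>\<close> is the value at \<open>p\<close> of an angle function for the direction \<open>e\<close>.\<close>

definition has_angle ::
    "('a, 'b::euclidean_space) manifold \<Rightarrow> ('a \<Rightarrow> 'k::finite cp)
      \<Rightarrow> (('k cp, complex ^ 'k) tvec \<Rightarrow> ('k cp, complex ^ 'k) tvec)
      \<Rightarrow> 'a \<Rightarrow> ('a, 'b) tvec \<Rightarrow> real \<Rightarrow> bool" where
  "has_angle M f A p e \<theta> \<longleftrightarrow>
     A (mdiff M CP f p e) =
       tscale (cos (2 * \<theta>)) (mdiff M CP f p e) - tscale (sin (2 * \<theta>)) (cpJ (f p) (mdiff M CP f p e))"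

section \<open>Hypersurfaces of spheres\<close>

text \<open>
  For \<open>n = CARD('n)\<close>, the ambient space \<open>real ^ 'n option option\<close> has dimension \<open>n + 2\<close>.
\<close>

definition hypersurface ::
    "('a, real ^ 'n::finite) manifold \<Rightarrow> 'a set \<Rightarrow> ('a \<Rightarrow> real ^ 'n option option)
      \<Rightarrow> ('a \<Rightarrow> real ^ 'n option option) \<Rightarrow> bool" where
  "hypersurface M U a b \<longleftrightarrow>
     openin (mtop M) U \<and> smooth_fun M U a \<and> smooth_fun M U b \<and>
     (\<forall>p\<in>U. norm (a p) = 1 \<and> inj_on (vdiff M a p) (tangent_space M p) \<and>
        norm (b p) = 1 \<and> b p \<bullet> a p = 0 \<and> (\<forall>X\<in>tangent_space M p. b p \<bullet> vdiff M a p X = 0))"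

definition gauss_map :: "('a \<Rightarrow> real ^ 'k::finite option) \<Rightarrow> ('a \<Rightarrow> real ^ 'k option) \<Rightarrow> 'a \<Rightarrow> 'k cp" where
  "gauss_map a b p = cline (cvec (a p) (b p))"

definition shape_op ::
    "('a, 'b::euclidean_space) manifold \<Rightarrow> ('a \<Rightarrow> real ^ 'm::finite) \<Rightarrow> ('a \<Rightarrow> real ^ 'm)
      \<Rightarrow> 'a \<Rightarrow> ('a, 'b) tvec \<Rightarrow> ('a, 'b) tvec" where
  "shape_op M a b p X = (THE Y. Y \<in> tangent_space M p \<and> vdiff M b p X = - vdiff M a p Y)"

definition principal_curvatures ::
    "('a, 'b::euclidean_space) manifold \<Rightarrow> ('a \<Rightarrow> real ^ 'm::finite) \<Rightarrow> ('a \<Rightarrow> real ^ 'm) \<Rightarrow> 'a \<Rightarrow> real set" where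
  "principal_curvatures M a b p =
     {\<kappa>. \<exists>e\<in>tangent_space M p. e \<noteq> tzero \<and> shape_op M a b p e = tscale \<kappa> e}"

definition principal_frame_at ::
    "('a, 'b::euclidean_space) manifold \<Rightarrow> ('a \<Rightarrow> real ^ 'm::finite) \<Rightarrow> ('a \<Rightarrow> real ^ 'm)
      \<Rightarrow> 'a \<Rightarrow> ('n::finite \<Rightarrow> ('a, 'b) tvec) \<Rightarrow> ('n \<Rightarrow> real) \<Rightarrow> bool" where
  "principal_frame_at M a b p e \<kappa> \<longleftrightarrow>
     frame_at M p e \<and> (\<forall>j. shape_op M a b p (e j) = tscale (\<kappa> j) (e j))"

end

theory Submission
  imports Defs
begin

text \<open>
  Everything is computed with lifts to the unit sphere of \<open>complex ^ 'n option option\<close>. For a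
  hypersurface \<open>a\<close> with unit normal \<open>b\<close>, the vector \<open>z = (a + ib) / \<surd>2\<close> lies over the Gauss map, and
  its differential \<open>(da + i db) / \<surd>2\<close> is horizontal because \<open>a\<close> and \<open>b\<close> are orthogonal to the images
  of \<open>da\<close> and \<open>db\<close>. The tangent space of the quadric at \<open>[z]\<close> is represented by the complexification
  of \<open>{a, b}\<^sup>\<bottom> = da(T)\<close>, so that the Lagrangian condition is the symmetry of the second fundamental
  form. On a principal direction, \<open>db(e) = - \<kappa> da(e)\<close>, and the lifted vector is a multiple of
  \<open>(1 - i\<kappa>) da(e)\<close>. Conjugation turns \<open>1 - i\<kappa>\<close> into \<open>1 + i\<kappa>\<close>, so an angle \<open>\<theta>\<close> for the shape operator
  \<open>- cconj\<close> is characterised by \<open>- (1 + i\<kappa>) = e\<^sup>-\<^sup>2\<^sup>i\<^sup>\<theta> (1 - i\<kappa>)\<close>, that is, by \<open>\<kappa> = cot \<theta>\<close>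
  (\<open>has_angle_iff\<close>, \<open>gauss_map_angles\<close>).

  For the converse, any lift \<open>g\<close> of a Lagrangian immersion becomes horizontal after multiplication
  with \<open>e\<^sup>i\<^sup>\<phi>\<close> if \<open>d\<phi> = - Im \<langle>dg, g\<rangle>\<close>. The right-hand side is closed, since its differential is a
  multiple of the Kaehler form, and the Poincare lemma on a ball gives \<open>\<phi>\<close>
  (\<open>horizontal_lift_exists\<close>). The real and imaginary parts of the horizontal lift satisfy all
  conditions on \<open>a\<close> and \<open>b\<close> except that \<open>a\<close> need not be an immersion. Multiplication by \<open>e\<^sup>i\<^sup>t\<close> rotates
  the pair without changing the line, and only finitely many rotation angles modulo \<open>\<pi>\<close> are
  singular at a given point, because the kernels that belong to different rotations are orthogonal
  (\<open>hypersurface_exists\<close>). A rotation shifts all angles by \<open>t\<close>, which changes the principal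
  curvatures \<open>cot \<theta>\<close> (\<open>another_hypersurface\<close>).

  An arbitrary shape operator of the quadric comes from a unit normal field, whose value at \<open>[z]\<close> is
  the projection of \<open>c cconj z\<close> with \<open>|c| = 1\<close>. The Levi-Civita connection of the projective space is
  the projection of the derivative of horizontal lifts, which is verified here with the Christoffel
  symbols in the affine charts (\<open>levi_civita_CP\<close>). Hence the shape operator is \<open>X \<mapsto> - c cconj X\<close>
  on lifts (\<open>shape_operator_formula\<close>). Passing from \<open>1\<close> to \<open>c = e\<^sup>i\<^sup>\<psi>\<close> subtracts \<open>\<psi> / 2\<close> from all
  angles, so the differences of angles do not depend on the shape operator, and the addition theorem
  for \<open>cot\<close> gives their relation to the principal curvatures (\<open>principal_frame_adapted\<close>).
\<close>

section \<open>Calculus of smooth maps\<close>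

text \<open>
  The given derivative agrees with \<^const>\<open>frechet_derivative\<close> on \<open>S\<close> only. Asking for all functions that
  agree with it on \<open>S\<close> makes the rule usable inside the induction for \<open>Ck_on_cong\<close>.
\<close>

lemma Ck_on_SucI_cong:
  assumes "\<And>x. x \<in> S \<Longrightarrow> (f has_derivative f' x) (at x)"
    and cong: "\<And>v g. (\<forall>x\<in>S. f' x v = g x) \<Longrightarrow> Ck_on k g S"
  shows "Ck_on (Suc k) f S"
proof -
  have "f' x = frechet_derivative f (at x)" if "x \<in> S" for x
    using assms(1)[OF that] by (rule frechet_derivative_at)
  then have "Ck_on k (\<lambda>x. frechet_derivative f (at x) v) S" for v
    by (intro cong[of v]) simp
  then show ?thesis
    using assms(1) by (auto simp: differentiable_def)
qed

lemma Ck_on_SucD: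
  assumes "Ck_on (Suc k) f S"
  shows "x \<in> S \<Longrightarrow> (f has_derivative frechet_derivative f (at x)) (at x)"
    and "Ck_on k (\<lambda>x. frechet_derivative f (at x) v) S"
  using assms by (auto simp: frechet_derivative_works)

lemma Ck_on_cong:
  assumes "open S" "\<And>x. x \<in> S \<Longrightarrow> f x = g x" "Ck_on k f S"
  shows "Ck_on k g S"
  using assms(2,3)
proof (induction k arbitrary: f g)
  case 0
  then show ?case by (simp cong: continuous_on_cong)
next
  case (Suc k)
  have d: "(g has_derivative frechet_derivative f (at x)) (at x)" if "x \<in> S" for x
    using has_derivative_transform_within_open[OF Ck_on_SucD(1)[OF Suc.prems(2) that] assms(1) that]
      Suc.prems(1) by auto
  show ?case
  proof (rule Ck_on_SucI_cong[OF d])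
    fix v h assume "\<forall>x\<in>S. frechet_derivative f (at x) v = h x"
    then show "Ck_on k h S"
      using Suc.IH[OF _ Ck_on_SucD(2)[OF Suc.prems(2), of v], of h] by simp
  qed auto
qed

text \<open>
  The closure properties of \<^const>\<open>Ck_on\<close> follow by induction on \<open>k\<close> from this rule: the directional
  derivatives of a sum, product or composition are again built from the given functions.
\<close>

lemma Ck_on_SucI:
  assumes "open S" "\<And>x. x \<in> S \<Longrightarrow> (f has_derivative f' x) (at x)"
    and "\<And>v. Ck_on k (\<lambda>x. f' x v) S"
  shows "Ck_on (Suc k) f S"
proof (rule Ck_on_SucI_cong[OF assms(2)])
  fix v g assume "\<forall>x\<in>S. f' x v = g x"
  then show "Ck_on k g S" using Ck_on_cong[OF assms(1) _ assms(3)] by blast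
qed auto

lemma Ck_on_subset: "Ck_on k f S \<Longrightarrow> T \<subseteq> S \<Longrightarrow> Ck_on k f T"
  by (induction k arbitrary: f) (auto intro: continuous_on_subset)

lemma Ck_on_pred: "Ck_on (Suc k) f S \<Longrightarrow> Ck_on k f S"
proof (induction k arbitrary: f)
  case 0
  then show ?case
    by (auto intro!: continuous_at_imp_continuous_on differentiable_imp_continuous_within)
next
  case (Suc k)
  then show ?case by (auto simp del: Ck_on.simps(1))
qed

lemma Ck_on_imp_continuous_on: "Ck_on k f S \<Longrightarrow> continuous_on S f"
  by (induction k) (auto dest: Ck_on_pred simp del: Ck_on.simps(2))

lemma Ck_on_const: "open S \<Longrightarrow> Ck_on k (\<lambda>x. c) S"
proof (induction k arbitrary: c)
  case (Suc k)
  show ?case by (rule Ck_on_SucI[where f' = "\<lambda>x v. 0"]) (use Suc in auto)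
qed auto

lemma Ck_on_linear:
  assumes "open S" "bounded_linear L"
  shows "Ck_on k L S"
proof (cases k)
  case 0
  then show ?thesis using assms(2) by (simp add: linear_continuous_on)
next
  case (Suc j)
  then show ?thesis
    using Ck_on_SucI[where f' = "\<lambda>x. L"] assms bounded_linear_imp_has_derivative Ck_on_const by blast
qed

lemma Ck_on_add:
  assumes "open S" "Ck_on k f S" "Ck_on k g S"
  shows "Ck_on k (\<lambda>x. f x + g x) S"
  using assms(2,3)
proof (induction k arbitrary: f g)
  case 0
  then show ?case by (simp add: continuous_on_add)
next
  case (Suc k)
  show ?case
    by (rule Ck_on_SucI[OF assms(1) has_derivative_add[OF Ck_on_SucD(1)[OF Suc.prems(1)]
              Ck_on_SucD(1)[OF Suc.prems(2)]]])
      (use Suc.IH[OF Ck_on_SucD(2)[OF Suc.prems(1)] Ck_on_SucD(2)[OF Suc.prems(2)]] in auto)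
qed

lemma Ck_on_bounded_linear:
  assumes "open S" "bounded_linear L" "Ck_on k f S"
  shows "Ck_on k (\<lambda>x. L (f x)) S"
  using assms(3)
proof (induction k arbitrary: f)
  case 0
  then show ?case using assms(2) by (simp add: bounded_linear.continuous_on)
next
  case (Suc k)
  show ?case
    by (rule Ck_on_SucI[OF assms(1) bounded_linear.has_derivative[OF assms(2)
              Ck_on_SucD(1)[OF Suc.prems]]])
      (use Suc.IH[OF Ck_on_SucD(2)[OF Suc.prems]] in auto)
qed

lemma Ck_on_bilinear:
  assumes "open S" "bounded_bilinear B" "Ck_on k f S" "Ck_on k g S"
  shows "Ck_on k (\<lambda>x. B (f x) (g x)) S"
  using assms(3,4)
proof (induction k arbitrary: f g)
  case 0
  then show ?case using assms(2) by (simp add: bounded_bilinear.continuous_on)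
next
  case (Suc k)
  show ?case
    by (rule Ck_on_SucI[OF assms(1) bounded_bilinear.FDERIV[OF assms(2)
              Ck_on_SucD(1)[OF Suc.prems(1)] Ck_on_SucD(1)[OF Suc.prems(2)]]], assumption, assumption)
      (intro Ck_on_add[OF assms(1)] Suc.IH Ck_on_SucD(2)[OF Suc.prems(1)]
        Ck_on_SucD(2)[OF Suc.prems(2)] Ck_on_pred[OF Suc.prems(1)] Ck_on_pred[OF Suc.prems(2)])
qed

lemma Ck_on_sum:
  assumes "open S" "\<And>i. i \<in> I \<Longrightarrow> Ck_on k (f i) S"
  shows "Ck_on k (\<lambda>x. \<Sum>i\<in>I. f i x) S"
proof (cases "finite I")
  case True
  then show ?thesis
    using assms(2)
    by (induction I) (auto intro: Ck_on_const[OF assms(1)] Ck_on_add[OF assms(1)])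
next
  case False
  then show ?thesis by (simp add: Ck_on_const[OF assms(1)])
qed

lemma linear_eq_sum_Basis:
  fixes L :: "'a::euclidean_space \<Rightarrow> 'b::real_vector"
  assumes "linear L"
  shows "L v = (\<Sum>b\<in>Basis. (v \<bullet> b) *\<^sub>R L b)"
proof -
  have "L v = L (\<Sum>b\<in>Basis. (v \<bullet> b) *\<^sub>R b)"
    by (simp add: euclidean_representation)
  then show ?thesis
    by (simp add: linear_sum[OF assms] linear_cmul[OF assms])
qed

text \<open>
  In a basis the chain rule expresses the derivative of \<open>f \<circ> g\<close> as a finite sum of products of
  derivatives of \<open>g\<close> with functions \<open>y \<mapsto> Df(y) b\<close> composed with \<open>g\<close>, to which the induction hypothesis applies.
\<close>

lemma Ck_on_compose:
  fixes g :: "'a::real_normed_vector \<Rightarrow> 'b::euclidean_space"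
  assumes "open S" "open T" "Ck_on k g S" "Ck_on k f T" "g ` S \<subseteq> T"
  shows "Ck_on k (\<lambda>x. f (g x)) S"
  using assms(3,4)
proof (induction k arbitrary: f)
  case 0
  then show ?case
    using assms(5) continuous_on_compose2[of T f S g] by simp
next
  case (Suc k)
  let ?f' = "\<lambda>x. frechet_derivative f (at x)" and ?g' = "\<lambda>x. frechet_derivative g (at x)"
  have gT: "g x \<in> T" if "x \<in> S" for x
    using assms(5) that by blast
  have d: "((\<lambda>x. f (g x)) has_derivative (\<lambda>v. \<Sum>b\<in>Basis. (?g' x v \<bullet> b) *\<^sub>R ?f' (g x) b)) (at x)"
    if "x \<in> S" for x
  proof -
    have f: "(f has_derivative ?f' (g x)) (at (g x))"
      by (rule Ck_on_SucD(1)[OF Suc.prems(2) gT[OF that]])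
    have "((\<lambda>x. f (g x)) has_derivative (\<lambda>v. ?f' (g x) (?g' x v))) (at x)"
      using diff_chain_at[OF Ck_on_SucD(1)[OF Suc.prems(1) that] f] by (simp add: o_def)
    then show ?thesis
      by (subst linear_eq_sum_Basis[OF has_derivative_linear[OF f], symmetric])
  qed
  have f'g: "Ck_on k (\<lambda>x. ?f' (g x) b) S" for b
    by (rule Suc.IH[OF Ck_on_pred[OF Suc.prems(1)] Ck_on_SucD(2)[OF Suc.prems(2)]])
  have "Ck_on k (\<lambda>x. (?g' x v \<bullet> b) *\<^sub>R ?f' (g x) b) S" for v b
    by (intro Ck_on_bilinear[OF assms(1) bounded_bilinear_scaleR] f'g
        Ck_on_bounded_linear[OF assms(1) bounded_linear_inner_left] Ck_on_SucD(2)[OF Suc.prems(1)])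
  then show ?case
    by (intro Ck_on_SucI[OF assms(1) d] Ck_on_sum[OF assms(1)])
qed

lemma Ck_on_inverse: "Ck_on k (inverse :: 'a::real_normed_field \<Rightarrow> 'a) (- {0})"
proof (induction k)
  case 0
  then show ?case by (auto intro!: continuous_on_inverse)
next
  case (Suc k)
  have o: "open (- {0::'a})" by auto
  have "Ck_on k (\<lambda>x. - (inverse x * v * inverse x)) (- {0})" for v :: 'a
    by (rule Ck_on_bounded_linear[OF o bounded_linear_minus[OF bounded_linear_ident]])
      (intro Ck_on_bilinear[OF o bounded_bilinear_mult] Suc Ck_on_const o)
  then show ?case
    by (intro Ck_on_SucI[OF o, where f' = "\<lambda>x v. - (inverse x * v * inverse x)"]
        has_derivative_inverse') auto
qed

lemma Ck_on_sqrt: "Ck_on k sqrt {0<..}"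
proof (induction k)
  case 0
  then show ?case by (auto intro!: continuous_intros)
next
  case (Suc k)
  have o: "open {0::real<..}" by auto
  have "Ck_on k (\<lambda>x. inverse (sqrt x)) {0<..}"
    by (rule Ck_on_compose[OF o _ Suc Ck_on_inverse]) auto
  then have "Ck_on k (\<lambda>x. v * (inverse (sqrt x) / 2)) {0<..}" for v :: real
    unfolding divide_inverse
    by (intro Ck_on_bilinear[OF o bounded_bilinear_mult] Ck_on_const[OF o])
  moreover have "(sqrt has_derivative (*) (inverse (sqrt x) / 2)) (at x)" if "x \<in> {0<..}" for x
    using DERIV_real_sqrt[of x] that by (simp add: has_field_derivative_def mult.commute)
  ultimately show ?case
    by (intro Ck_on_SucI[OF o, of _ "\<lambda>x. (*) (inverse (sqrt x) / 2)"]) (auto simp: mult.commute)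
qed

lemma Ck_on_arctan: "Ck_on k arctan UNIV"
proof (cases k)
  case 0
  then show ?thesis by (auto intro!: continuous_intros)
next
  case (Suc j)
  have nz: "0 \<noteq> 1 + x\<^sup>2" for x :: real
    using zero_le_power2[of x] by linarith
  have 0: "range (\<lambda>x::real. 1 + x * x) \<subseteq> - {0}"
  proof
    fix y :: real assume "y \<in> range (\<lambda>x. 1 + x * x)"
    then obtain x where "y = 1 + x\<^sup>2" by (auto simp: power2_eq_square)
    then show "y \<in> - {0}" using nz[of x] by simp
  qed
  have 1: "Ck_on j (\<lambda>x::real. 1 + x * x) UNIV"
    by (intro Ck_on_add Ck_on_const Ck_on_bilinear[OF _ bounded_bilinear_mult]
        Ck_on_linear bounded_linear_ident open_UNIV)
  have "Ck_on j (\<lambda>x::real. inverse (1 + x * x)) UNIV"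
    by (rule Ck_on_compose[where f = inverse, OF open_UNIV open_Compl[OF closed_singleton] 1
          Ck_on_inverse 0])
  then have 2: "Ck_on j (\<lambda>x::real. inverse (1 + x\<^sup>2)) UNIV"
    unfolding power2_eq_square .
  have 3: "Ck_on j (\<lambda>x. v * inverse (1 + x\<^sup>2)) UNIV" for v :: real
    by (rule Ck_on_bilinear[OF open_UNIV bounded_bilinear_mult Ck_on_const[OF open_UNIV] 2])
  have 4: "(arctan has_derivative (\<lambda>v. v * inverse (1 + x\<^sup>2))) (at x)" for x
    using DERIV_arctan[of x] unfolding has_field_derivative_def mult_commute_abs .
  show ?thesis
    unfolding Suc by (rule Ck_on_SucI[OF open_UNIV 4 3])
qed

lemma has_derivative_cis: "(cis has_derivative (\<lambda>v. of_real v * (\<i> * cis x))) (at x)"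
proof -
  have "((\<lambda>t. exp (t *\<^sub>R \<i>)) has_vector_derivative exp (x *\<^sub>R \<i>) * \<i>) (at x)"
    by (rule exp_scaleR_has_vector_derivative_right)
  then show ?thesis
    by (simp add: has_vector_derivative_def cis_conv_exp[abs_def] scaleR_conv_of_real mult_ac)
qed

lemma Ck_on_cis: "Ck_on k cis UNIV"
proof (induction k)
  case 0
  show ?case
    by (auto intro!: continuous_at_imp_continuous_on has_derivative_continuous has_derivative_cis)
next
  case (Suc k)
  have "Ck_on k (\<lambda>x. of_real v * (\<i> * cis x)) UNIV" for v
    by (intro Ck_on_bilinear[OF _ bounded_bilinear_mult] Ck_on_const Suc) auto
  then show ?case by (intro Ck_on_SucI[OF _ has_derivative_cis]) auto
qed

lemma smooth_on_cong:
  "open S \<Longrightarrow> (\<And>x. x \<in> S \<Longrightarrow> f x = g x) \<Longrightarrow> smooth_on S f \<Longrightarrow> smooth_on S g"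
  unfolding smooth_on_def by (auto intro: Ck_on_cong)

lemma smooth_on_subset: "smooth_on S f \<Longrightarrow> T \<subseteq> S \<Longrightarrow> smooth_on T f"
  unfolding smooth_on_def by (auto intro: Ck_on_subset)

lemma smooth_on_const: "open S \<Longrightarrow> smooth_on S (\<lambda>x. c)"
  unfolding smooth_on_def by (auto intro!: Ck_on_const)

lemma smooth_on_add:
  "open S \<Longrightarrow> smooth_on S f \<Longrightarrow> smooth_on S g \<Longrightarrow> smooth_on S (\<lambda>x. f x + g x)"
  unfolding smooth_on_def by (rule allI, rule Ck_on_add) (assumption | erule spec)+

lemma smooth_on_bounded_linear:
  "open S \<Longrightarrow> bounded_linear L \<Longrightarrow> smooth_on S f \<Longrightarrow> smooth_on S (\<lambda>x. L (f x))"
  unfolding smooth_on_def by (rule allI, rule Ck_on_bounded_linear) (assumption | erule spec)+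

lemma smooth_on_ident: "open S \<Longrightarrow> smooth_on S (\<lambda>x. x)"
  unfolding smooth_on_def by (auto intro: Ck_on_linear bounded_linear_ident)

lemma smooth_on_bilinear:
  "open S \<Longrightarrow> bounded_bilinear B \<Longrightarrow> smooth_on S f \<Longrightarrow> smooth_on S g \<Longrightarrow> smooth_on S (\<lambda>x. B (f x) (g x))"
  unfolding smooth_on_def by (rule allI, rule Ck_on_bilinear) (assumption | erule spec)+

lemma smooth_on_sum:
  "open S \<Longrightarrow> (\<And>i. i \<in> I \<Longrightarrow> smooth_on S (f i)) \<Longrightarrow> smooth_on S (\<lambda>x. \<Sum>i\<in>I. f i x)"
  unfolding smooth_on_def by (auto intro!: Ck_on_sum)

lemma smooth_on_compose:
  fixes g :: "'a::real_normed_vector \<Rightarrow> 'b::euclidean_space"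
  shows "open S \<Longrightarrow> open T \<Longrightarrow> smooth_on S g \<Longrightarrow> smooth_on T f \<Longrightarrow> g ` S \<subseteq> T
    \<Longrightarrow> smooth_on S (\<lambda>x. f (g x))"
  unfolding smooth_on_def by (rule allI, rule Ck_on_compose) (assumption | erule spec)+

lemma smooth_on_mult:
  fixes f g :: "'a::real_normed_vector \<Rightarrow> 'b::real_normed_algebra"
  shows "open S \<Longrightarrow> smooth_on S f \<Longrightarrow> smooth_on S g \<Longrightarrow> smooth_on S (\<lambda>x. f x * g x)"
  by (rule smooth_on_bilinear[OF _ bounded_bilinear_mult])

lemma smooth_on_scaleR:
  "open S \<Longrightarrow> smooth_on S f \<Longrightarrow> smooth_on S g \<Longrightarrow> smooth_on S (\<lambda>x. f x *\<^sub>R g x)"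
  by (rule smooth_on_bilinear[OF _ bounded_bilinear_scaleR])

lemma smooth_on_inner:
  "open S \<Longrightarrow> smooth_on S f \<Longrightarrow> smooth_on S g \<Longrightarrow> smooth_on S (\<lambda>x. f x \<bullet> g x)"
  by (rule smooth_on_bilinear[OF _ bounded_bilinear_inner])

lemma smooth_on_minus: "open S \<Longrightarrow> smooth_on S f \<Longrightarrow> smooth_on S (\<lambda>x. - f x)"
  by (rule smooth_on_bounded_linear[OF _ bounded_linear_minus[OF bounded_linear_ident]])

lemma smooth_on_inverse:
  fixes f :: "'a::real_normed_vector \<Rightarrow> 'b::{real_normed_field,euclidean_space}"
  assumes "open S" "smooth_on S f" "\<And>x. x \<in> S \<Longrightarrow> f x \<noteq> 0"
  shows "smooth_on S (\<lambda>x. inverse (f x))"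
  by (rule smooth_on_compose[OF assms(1) _ assms(2), of "- {0}"])
    (use assms(3) in \<open>auto simp: smooth_on_def Ck_on_inverse\<close>)

lemma smooth_on_divide:
  fixes f :: "'a::real_normed_vector \<Rightarrow> 'b::{real_normed_field,euclidean_space}"
  assumes "open S" "smooth_on S f" "smooth_on S g" "\<And>x. x \<in> S \<Longrightarrow> g x \<noteq> 0"
  shows "smooth_on S (\<lambda>x. f x / g x)"
  unfolding divide_inverse by (intro smooth_on_mult smooth_on_inverse assms)

lemma smooth_on_sqrt:
  assumes "open S" "smooth_on S f" "\<And>x. x \<in> S \<Longrightarrow> f x > 0"
  shows "smooth_on S (\<lambda>x. sqrt (f x))"
  by (rule smooth_on_compose[OF assms(1) _ assms(2), of "{0<..}"])
    (use assms(3) in \<open>auto simp: smooth_on_def Ck_on_sqrt\<close>)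

lemma smooth_on_arctan: "open S \<Longrightarrow> smooth_on S f \<Longrightarrow> smooth_on S (\<lambda>x. arctan (f x))"
  by (rule smooth_on_compose[of S UNIV]) (auto simp: smooth_on_def Ck_on_arctan)

lemma smooth_on_cis: "open S \<Longrightarrow> smooth_on S f \<Longrightarrow> smooth_on S (\<lambda>x. cis (f x))"
  by (rule smooth_on_compose[of S UNIV]) (auto simp: smooth_on_def Ck_on_cis)

lemma smooth_on_vec_nth:
  fixes f :: "'a::real_normed_vector \<Rightarrow> ('b::euclidean_space) ^ 'k::finite"
  shows "open S \<Longrightarrow> smooth_on S f \<Longrightarrow> smooth_on S (\<lambda>x. f x $ i)"
  by (rule smooth_on_bounded_linear[OF _ bounded_linear_vec_nth])

lemma smooth_on_vec_lambda:
  fixes f :: "'k::finite \<Rightarrow> 'a::real_normed_vector \<Rightarrow> 'b::euclidean_space"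
  assumes "open S" "\<And>i. smooth_on S (f i)"
  shows "smooth_on S (\<lambda>x. \<chi> i. f i x)"
proof -
  have "bounded_linear (axis i :: 'b \<Rightarrow> 'b ^ 'k)" for i
    by (auto intro!: linear_conv_bounded_linear[THEN iffD1] linearI simp: axis_def vec_eq_iff)
  then have "smooth_on S (\<lambda>x. \<Sum>i\<in>UNIV. axis i (f i x))"
    by (intro smooth_on_sum assms smooth_on_bounded_linear[where L = "axis _"])
  moreover have "(\<Sum>i\<in>UNIV. axis i (f i x)) = (\<chi> i. f i x)" for x
    by (auto simp: axis_def vec_eq_iff if_distrib cong: if_cong)
  ultimately show ?thesis by simp
qed

lemma smooth_on_imp_has_derivative:
  "smooth_on S f \<Longrightarrow> x \<in> S \<Longrightarrow> (f has_derivative frechet_derivative f (at x)) (at x)"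
  using Ck_on_SucD(1)[of 0 f S x] unfolding smooth_on_def by blast

lemma smooth_on_imp_continuous_on: "smooth_on S f \<Longrightarrow> continuous_on S f"
  using Ck_on_imp_continuous_on by (auto simp: smooth_on_def)

lemma smooth_on_frechet_derivative_const:
  "smooth_on S f \<Longrightarrow> smooth_on S (\<lambda>x. frechet_derivative f (at x) v)"
  using Ck_on_SucD(2) unfolding smooth_on_def by blast

lemma smooth_on_frechet_derivative:
  fixes f :: "'a::euclidean_space \<Rightarrow> 'b::real_normed_vector"
  assumes "open S" "smooth_on S f" "smooth_on S w"
  shows "smooth_on S (\<lambda>x. frechet_derivative f (at x) (w x))"
proof -
  let ?g = "\<lambda>x. \<Sum>b\<in>Basis. (w x \<bullet> b) *\<^sub>R frechet_derivative f (at x) b"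
  have "smooth_on S ?g"
    by (intro smooth_on_sum smooth_on_scaleR smooth_on_inner smooth_on_const
        smooth_on_frechet_derivative_const assms)
  moreover have "?g x = frechet_derivative f (at x) (w x)" if "x \<in> S" for x
    by (rule linear_eq_sum_Basis[OF has_derivative_linear[OF smooth_on_imp_has_derivative[OF
            assms(2) that]], symmetric])
  ultimately show ?thesis by (rule smooth_on_cong[OF assms(1), rotated])
qed

lemma smooth_onI_has_derivative:
  assumes "open S" "\<And>x. x \<in> S \<Longrightarrow> (f has_derivative f' x) (at x)" "\<And>v. smooth_on S (\<lambda>x. f' x v)"
  shows "smooth_on S f"
  unfolding smooth_on_def
proof
  fix k
  have "Ck_on (Suc k) f S"
    by (rule Ck_on_SucI[OF assms(1,2)]) (use assms(3) in \<open>auto simp: smooth_on_def\<close>)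
  then show "Ck_on k f S" by (rule Ck_on_pred)
qed

text \<open>
  A second difference over a parallelogram with sides \<open>hu\<close> and \<open>hv\<close> is, by the mean value theorem used
  twice, \<open>h\<^sup>2\<close> times the iterated derivative at some point of the parallelogram; exchanging its two
  sides gives the symmetry of second derivatives.
\<close>

lemma second_difference_mean_value:
  fixes f :: "'a::real_normed_vector \<Rightarrow> real"
  assumes "0 < h"
    and S: "\<And>s t. 0 \<le> s \<Longrightarrow> s \<le> h \<Longrightarrow> 0 \<le> t \<Longrightarrow> t \<le> h \<Longrightarrow> x + s *\<^sub>R u + t *\<^sub>R v \<in> S"
    and f: "\<And>y. y \<in> S \<Longrightarrow> (f has_derivative f' y) (at y)"
    and f': "\<And>y. y \<in> S \<Longrightarrow> ((\<lambda>y. f' y u) has_derivative f'' y) (at y)"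
  shows "\<exists>s t. 0 \<le> s \<and> s \<le> h \<and> 0 \<le> t \<and> t \<le> h \<and>
    f (x + h *\<^sub>R u + h *\<^sub>R v) - f (x + h *\<^sub>R u) - (f (x + h *\<^sub>R v) - f x)
      = h * h * f'' (x + s *\<^sub>R u + t *\<^sub>R v) v"
proof -
  define \<phi> where "\<phi> s = f (x + s *\<^sub>R u + h *\<^sub>R v) - f (x + s *\<^sub>R u)" for s
  have line: "((\<lambda>s. F (a + s *\<^sub>R w)) has_field_derivative F' w) (at s)"
    if "(F has_derivative F') (at (a + s *\<^sub>R w))" for F :: "'a \<Rightarrow> real" and F' a w s
  proof -
    have "((\<lambda>s. F (a + s *\<^sub>R w)) has_derivative (\<lambda>r. F' (r *\<^sub>R w))) (at s)"
      by (rule has_derivative_compose[where f = "\<lambda>s. a + s *\<^sub>R w", OF _ that])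
        (auto intro!: derivative_eq_intros)
    then show ?thesis
      using has_derivative_linear[OF that]
      by (simp add: has_field_derivative_def linear_cmul mult_commute_abs)
  qed
  have "(\<phi> has_field_derivative f' (x + s *\<^sub>R u + h *\<^sub>R v) u - f' (x + s *\<^sub>R u) u) (at s)"
    if "0 \<le> s" "s \<le> h" for s
  proof -
    have 1: "(f has_derivative f' (x + s *\<^sub>R u + h *\<^sub>R v)) (at ((x + h *\<^sub>R v) + s *\<^sub>R u))"
      using f[OF S[OF that, of h]] \<open>0 < h\<close> by (simp add: add_ac)
    have 2: "(f has_derivative f' (x + s *\<^sub>R u)) (at (x + s *\<^sub>R u))"
      using f[OF S[OF that, of 0]] \<open>0 < h\<close> by simp
    show ?thesis
      unfolding \<phi>_def using DERIV_diff[OF line[OF 1] line[OF 2]] by (simp add: add_ac)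
  qed
  then obtain s where s: "0 < s" "s < h"
    "\<phi> h - \<phi> 0 = (h - 0) * (f' (x + s *\<^sub>R u + h *\<^sub>R v) u - f' (x + s *\<^sub>R u) u)"
    using MVT2[of 0 h \<phi> "\<lambda>s. f' (x + s *\<^sub>R u + h *\<^sub>R v) u - f' (x + s *\<^sub>R u) u"] \<open>0 < h\<close>
    by auto
  have "((\<lambda>t. f' (x + s *\<^sub>R u + t *\<^sub>R v) u) has_field_derivative f'' (x + s *\<^sub>R u + t *\<^sub>R v) v) (at t)"
    if "0 \<le> t" "t \<le> h" for t
    using line[OF f'[OF S[of s t]]] s that by simp
  then obtain t where t: "0 < t" "t < h"
    "f' (x + s *\<^sub>R u + h *\<^sub>R v) u - f' (x + s *\<^sub>R u + 0 *\<^sub>R v) u = (h - 0) * f'' (x + s *\<^sub>R u + t *\<^sub>R v) v"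
    using MVT2[of 0 h "\<lambda>t. f' (x + s *\<^sub>R u + t *\<^sub>R v) u" "\<lambda>t. f'' (x + s *\<^sub>R u + t *\<^sub>R v) v"] \<open>0 < h\<close>
    by auto
  then show ?thesis
    using s by (intro exI[of _ s] exI[of _ t]) (simp add: \<phi>_def)
qed

lemma second_derivative_symmetric_real:
  fixes f :: "'a::real_normed_vector \<Rightarrow> real"
  assumes "open S" "smooth_on S f" "x \<in> S"
  shows "frechet_derivative (\<lambda>y. frechet_derivative f (at y) u) (at x) v
       = frechet_derivative (\<lambda>y. frechet_derivative f (at y) v) (at x) u"
proof (rule ccontr)
  let ?F = "\<lambda>u v y. frechet_derivative (\<lambda>y. frechet_derivative f (at y) u) (at y) v"
  assume neq: "?F u v x \<noteq> ?F v u x"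
  define e where "e = \<bar>?F u v x - ?F v u x\<bar> / 2"
  have "e > 0" using neq by (simp add: e_def)
  have c: "continuous (at x) (?F a b)" for a b
    using smooth_on_imp_continuous_on[OF smooth_on_frechet_derivative_const[OF
          smooth_on_frechet_derivative_const[OF assms(2)]]] assms(1,3)
    by (simp add: continuous_on_eq_continuous_at)
  obtain d1 where d1: "d1 > 0" "\<And>y. dist y x < d1 \<Longrightarrow> dist (?F u v y) (?F u v x) < e"
    using c[of u v] \<open>e > 0\<close> unfolding continuous_at_eps_delta by blast
  obtain d2 where d2: "d2 > 0" "\<And>y. dist y x < d2 \<Longrightarrow> dist (?F v u y) (?F v u x) < e"
    using c[of v u] \<open>e > 0\<close> unfolding continuous_at_eps_delta by blast
  obtain d3 where d3: "d3 > 0" "\<And>y. dist y x < d3 \<Longrightarrow> y \<in> S"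
    using assms(1,3) unfolding open_dist by blast
  define d where "d = min d1 (min d2 d3)"
  define h where "h = d / (norm u + norm v + 1)"
  have N: "norm u + norm v + 1 > 0" by (simp add: add_nonneg_pos)
  have "d > 0" using d1 d2 d3 by (simp add: d_def)
  then have "h > 0" using N by (simp add: h_def)
  have near: "dist (x + s *\<^sub>R u + t *\<^sub>R v) x < d" "dist (x + t *\<^sub>R v + s *\<^sub>R u) x < d"
    if "0 \<le> s" "s \<le> h" "0 \<le> t" "t \<le> h" for s t
  proof -
    have "norm (s *\<^sub>R u + t *\<^sub>R v) \<le> s * norm u + t * norm v"
      using norm_triangle_ineq[of "s *\<^sub>R u" "t *\<^sub>R v"] that by simp
    also have "\<dots> \<le> h * norm u + h * norm v"
      using that by (intro add_mono mult_right_mono) auto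
    also have "\<dots> < h * (norm u + norm v + 1)"
      using \<open>h > 0\<close> by (simp add: algebra_simps)
    also have "\<dots> = d" using N by (simp add: h_def)
    finally show "dist (x + s *\<^sub>R u + t *\<^sub>R v) x < d" by (simp add: dist_norm algebra_simps)
    then show "dist (x + t *\<^sub>R v + s *\<^sub>R u) x < d" by (simp add: algebra_simps)
  qed
  have f1: "(f has_derivative frechet_derivative f (at y)) (at y)" if "y \<in> S" for y
    by (rule smooth_on_imp_has_derivative[OF assms(2) that])
  have f2: "((\<lambda>y. frechet_derivative f (at y) a) has_derivative
      frechet_derivative (\<lambda>y. frechet_derivative f (at y) a) (at y)) (at y)" if "y \<in> S" for y a
    by (rule smooth_on_imp_has_derivative[OF smooth_on_frechet_derivative_const[OF assms(2)] that])
  have inS: "x + s *\<^sub>R u + t *\<^sub>R v \<in> S" "x + t *\<^sub>R v + s *\<^sub>R u \<in> S"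
    if "0 \<le> s" "s \<le> h" "0 \<le> t" "t \<le> h" for s t
    using near[OF that] d3(2) by (auto simp: d_def)
  obtain s t where st: "0 \<le> s" "s \<le> h" "0 \<le> t" "t \<le> h"
    "f (x + h *\<^sub>R u + h *\<^sub>R v) - f (x + h *\<^sub>R u) - (f (x + h *\<^sub>R v) - f x)
      = h * h * ?F u v (x + s *\<^sub>R u + t *\<^sub>R v)"
    using second_difference_mean_value[OF \<open>h > 0\<close> inS(1) f1 f2] by blast
  obtain t' s' where st': "0 \<le> t'" "t' \<le> h" "0 \<le> s'" "s' \<le> h"
    "f (x + h *\<^sub>R v + h *\<^sub>R u) - f (x + h *\<^sub>R v) - (f (x + h *\<^sub>R u) - f x)
      = h * h * ?F v u (x + t' *\<^sub>R v + s' *\<^sub>R u)"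
    using second_difference_mean_value[OF \<open>h > 0\<close> inS(2) f1 f2] by blast
  have "h * h * ?F u v (x + s *\<^sub>R u + t *\<^sub>R v) = h * h * ?F v u (x + t' *\<^sub>R v + s' *\<^sub>R u)"
    using st(5) st'(5) by (simp add: algebra_simps)
  then have "?F u v (x + s *\<^sub>R u + t *\<^sub>R v) = ?F v u (x + t' *\<^sub>R v + s' *\<^sub>R u)"
    using \<open>h > 0\<close> by simp
  moreover have "dist (?F u v (x + s *\<^sub>R u + t *\<^sub>R v)) (?F u v x) < e"
    using near(1)[OF st(1-4)] d1(2) by (simp add: d_def)
  moreover have "dist (?F v u (x + t' *\<^sub>R v + s' *\<^sub>R u)) (?F v u x) < e"
    using near(2)[OF st'(3,4,1,2)] d2(2) by (simp add: d_def)
  ultimately show False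
    by (simp add: e_def dist_real_def abs_if split: if_splits)
qed

lemma second_derivative_symmetric:
  fixes f :: "'a::real_normed_vector \<Rightarrow> 'b::euclidean_space"
  assumes "open S" "smooth_on S f" "x \<in> S"
  shows "frechet_derivative (\<lambda>y. frechet_derivative f (at y) u) (at x) v
       = frechet_derivative (\<lambda>y. frechet_derivative f (at y) v) (at x) u"
proof (rule euclidean_eqI)
  fix b :: 'b assume "b \<in> Basis"
  have 1: "frechet_derivative (\<lambda>y. f y \<bullet> b) (at y) = (\<lambda>w. frechet_derivative f (at y) w \<bullet> b)"
    if "y \<in> S" for y
    by (rule frechet_derivative_at[symmetric])
      (intro has_derivative_inner_left smooth_on_imp_has_derivative[OF assms(2) that])
  have 2: "frechet_derivative (\<lambda>y. frechet_derivative (\<lambda>y. f y \<bullet> b) (at y) u) (at x) v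
      = frechet_derivative (\<lambda>y. frechet_derivative f (at y) u) (at x) v \<bullet> b" for u v
  proof -
    have "((\<lambda>y. frechet_derivative f (at y) u \<bullet> b) has_derivative
        (\<lambda>v. frechet_derivative (\<lambda>y. frechet_derivative f (at y) u) (at x) v \<bullet> b)) (at x)"
      by (intro has_derivative_inner_left smooth_on_imp_has_derivative[OF
            smooth_on_frechet_derivative_const[OF assms(2)] assms(3)])
    then have "((\<lambda>y. frechet_derivative (\<lambda>y. f y \<bullet> b) (at y) u) has_derivative
        (\<lambda>v. frechet_derivative (\<lambda>y. frechet_derivative f (at y) u) (at x) v \<bullet> b)) (at x)"
      by (rule has_derivative_transform_within_open[OF _ assms(1,3)]) (simp add: 1)
    from frechet_derivative_at[OF this] show ?thesis by metis
  qed
  have "smooth_on S (\<lambda>y. f y \<bullet> b)"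
    by (intro smooth_on_inner smooth_on_const assms)
  from second_derivative_symmetric_real[OF assms(1) this assms(3), of u v]
  show "frechet_derivative (\<lambda>y. frechet_derivative f (at y) u) (at x) v \<bullet> b
      = frechet_derivative (\<lambda>y. frechet_derivative f (at y) v) (at x) u \<bullet> b"
    by (simp add: 2)
qed

section \<open>The Hermitian product\<close>

definition herm :: "complex ^ 'm::finite \<Rightarrow> complex ^ 'm \<Rightarrow> complex" where
  "herm u v = (\<Sum>j\<in>UNIV. u $ j * cnj (v $ j))"

lemma herm_add_left: "herm (u + u') v = herm u v + herm u' v"
  and herm_add_right: "herm u (v + v') = herm u v + herm u v'"
  and herm_diff_left: "herm (u - u') v = herm u v - herm u' v"
  and herm_diff_right: "herm u (v - v') = herm u v - herm u v'"
  and herm_minus_left: "herm (- u) v = - herm u v"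
  and herm_minus_right: "herm u (- v) = - herm u v"
  by (simp_all add: herm_def algebra_simps sum.distrib sum_subtractf sum_negf)

lemma vec_scaleR_nth: "(r *\<^sub>R (u :: complex ^ 'm)) $ j = of_real r * u $ j"
  by (simp add: scaleR_conv_of_real[where 'a = complex])

lemma herm_scale_left: "herm (c *s u) v = c * herm u v"
  and herm_scale_right: "herm u (c *s v) = cnj c * herm u v"
  and herm_scaleR_left: "herm (r *\<^sub>R u) v = of_real r * herm u v"
  and herm_scaleR_right: "herm u (r *\<^sub>R v) = of_real r * herm u v"
  by (simp_all add: herm_def sum_distrib_left vec_scaleR_nth del: vector_scaleR_component)
    (simp_all add: mult_ac)

lemma herm_zero_left [simp]: "herm 0 v = 0" and herm_zero_right [simp]: "herm u 0 = 0"
  by (simp_all add: herm_def)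

lemmas herm_simps = herm_add_left herm_add_right herm_diff_left herm_diff_right herm_minus_left
  herm_minus_right herm_scale_left herm_scale_right herm_scaleR_left herm_scaleR_right

lemma cnj_herm: "cnj (herm u v) = herm v u"
  by (simp add: herm_def mult.commute)

lemma herm_eq_0_commute: "herm u v = 0 \<longleftrightarrow> herm v u = 0"
  using cnj_herm[of u v] cnj_herm[of v u] by (metis complex_cnj_zero)

lemma Re_herm: "Re (herm u v) = u \<bullet> v"
  by (simp add: herm_def inner_vec_def inner_complex_def)

lemma Im_herm: "Im (herm u v) = u \<bullet> (\<i> *s v)"
  by (simp add: Re_herm[symmetric] herm_scale_right)

lemma herm_self: "herm u u = of_real (u \<bullet> u)"
proof -
  have "Im (herm u u) = 0"
    using cnj_herm[of u u] by (metis cnj.simps(2) neg_equal_zero)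
  then show ?thesis by (simp add: complex_eq_iff Re_herm)
qed

lemma herm_self_norm: "herm u u = (of_real (norm u))\<^sup>2"
  by (simp add: herm_self power2_norm_eq_inner flip: of_real_power)

lemma herm_self_eq_0 [simp]: "herm u u = 0 \<longleftrightarrow> u = 0"
  by (simp add: herm_self)

text \<open>
  The two real orthogonality conditions are the real and the imaginary part of a Hermitian one.
\<close>

lemma horizontal_iff: "v \<in> horizontal z \<longleftrightarrow> herm v z = 0"
  by (auto simp: horizontal_def complex_eq_iff Re_herm Im_herm)

lemma scaleR_eq_scale: "r *\<^sub>R (v :: complex ^ 'm) = of_real r *s v"
  by (simp add: vec_eq_iff vec_scaleR_nth del: vector_scaleR_component)

lemma bounded_bilinear_herm: "bounded_bilinear herm"
  by (intro bilinear_conv_bounded_bilinear[THEN iffD1])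
    (simp add: bilinear_def linear_iff herm_simps scaleR_conv_of_real[where 'a = complex])

lemma cconj_simps:
  "cconj (u + v) = cconj u + cconj v" "cconj (u - v) = cconj u - cconj v"
  "cconj (c *s u) = cnj c *s cconj u" "cconj (r *\<^sub>R u) = r *\<^sub>R cconj u"
  "cconj (cconj u) = u" "cconj (- u) = - cconj u"
  by (simp_all add: cconj_def vec_eq_iff)

lemma herm_cconj_cconj: "herm (cconj u) (cconj v) = herm v u"
  by (simp add: herm_def cconj_def mult.commute)

lemma herm_cconj_commute: "herm u (cconj v) = herm v (cconj u)"
  by (simp add: herm_def cconj_def mult.commute)

lemma sum_squares_eq_herm: "(\<Sum>j\<in>UNIV. (z $ j)\<^sup>2) = herm z (cconj z)"
  by (simp add: herm_def cconj_def power2_eq_square)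

lemma bounded_linear_cconj: "bounded_linear cconj"
  by (intro linear_conv_bounded_linear[THEN iffD1] linearI) (simp_all add: cconj_simps)

lemma bounded_bilinear_scale: "bounded_bilinear ((*s) :: complex \<Rightarrow> complex ^ 'm::finite \<Rightarrow> _)"
  by (intro bilinear_conv_bounded_bilinear[THEN iffD1])
    (auto simp: bilinear_def linear_iff vec_eq_iff algebra_simps vec_scaleR_nth del: vector_scaleR_component)

section \<open>Complex lines and the affine charts\<close>

lemma self_in_cline: "z \<in> cline z"
  unfolding cline_def by (rule range_eqI[of _ _ 1]) simp

lemma cline_scale:
  assumes "c \<noteq> 0"
  shows "cline (c *s z) = cline z"
proof -
  have "range (\<lambda>d. d *s z) = range ((\<lambda>d. d *s z) \<circ> (\<lambda>d. d * c))"
    unfolding image_comp[symmetric] using assms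
    by (intro arg_cong[where f = "image _"]) (auto intro!: surjI[of _ "\<lambda>d. d / c", symmetric])
  then show ?thesis
    unfolding cline_def by (simp add: o_def)
qed

lemma cline_eqD:
  assumes "cline z = cline w" "z \<noteq> 0"
  obtains c where "c \<noteq> 0" "z = c *s w"
proof -
  have "z \<in> cline w" using assms(1) self_in_cline by metis
  then obtain c where "z = c *s w" by (auto simp: cline_def)
  then show thesis using that[of c] assms(2) by auto
qed

text \<open>
  Homogeneous versions of the affine charts: \<open>acoord\<close> computes the coordinates from any representative
  of a line, \<open>alift\<close> is the affine section with entry \<open>1\<close> at \<open>\<sigma> None\<close>, \<open>adir\<close> is the linear part of
  \<open>alift\<close>, and \<open>dacoord \<sigma> z\<close> is the derivative of \<open>acoord \<sigma>\<close> at \<open>z\<close>.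
\<close>

definition acoord :: "('k option \<Rightarrow> 'k option) \<Rightarrow> complex ^ 'k option \<Rightarrow> complex ^ 'k::finite" where
  "acoord \<sigma> z = (\<chi> i. z $ \<sigma> (Some i) / z $ \<sigma> None)"

definition adir :: "('k option \<Rightarrow> 'k option) \<Rightarrow> complex ^ 'k \<Rightarrow> complex ^ 'k::finite option" where
  "adir \<sigma> x = (\<chi> j. case inv \<sigma> j of None \<Rightarrow> 0 | Some i \<Rightarrow> x $ i)"

definition alift :: "('k option \<Rightarrow> 'k option) \<Rightarrow> complex ^ 'k \<Rightarrow> complex ^ 'k::finite option" where
  "alift \<sigma> x = (\<chi> j. case inv \<sigma> j of None \<Rightarrow> 1 | Some i \<Rightarrow> x $ i)"

definition dacoord :: "('k option \<Rightarrow> 'k option) \<Rightarrow> complex ^ 'k option \<Rightarrow> complex ^ 'k option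
    \<Rightarrow> complex ^ 'k::finite" where
  "dacoord \<sigma> z v = (\<chi> i. (v $ \<sigma> (Some i) * z $ \<sigma> None - z $ \<sigma> (Some i) * v $ \<sigma> None) / (z $ \<sigma> None)\<^sup>2)"

lemma bij_option_cases:
  assumes "bij \<sigma>"
  obtains "j = \<sigma> None" | i where "j = \<sigma> (Some i)"
  using assms by (metis bij_pointE option.exhaust)

lemma vec_eq_iff_bij:
  assumes "bij \<sigma>"
  shows "v = w \<longleftrightarrow> v $ \<sigma> None = w $ \<sigma> None \<and> (\<forall>i. v $ \<sigma> (Some i) = w $ \<sigma> (Some i))"
  using assms by (metis bij_option_cases vec_eq_iff)

lemma sum_bij_option:
  fixes f :: "'k::finite option \<Rightarrow> 'b::comm_monoid_add" and \<sigma> :: "'k option \<Rightarrow> 'k option"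
  assumes "bij \<sigma>"
  shows "(\<Sum>j\<in>UNIV. f j) = f (\<sigma> None) + (\<Sum>i\<in>UNIV. f (\<sigma> (Some i)))"
proof -
  have "(\<Sum>j\<in>UNIV. f j) = (\<Sum>j\<in>UNIV. f (\<sigma> j))"
    by (rule sum.reindex_bij_betw[OF assms, symmetric])
  also have "\<dots> = f (\<sigma> None) + (\<Sum>j\<in>range Some. f (\<sigma> j))"
    unfolding UNIV_option_conv by (subst sum.insert) (simp_all add: finite_range_Some)
  also have "(\<Sum>j\<in>range Some. f (\<sigma> j)) = (\<Sum>i\<in>UNIV. f (\<sigma> (Some i)))"
    by (simp add: sum.reindex)
  finally show ?thesis .
qed

lemma adir_nth [simp]: "bij \<sigma> \<Longrightarrow> adir \<sigma> x $ \<sigma> None = 0" "bij \<sigma> \<Longrightarrow> adir \<sigma> x $ \<sigma> (Some i) = x $ i"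
  by (simp_all add: adir_def bij_is_inj)

lemma alift_nth [simp]: "bij \<sigma> \<Longrightarrow> alift \<sigma> x $ \<sigma> None = 1" "bij \<sigma> \<Longrightarrow> alift \<sigma> x $ \<sigma> (Some i) = x $ i"
  by (simp_all add: alift_def bij_is_inj)

lemma alift_nonzero [simp]: "bij \<sigma> \<Longrightarrow> alift \<sigma> x \<noteq> 0"
  by (metis alift_nth(1) zero_index zero_neq_one)

lemma acoord_alift: "bij \<sigma> \<Longrightarrow> acoord \<sigma> (alift \<sigma> x) = x"
  by (simp add: acoord_def vec_eq_iff)

lemma alift_acoord:
  "bij \<sigma> \<Longrightarrow> z $ \<sigma> None \<noteq> 0 \<Longrightarrow> alift \<sigma> (acoord \<sigma> z) = (1 / z $ \<sigma> None) *s z"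
  by (simp add: vec_eq_iff_bij[of \<sigma>] acoord_def)

lemma alift_eq: "bij \<sigma> \<Longrightarrow> alift \<sigma> x = alift \<sigma> 0 + adir \<sigma> x"
  by (simp add: vec_eq_iff_bij[of \<sigma>])

lemma adir_simps:
  assumes "bij \<sigma>"
  shows "adir \<sigma> (u + v) = adir \<sigma> u + adir \<sigma> v" "adir \<sigma> (u - v) = adir \<sigma> u - adir \<sigma> v"
    "adir \<sigma> (c *s u) = c *s adir \<sigma> u" "adir \<sigma> (r *\<^sub>R u) = r *\<^sub>R adir \<sigma> u"
  using assms by (simp_all add: vec_eq_iff_bij[of \<sigma>])

lemma bounded_linear_adir: "bij \<sigma> \<Longrightarrow> bounded_linear (adir \<sigma>)"
  by (intro linear_conv_bounded_linear[THEN iffD1] linearI) (simp_all add: adir_simps)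

lemma has_derivative_alift: "bij \<sigma> \<Longrightarrow> (alift \<sigma> has_derivative adir \<sigma>) (at x)"
proof -
  assume "bij \<sigma>"
  then have "((\<lambda>x. alift \<sigma> 0 + adir \<sigma> x) has_derivative adir \<sigma>) (at x)"
    by (auto intro!: derivative_eq_intros bounded_linear_imp_has_derivative bounded_linear_adir)
  then show ?thesis by (simp add: alift_eq[OF \<open>bij \<sigma>\<close>, abs_def, symmetric])
qed

lemma herm_adir:
  assumes "bij \<sigma>"
  shows "herm (adir \<sigma> u) (adir \<sigma> v) = herm u v" "herm (adir \<sigma> u) (alift \<sigma> x) = herm u x"
    "herm (alift \<sigma> x) (alift \<sigma> x) = 1 + herm x x"
  using assms by (simp_all add: herm_def sum_bij_option[of \<sigma>])

lemma has_derivative_vec_lambda: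
  fixes f :: "'i::finite \<Rightarrow> 'a::real_normed_vector \<Rightarrow> 'b::euclidean_space"
  assumes "\<And>i. (f i has_derivative f' i) (at x)"
  shows "((\<lambda>x. \<chi> i. f i x) has_derivative (\<lambda>v. \<chi> i. f' i v)) (at x)"
proof -
  have bl: "bounded_linear (axis i :: 'b \<Rightarrow> 'b ^ 'i)" for i
    by (auto intro!: linear_conv_bounded_linear[THEN iffD1] linearI simp: axis_def vec_eq_iff)
  have eq: "(\<Sum>i\<in>UNIV. axis i (g i)) = (\<chi> i. g i)" for g :: "'i \<Rightarrow> 'b"
    by (auto simp: axis_def vec_eq_iff if_distrib cong: if_cong)
  have "((\<lambda>x. \<Sum>i\<in>UNIV. axis i (f i x)) has_derivative (\<lambda>v. \<Sum>i\<in>UNIV. axis i (f' i v))) (at x)"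
    by (intro has_derivative_sum bounded_linear.has_derivative[OF bl] assms)
  then show ?thesis by (simp add: eq)
qed

lemma has_derivative_acoord:
  assumes "z $ \<sigma> None \<noteq> 0"
  shows "(acoord \<sigma> has_derivative dacoord \<sigma> z) (at z)"
proof -
  have nth: "((\<lambda>z. z $ j) has_derivative (\<lambda>v. v $ j)) (at z)" for j
    by (rule bounded_linear_imp_has_derivative[OF bounded_linear_vec_nth])
  have "((\<lambda>z. z $ \<sigma> (Some i) / z $ \<sigma> None) has_derivative
      (\<lambda>v. (v $ \<sigma> (Some i) * z $ \<sigma> None - z $ \<sigma> (Some i) * v $ \<sigma> None) / (z $ \<sigma> None)\<^sup>2)) (at z)" for i
    by (rule has_derivative_eq_rhs[OF has_derivative_divide[OF nth nth assms]])
      (use assms in \<open>auto simp: field_simps power2_eq_square fun_eq_iff\<close>)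
  then show ?thesis
    unfolding acoord_def[abs_def] dacoord_def[abs_def] by (rule has_derivative_vec_lambda)
qed

text \<open>
  Multiplying a curve of representatives by a scalar function does not change the curve of lines. This
  is the infinitesimal version, which makes tangent vectors independent of the representative.
\<close>

lemma dacoord_homogeneous:
  assumes "c \<noteq> 0" "z $ \<sigma> None \<noteq> 0"
  shows "dacoord \<sigma> (c *s z) (c *s v + d *s z) = dacoord \<sigma> z v"
  using assms by (simp add: dacoord_def vec_eq_iff field_simps power2_eq_square)

lemma linear_dacoord: "linear (dacoord \<sigma> z)"
  by (rule linearI)
    (simp_all add: dacoord_def vec_eq_iff diff_divide_distrib add_divide_distrib vec_scaleR_nth
      algebra_simps del: vector_scaleR_component)

lemma adir_dacoord:
  assumes "bij \<sigma>" "z $ \<sigma> None \<noteq> 0"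
  shows "adir \<sigma> (dacoord \<sigma> z v) = (1 / z $ \<sigma> None) *s v + (- v $ \<sigma> None / (z $ \<sigma> None)\<^sup>2) *s z"
  using assms by (simp add: vec_eq_iff_bij[of \<sigma>] dacoord_def power2_eq_square field_simps)

lemma cline_in_cdom: "cline z \<in> cdom (affine_chart \<sigma>) \<longleftrightarrow> z $ \<sigma> None \<noteq> 0"
proof
  assume "cline z \<in> cdom (affine_chart \<sigma>)"
  then obtain w where w: "cline w = cline z" "w $ \<sigma> None \<noteq> 0"
    by (auto simp: affine_chart_def)
  then have "w \<noteq> 0" by auto
  then obtain c where "w = c *s z"
    using cline_eqD[OF w(1)] by blast
  then show "z $ \<sigma> None \<noteq> 0" using w(2) by auto
qed (auto simp: affine_chart_def)

lemma cmap_cline: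
  assumes "z $ \<sigma> None \<noteq> 0"
  shows "cmap (affine_chart \<sigma>) (cline z) = acoord \<sigma> z"
proof -
  define w where "w = (SOME w. w \<in> cline z \<and> w \<noteq> 0)"
  have "w \<in> cline z \<and> w \<noteq> 0"
    unfolding w_def by (rule someI[of _ z]) (use assms self_in_cline in auto)
  then obtain c where "w = c *s z" "c \<noteq> 0" by (auto simp: cline_def)
  then show ?thesis
    unfolding affine_chart_def acoord_def by (simp add: Let_def w_def[symmetric])
qed

lemma cinv_affine_chart:
  assumes "bij \<sigma>"
  shows "cinv (affine_chart \<sigma>) x = cline (alift \<sigma> x)"
proof (rule inv_into_f_eq)
  show "inj_on (cmap (affine_chart \<sigma>)) (cdom (affine_chart \<sigma>))"
  proof (rule inj_onI)
    fix L L' assume "L \<in> cdom (affine_chart \<sigma>)" "L' \<in> cdom (affine_chart \<sigma>)"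
      and eq: "cmap (affine_chart \<sigma>) L = cmap (affine_chart \<sigma>) L'"
    then obtain z w where z: "L = cline z" "z $ \<sigma> None \<noteq> 0" and w: "L' = cline w" "w $ \<sigma> None \<noteq> 0"
      by (auto simp: affine_chart_def)
    then have "acoord \<sigma> z = acoord \<sigma> w" using eq by (simp add: cmap_cline)
    then have "cline ((1 / z $ \<sigma> None) *s z) = cline ((1 / w $ \<sigma> None) *s w)"
      using z w assms by (metis alift_acoord)
    then show "L = L'" using z w by (simp add: cline_scale)
  qed
qed (use assms in \<open>auto simp: cline_in_cdom cmap_cline acoord_alift\<close>)

lemma cmap_image_affine_chart: "bij \<sigma> \<Longrightarrow> cmap (affine_chart \<sigma>) ` (cdom (affine_chart \<sigma>) \<inter> W) =
    {x. cline (alift \<sigma> x) \<in> W}"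
proof (intro set_eqI iffI)
  fix x assume "bij \<sigma>" "x \<in> cmap (affine_chart \<sigma>) ` (cdom (affine_chart \<sigma>) \<inter> W)"
  then obtain L where L: "L \<in> cdom (affine_chart \<sigma>)" "L \<in> W" "x = cmap (affine_chart \<sigma>) L"
    by blast
  then obtain z where "L = cline z" "z $ \<sigma> None \<noteq> 0"
    by (auto simp: affine_chart_def)
  then have z: "z $ \<sigma> None \<noteq> 0" "cline z \<in> W" "x = acoord \<sigma> z"
    using L by (auto simp: cmap_cline)
  then show "x \<in> {x. cline (alift \<sigma> x) \<in> W}"
    using \<open>bij \<sigma>\<close> by (simp add: alift_acoord cline_scale)
next
  fix x assume "bij \<sigma>" "x \<in> {x. cline (alift \<sigma> x) \<in> W}"
  then show "x \<in> cmap (affine_chart \<sigma>) ` (cdom (affine_chart \<sigma>) \<inter> W)"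
    by (intro image_eqI[of _ _ "cline (alift \<sigma> x)"]) (auto simp: cmap_cline acoord_alift cline_in_cdom)
qed

lemma charts_CP: "charts CP = {affine_chart \<sigma> |\<sigma>. bij \<sigma>}"
  by (simp add: CP_def)

lemma affine_chart_in_charts_at:
  "bij \<sigma> \<Longrightarrow> z $ \<sigma> None \<noteq> 0 \<Longrightarrow> affine_chart \<sigma> \<in> charts_at CP (cline z)"
  by (auto simp: charts_at_def charts_CP cline_in_cdom)

lemma charts_at_CP_E:
  assumes "c \<in> charts_at CP (cline z)"
  obtains \<sigma> where "bij \<sigma>" "c = affine_chart \<sigma>" "z $ \<sigma> None \<noteq> 0"
  using assms by (auto simp: charts_at_def charts_CP cline_in_cdom)

lemma exists_affine_chart:
  fixes z :: "complex ^ 'k::finite option"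
  assumes "z \<noteq> 0"
  obtains \<sigma> :: "'k option \<Rightarrow> 'k option" where "bij \<sigma>" "z $ \<sigma> None \<noteq> 0"
proof -
  obtain j where j: "z $ j \<noteq> 0" using assms by (auto simp: vec_eq_iff)
  show thesis
    by (rule that[of "Transposition.transpose None j"]) (use j in auto)
qed

text \<open>
  The cone of the nonzero vectors over an open set is its preimage under \<open>z \<mapsto> [z / |z|]\<close>. Working in
  the cone avoids the quotient topology.
\<close>

lemma open_cone:
  assumes "openin (mtop CP) (W :: 'k::finite cp set)"
  shows "open {z. z \<noteq> 0 \<and> cline z \<in> W}"
proof -
  have "openin (top_of_set (sphere 0 1)) {z \<in> sphere 0 1. cline z \<in> W}"
    using assms by (simp add: openin_CP)
  then obtain T where T: "open T" "{z \<in> sphere 0 1. cline z \<in> W} = sphere 0 1 \<inter> T"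
    by (auto simp: openin_open)
  have "z \<noteq> 0 \<and> cline z \<in> W \<longleftrightarrow> z \<noteq> 0 \<and> (1 / norm z) *\<^sub>R z \<in> T" for z
  proof (cases "z = 0")
    case False
    then have "cline ((1 / norm z) *\<^sub>R z) = cline z"
      by (simp add: scaleR_eq_scale cline_scale)
    moreover have "(1 / norm z) *\<^sub>R z \<in> sphere 0 1" using False by simp
    moreover have "(w \<in> sphere 0 1 \<and> cline w \<in> W) = (w \<in> sphere 0 1 \<and> w \<in> T)" for w
      using T(2) by (simp only: set_eq_iff Int_iff mem_Collect_eq)
    ultimately show ?thesis using False by metis
  qed simp
  then have "{z. z \<noteq> 0 \<and> cline z \<in> W} = - {0} \<inter> (\<lambda>z. (1 / norm z) *\<^sub>R z) -` T" by auto
  moreover have "continuous_on (- {0}) (\<lambda>z :: complex ^ 'k option. (1 / norm z) *\<^sub>R z)"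
    by (intro continuous_intros) auto
  note continuous_open_preimage[OF this open_Compl[OF closed_singleton] T(1)]
  ultimately show ?thesis by (simp only:)
qed

section \<open>The tangent spaces of the projective space\<close>

lemma has_derivative_transform_nhds:
  assumes "(f has_derivative D) (at x)" "eventually (\<lambda>y. f y = g y) (nhds x)"
  shows "(g has_derivative D) (at x)"
  by (rule has_derivative_transform_eventually[OF assms(1)])
    (use assms(2) eventually_nhds_x_imp_x[OF assms(2)] in
      \<open>auto simp: eventually_at_filter elim: eventually_mono\<close>)

lemma push_cline:
  assumes "(k has_derivative k') (at x)" "eventually (\<lambda>y. h y = cline (k y)) (nhds x)"
    "bij \<sigma>" "k x $ \<sigma> None \<noteq> 0"
  shows "push CP h x v (affine_chart \<sigma>) = dacoord \<sigma> (k x) (k' v)"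
proof -
  have hx: "h x = cline (k x)" using eventually_nhds_x_imp_x[OF assms(2)] .
  have "((\<lambda>y. acoord \<sigma> (k y)) has_derivative (\<lambda>v. dacoord \<sigma> (k x) (k' v))) (at x)"
    using diff_chain_at[OF assms(1) has_derivative_acoord[where \<sigma> = \<sigma>, OF assms(4)]] by (simp add: o_def)
  moreover have "eventually (\<lambda>y. acoord \<sigma> (k y) = (cmap (affine_chart \<sigma>) \<circ> h) y) (nhds x)"
  proof -
    have "isCont (\<lambda>y. k y $ \<sigma> None) x"
      using has_derivative_continuous[OF assms(1)] by (intro continuous_intros)
    then have "((\<lambda>y. k y $ \<sigma> None) \<longlongrightarrow> k x $ \<sigma> None) (nhds x)"
      unfolding isCont_def by (rule tendsto_at_iff_tendsto_nhds[THEN iffD1])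
    then have "eventually (\<lambda>y. k y $ \<sigma> None \<noteq> 0) (nhds x)"
      using assms(4) by (rule tendsto_imp_eventually_ne)
    with assms(2) show ?thesis
      by eventually_elim (simp add: cmap_cline)
  qed
  ultimately have "((cmap (affine_chart \<sigma>) \<circ> h) has_derivative (\<lambda>v. dacoord \<sigma> (k x) (k' v))) (at x)"
    by (rule has_derivative_transform_nhds)
  from frechet_derivative_at[OF this]
  show ?thesis
    unfolding push_def hx using affine_chart_in_charts_at[OF assms(3,4)] by metis
qed

lemma dhopf_affine_chart:
  "bij \<sigma> \<Longrightarrow> z $ \<sigma> None \<noteq> 0 \<Longrightarrow> dhopf z v (affine_chart \<sigma>) = dacoord \<sigma> z v"
  unfolding dhopf_def by (rule push_cline[where k = "\<lambda>z. z" and k' = "\<lambda>v. v"]) auto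

lemma dhopf_outside: "c \<notin> charts_at CP (cline z) \<Longrightarrow> dhopf z v c = 0"
  by (simp add: dhopf_def push_def)

text \<open>
  Velocities in the projective space are projections of velocities of lifts, which need not have
  constant length.
\<close>

lemma push_eq_dhopf:
  assumes "(k has_derivative k') (at x)" "eventually (\<lambda>y. h y = cline (k y)) (nhds x)"
  shows "push CP h x v = dhopf (k x) (k' v)"
proof
  fix c
  have hx: "h x = cline (k x)" using eventually_nhds_x_imp_x[OF assms(2)] .
  show "push CP h x v c = dhopf (k x) (k' v) c"
  proof (cases "c \<in> charts_at CP (cline (k x))")
    case True
    then obtain \<sigma> where "bij \<sigma>" "c = affine_chart \<sigma>" "k x $ \<sigma> None \<noteq> 0"
      by (rule charts_at_CP_E)
    then show ?thesis using push_cline[OF assms] dhopf_affine_chart by metis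
  next
    case False
    then show ?thesis by (simp add: push_def dhopf_outside hx)
  qed
qed

lemma dhopf_eqI:
  assumes "cline z = cline w"
    "\<And>\<sigma>. bij \<sigma> \<Longrightarrow> z $ \<sigma> None \<noteq> 0 \<Longrightarrow> w $ \<sigma> None \<noteq> 0 \<Longrightarrow> dacoord \<sigma> z u = dacoord \<sigma> w v"
  shows "dhopf z u = dhopf w v"
proof
  fix c
  show "dhopf z u c = dhopf w v c"
  proof (cases "c \<in> charts_at CP (cline z)")
    case True
    then obtain \<sigma> where s: "bij \<sigma>" "c = affine_chart \<sigma>" "z $ \<sigma> None \<noteq> 0"
      by (rule charts_at_CP_E)
    then have "w $ \<sigma> None \<noteq> 0" using assms(1) cline_in_cdom by metis
    then show ?thesis using s assms(2) dhopf_affine_chart by metis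
  next
    case False
    then show ?thesis using assms(1) dhopf_outside by metis
  qed
qed

lemma dhopf_homogeneous:
  assumes "c \<noteq> 0"
  shows "dhopf (c *s z) (c *s v + d *s z) = dhopf z v"
  by (rule dhopf_eqI) (use assms in \<open>auto simp: cline_scale intro: dacoord_homogeneous\<close>)

lemma dhopf_add_vertical: "dhopf z (v + d *s z) = dhopf z v"
  using dhopf_homogeneous[of 1] by simp

lemma dhopf_pointwise_linear:
  "linear (\<lambda>v. dhopf z v c)"
proof (cases "c \<in> charts_at CP (cline z)")
  case True
  then obtain \<sigma> where s: "bij \<sigma>" "c = affine_chart \<sigma>" "z $ \<sigma> None \<noteq> 0"
    by (rule charts_at_CP_E)
  then show ?thesis by (simp add: dhopf_affine_chart linear_dacoord[unfolded eta_contract_eq])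
next
  case False
  then show ?thesis by (simp add: dhopf_outside linear_iff)
qed

lemma dhopf_diff: "dhopf z u - dhopf z v = dhopf z (u - v)"
  by (rule ext) (simp add: linear_diff[OF dhopf_pointwise_linear])

lemma dhopf_minus: "- dhopf z u = dhopf z (- u)"
  by (rule ext) (simp add: linear_neg[OF dhopf_pointwise_linear])

lemma tscale_dhopf: "tscale r (dhopf z u) = dhopf z (r *\<^sub>R u)"
  unfolding tscale_def by (rule ext) (simp add: linear_cmul[OF dhopf_pointwise_linear])

lemma dhopf_eq_iff:
  fixes z :: "complex ^ 'k::finite option"
  assumes "z \<noteq> 0"
  shows "dhopf z u = dhopf z v \<longleftrightarrow> (\<exists>d. u = v + d *s z)"
proof
  assume eq: "dhopf z u = dhopf z v"
  obtain \<sigma> :: "'k option \<Rightarrow> 'k option" where s: "bij \<sigma>" "z $ \<sigma> None \<noteq> 0"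
    using exists_affine_chart[OF assms] .
  then have "adir \<sigma> (dacoord \<sigma> z u) = adir \<sigma> (dacoord \<sigma> z v)"
    using eq by (metis dhopf_affine_chart)
  then have "(1 / z $ \<sigma> None) *s (u - v) = ((u $ \<sigma> None - v $ \<sigma> None) / (z $ \<sigma> None)\<^sup>2) *s z"
    using s by (simp add: adir_dacoord vec_eq_iff field_simps)
  then have "z $ \<sigma> None *s ((1 / z $ \<sigma> None) *s (u - v))
      = z $ \<sigma> None *s (((u $ \<sigma> None - v $ \<sigma> None) / (z $ \<sigma> None)\<^sup>2) *s z)" by simp
  then have "u - v = (z $ \<sigma> None * ((u $ \<sigma> None - v $ \<sigma> None) / (z $ \<sigma> None)\<^sup>2)) *s z"
    using s(2) by (simp only: vector_smult_assoc) simp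
  then have "u = v + (z $ \<sigma> None * ((u $ \<sigma> None - v $ \<sigma> None) / (z $ \<sigma> None)\<^sup>2)) *s z"
    by (simp only: diff_eq_eq add.commute)
  then show "\<exists>d. u = v + d *s z" by (rule exI)
qed (auto simp: dhopf_add_vertical)

text \<open>
  The lift of a tangent vector can be read off from its component in a single affine chart. The
  transformation law then determines the other components, and they agree with those of the
  projected lift because the transition maps are \<open>acoord \<tau> \<circ> alift \<sigma>\<close>.
\<close>

lemma tangent_space_CP:
  fixes z :: "complex ^ 'k::finite option"
  assumes "z \<noteq> 0"
  shows "tangent_space CP (cline z) = range (dhopf z)"
proof -
  have transition: "frechet_derivative (cmap (affine_chart \<tau>) \<circ> cinv (affine_chart \<sigma>)) (at (acoord \<sigma> z)) u
      = dacoord \<tau> z (z $ \<sigma> None *s adir \<sigma> u)"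
    if s: "bij \<sigma>" "z $ \<sigma> None \<noteq> 0" and t: "bij \<tau>" "z $ \<tau> None \<noteq> 0" for \<sigma> \<tau> :: "'k option \<Rightarrow> 'k option" and u
  proof -
    have al: "alift \<sigma> (acoord \<sigma> z) = (1 / z $ \<sigma> None) *s z"
      by (rule alift_acoord[OF s])
    have "push CP (cinv (affine_chart \<sigma>)) (acoord \<sigma> z) u (affine_chart \<tau>)
        = dacoord \<tau> (alift \<sigma> (acoord \<sigma> z)) (adir \<sigma> u)"
      by (rule push_cline[OF has_derivative_alift[OF s(1)]])
        (use s t in \<open>auto simp: cinv_affine_chart al\<close>)
    moreover have "affine_chart \<tau> \<in> charts_at CP (cinv (affine_chart \<sigma>) (acoord \<sigma> z))"
      using s t by (simp add: cinv_affine_chart al cline_scale affine_chart_in_charts_at)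
    ultimately show ?thesis
      using dacoord_homogeneous[of "1 / z $ \<sigma> None" z \<tau> "z $ \<sigma> None *s adir \<sigma> u" 0] s t
      by (simp add: push_def al)
  qed
  have inT: "dhopf z v \<in> tangent_space CP (cline z)" for v
  proof -
    have "dhopf z v d = frechet_derivative (cmap d \<circ> cinv c) (at (cmap c (cline z))) (dhopf z v c)"
      if cd: "c \<in> charts_at CP (cline z)" "d \<in> charts_at CP (cline z)" for c d
    proof -
      obtain \<sigma> where s: "bij \<sigma>" "c = affine_chart \<sigma>" "z $ \<sigma> None \<noteq> 0"
        using charts_at_CP_E[OF cd(1)] .
      obtain \<tau> where t: "bij \<tau>" "d = affine_chart \<tau>" "z $ \<tau> None \<noteq> 0"
        using charts_at_CP_E[OF cd(2)] .
      have "z $ \<sigma> None *s adir \<sigma> (dacoord \<sigma> z v) = 1 *s v + (- v $ \<sigma> None / z $ \<sigma> None) *s z"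
        using s by (simp add: adir_dacoord vec_eq_iff field_simps power2_eq_square)
      then show ?thesis
        using s t dacoord_homogeneous[of 1 z \<tau> v "- v $ \<sigma> None / z $ \<sigma> None"]
        by (simp add: dhopf_affine_chart cmap_cline transition)
    qed
    then show ?thesis
      unfolding tangent_space_def using dhopf_outside[of _ z] by blast
  qed
  have "X \<in> range (dhopf z)" if X: "X \<in> tangent_space CP (cline z)" for X
  proof -
    obtain \<sigma> :: "'k option \<Rightarrow> 'k option" where s: "bij \<sigma>" "z $ \<sigma> None \<noteq> 0"
      using exists_affine_chart[OF assms] .
    let ?v = "z $ \<sigma> None *s adir \<sigma> (X (affine_chart \<sigma>))"
    have "X = dhopf z ?v"
    proof
      fix c
      show "X c = dhopf z ?v c"
      proof (cases "c \<in> charts_at CP (cline z)")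
        case True
        then obtain \<tau> where t: "bij \<tau>" "c = affine_chart \<tau>" "z $ \<tau> None \<noteq> 0"
          by (rule charts_at_CP_E)
        have "X c = frechet_derivative (cmap c \<circ> cinv (affine_chart \<sigma>))
            (at (cmap (affine_chart \<sigma>) (cline z))) (X (affine_chart \<sigma>))"
          using X True affine_chart_in_charts_at[OF s] unfolding tangent_space_def by blast
        then show ?thesis
          using s t by (simp add: cmap_cline transition dhopf_affine_chart)
      next
        case False
        then have "X c = 0" using X unfolding tangent_space_def by blast
        then show ?thesis using False by (simp add: dhopf_outside)
      qed
    qed
    then show ?thesis by blast
  qed
  then show ?thesis using inT by blast
qed

lemma dhopf_eq_horizontal_iff:
  assumes "z \<noteq> 0" "herm u z = 0" "herm v z = 0"
  shows "dhopf z u = dhopf z v \<longleftrightarrow> u = v"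
proof
  assume "dhopf z u = dhopf z v"
  then obtain d where d: "u = v + d *s z" using dhopf_eq_iff[OF assms(1)] by blast
  then have "d * herm z z = 0" using assms by (simp add: herm_simps)
  then show "u = v" using d assms(1) by simp
qed simp

lemma hlift_dhopf:
  assumes "z \<noteq> 0" "herm v z = 0"
  shows "hlift z (dhopf z v) = v"
  unfolding hlift_def
  by (rule the_equality) (use assms in \<open>auto simp: horizontal_iff dhopf_eq_horizontal_iff\<close>)

lemma dhopf_horizontal_part: "dhopf z v = dhopf z (v - (herm v z / herm z z) *s z)"
  using dhopf_add_vertical[of z v "- (herm v z / herm z z)"] by (simp add: vec_eq_iff)

lemma herm_horizontal_part: "z \<noteq> 0 \<Longrightarrow> herm (v - (herm v z / herm z z) *s z) z = 0"
  by (simp add: herm_simps)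

lemma tangent_space_CP_horizontal:
  assumes "z \<noteq> 0" "X \<in> tangent_space CP (cline z)"
  obtains v where "herm v z = 0" "X = dhopf z v"
  using assms dhopf_horizontal_part herm_horizontal_part tangent_space_CP
  by (metis (no_types, lifting) imageE)

lemma unit_rep_cline:
  assumes "norm z = 1"
  obtains c where "norm c = 1" "unit_rep (cline z) = c *s z"
proof -
  have *: "unit_rep (cline z) \<in> sphere 0 1 \<and> cline (unit_rep (cline z)) = cline z"
    unfolding unit_rep_def by (rule someI[of _ z]) (use assms in auto)
  then obtain c where c: "unit_rep (cline z) = c *s z"
    using cline_eqD[of "unit_rep (cline z)" z] by fastforce
  have "c * cnj c = 1"
    using * assms herm_self_norm[of "c *s z"] herm_self_norm[of z] by (simp add: c herm_simps mult.commute)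
  then have "norm c = 1"
    by (metis complex_norm_square norm_ge_zero of_real_eq_1_iff power2_eq_1_iff abs_of_nonneg
        abs_neg_one norm_minus_cancel)
  then show thesis using c that by blast
qed

text \<open>
  Two representatives on the unit sphere differ by a phase, which multiplies horizontal lifts by the
  same phase and preserves the inner product. So any representative may be used for the metric and,
  likewise, for the complex structure.
\<close>

lemma gFS_dhopf:
  assumes "norm z = 1" "herm u z = 0" "herm v z = 0"
  shows "gFS (cline z) (dhopf z u) (dhopf z v) = u \<bullet> v"
proof -
  obtain c where c: "norm c = 1" "unit_rep (cline z) = c *s z"
    using unit_rep_cline[OF assms(1)] .
  have cc: "c * cnj c = 1" "c \<noteq> 0" using c(1) by (auto simp: complex_norm_square[symmetric])
  have nz: "c *s z \<noteq> 0" using assms(1) cc by (auto simp: vector_mul_eq_0)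
  have l: "hlift (c *s z) (dhopf z w) = c *s w" if "herm w z = 0" for w
    using hlift_dhopf[OF nz, of "c *s w"] dhopf_homogeneous[OF cc(2), of z w 0] that
    by (simp add: herm_simps)
  have "(c *s u) \<bullet> (c *s v) = Re ((c * cnj c) * herm u v)"
    by (simp add: Re_herm[symmetric] herm_simps mult_ac)
  then show ?thesis
    using cc by (simp add: gFS_def c l assms Re_herm)
qed

lemma cpJ_dhopf:
  assumes "norm z = 1" "herm v z = 0"
  shows "cpJ (cline z) (dhopf z v) = dhopf z (\<i> *s v)"
proof -
  obtain c where c: "norm c = 1" "unit_rep (cline z) = c *s z"
    using unit_rep_cline[OF assms(1)] .
  have c0: "c \<noteq> 0" using c(1) by auto
  have nz: "c *s z \<noteq> 0" using assms(1) c0 by (auto simp: vector_mul_eq_0)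
  have "hlift (c *s z) (dhopf z v) = c *s v"
    using hlift_dhopf[OF nz, of "c *s v"] dhopf_homogeneous[OF c0, of z v 0] assms(2)
    by (simp add: herm_simps)
  then show ?thesis
    using dhopf_homogeneous[OF c0, of z "\<i> *s v" 0] by (simp add: cpJ_def c mult.commute)
qed

section \<open>Differentials in one chart\<close>

lemma chart_facts:
  assumes "smooth_manifold M" "c \<in> charts M"
  shows "openin (mtop M) (cdom c)" "open (cmap c ` cdom c)" "inj_on (cmap c) (cdom c)"
    "homeomorphic_map (subtopology (mtop M) (cdom c)) (top_of_set (cmap c ` cdom c)) (cmap c)"
    "cdom c \<subseteq> carrier M"
proof -
  show 1: "openin (mtop M) (cdom c)" "open (cmap c ` cdom c)"
    "homeomorphic_map (subtopology (mtop M) (cdom c)) (top_of_set (cmap c ` cdom c)) (cmap c)"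
    using assms unfolding smooth_manifold_def by blast+
  then show "cdom c \<subseteq> carrier M" by (simp add: openin_subset)
  then show "inj_on (cmap c) (cdom c)"
    using homeomorphic_imp_injective_map[OF 1(3)] by (simp add: Int_absorb1)
qed

lemma smooth_transition:
  "smooth_manifold M \<Longrightarrow> c \<in> charts M \<Longrightarrow> d \<in> charts M
    \<Longrightarrow> smooth_on (cmap c ` (cdom c \<inter> cdom d)) (\<lambda>x. cmap d (cinv c x))"
  unfolding smooth_manifold_def o_def by blast

lemma exists_chart_at:
  assumes "smooth_manifold M" "p \<in> carrier M"
  obtains c where "c \<in> charts_at M p"
proof -
  have "p \<in> (\<Union>c\<in>charts M. cdom c)"
    using assms unfolding smooth_manifold_def by blast
  then show thesis using that unfolding charts_at_def by blast
qed

lemma charts_atD: "c \<in> charts_at M p \<Longrightarrow> c \<in> charts M" "c \<in> charts_at M p \<Longrightarrow> p \<in> cdom c"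
  by (simp_all add: charts_at_def)

lemma open_chart_image:
  assumes "smooth_manifold M" "c \<in> charts M" "openin (mtop M) W"
  shows "open (cmap c ` (cdom c \<inter> W))"
proof -
  note f = chart_facts[OF assms(1,2)]
  have "openin (subtopology (mtop M) (cdom c)) (cdom c \<inter> W)"
    using assms(3) by (metis inf_commute openin_subtopology_Int)
  then have "openin (top_of_set (cmap c ` cdom c)) (cmap c ` (cdom c \<inter> W))"
    using homeomorphic_map_openness[OF f(4), of "cdom c \<inter> W"] f(5)
    by (simp add: Int_absorb1)
  then show ?thesis using f(2) openin_open_eq by blast
qed

lemma openin_chart_preimage:
  assumes "smooth_manifold M" "c \<in> charts M" "open S"
  shows "openin (mtop M) {q \<in> cdom c. cmap c q \<in> S}"
proof -
  note f = chart_facts[OF assms(1,2)]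
  have "openin (subtopology (mtop M) (cdom c)) {q \<in> topspace (subtopology (mtop M) (cdom c)). cmap c q \<in> cmap c ` cdom c \<inter> S}"
    using homeomorphic_imp_continuous_map[OF f(4)] assms(3) f(2)
    by (intro openin_continuous_map_preimage[of _ "top_of_set (cmap c ` cdom c)"])
      (auto simp: openin_open_eq)
  moreover have "{q \<in> topspace (subtopology (mtop M) (cdom c)). cmap c q \<in> cmap c ` cdom c \<inter> S}
      = {q \<in> cdom c. cmap c q \<in> S}"
    using f(5) by auto
  ultimately show ?thesis using f(1) by (metis openin_trans_full)
qed

lemma smooth_funI:
  assumes "smooth_manifold M" "openin (mtop M) U"
    and "\<And>c. c \<in> charts M \<Longrightarrow> open (cmap c ` (cdom c \<inter> U)) \<Longrightarrow>
      smooth_on (cmap c ` (cdom c \<inter> U)) (\<lambda>x. f (cinv c x))"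
  shows "smooth_fun M U f"
  unfolding smooth_fun_def o_def using assms open_chart_image by blast

lemma smooth_funD: "smooth_fun M U f \<Longrightarrow> c \<in> charts M \<Longrightarrow> smooth_on (cmap c ` (cdom c \<inter> U)) (\<lambda>x. f (cinv c x))"
  unfolding smooth_fun_def o_def by blast

lemma smooth_fun_subset: "smooth_fun M U f \<Longrightarrow> W \<subseteq> U \<Longrightarrow> smooth_fun M W f"
  unfolding smooth_fun_def by (meson Int_mono image_mono order_refl smooth_on_subset)

lemma cinv_in_cdom: "x \<in> cmap c ` W \<Longrightarrow> W \<subseteq> cdom c \<Longrightarrow> inj_on (cmap c) (cdom c) \<Longrightarrow> cinv c x \<in> W"
  by (auto simp: subset_iff)

text \<open>
  Smoothness in one chart suffices, because the transition maps are smooth.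
\<close>

lemma smooth_funI_chart:
  assumes sm: "smooth_manifold M" and c: "c \<in> charts M" and W: "openin (mtop M) W" "W \<subseteq> cdom c"
    and f: "smooth_on (cmap c ` W) (\<lambda>x. f (cinv c x))"
  shows "smooth_fun M W f"
proof (rule smooth_funI[OF sm W(1)])
  fix d assume d: "d \<in> charts M" "open (cmap d ` (cdom d \<inter> W))"
  have inj: "inj_on (cmap c) (cdom c)" "inj_on (cmap d) (cdom d)"
    using chart_facts(3)[OF sm] c d by blast+
  have oW: "open (cmap c ` W)"
    using open_chart_image[OF sm c W(1)] W(2) by (simp add: Int_absorb1)
  have "smooth_on (cmap d ` (cdom d \<inter> W)) (\<lambda>x. cmap c (cinv d x))"
    by (rule smooth_on_subset[OF smooth_transition[OF sm d(1) c]]) (use W(2) in auto)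
  then have "smooth_on (cmap d ` (cdom d \<inter> W)) (\<lambda>x. f (cinv c (cmap c (cinv d x))))"
    by (rule smooth_on_compose[OF d(2) oW _ f]) (use inj in auto)
  then show "smooth_on (cmap d ` (cdom d \<inter> W)) (\<lambda>x. f (cinv d x))"
    by (rule smooth_on_cong[OF d(2), rotated]) (use inj W(2) in \<open>auto simp: subset_iff\<close>)
qed

text \<open>
  Smooth functions are continuous: near each point the preimage is described by a chart.
\<close>

lemma openin_smooth_preimage:
  assumes sm: "smooth_manifold (M :: ('a, 'b::euclidean_space) manifold)" and U: "openin (mtop M) U"
    and f: "smooth_fun M U f" and S: "open S"
  shows "openin (mtop M) {q \<in> U. f q \<in> S}"
proof -
  define T where "T c = cmap (c :: ('a, 'b) chart) ` (cdom c \<inter> U) \<inter> (\<lambda>x. f (cinv c x)) -` S" for c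
  have "open (T c)" if "c \<in> charts M" for c
    unfolding T_def
    by (rule continuous_open_preimage[OF smooth_on_imp_continuous_on[OF smooth_funD[OF f that]]
          open_chart_image[OF sm that U] S])
  then have "openin (mtop M) (\<Union>c\<in>charts M. {q \<in> cdom c. cmap c q \<in> T c})"
    using openin_chart_preimage[OF sm] by (intro openin_Union) auto
  moreover have "(\<Union>c\<in>charts M. {q \<in> cdom c. cmap c q \<in> T c}) = {q \<in> U. f q \<in> S}"
  proof (intro set_eqI iffI)
    fix q assume "q \<in> (\<Union>c\<in>charts M. {q \<in> cdom c. cmap c q \<in> T c})"
    then obtain c where c: "c \<in> charts M" "q \<in> cdom c" "cmap c q \<in> T c" by blast
    then have "q \<in> U"
      using chart_facts(3)[OF sm c(1)] unfolding T_def inj_on_def by blast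
    then show "q \<in> {q \<in> U. f q \<in> S}"
      using c chart_facts(3)[OF sm c(1)] by (simp add: T_def)
  next
    fix q assume q: "q \<in> {q \<in> U. f q \<in> S}"
    then have "q \<in> carrier M" using openin_subset[OF U] by blast
    then obtain c where c: "c \<in> charts_at M q" by (rule exists_chart_at[OF sm])
    then have "cmap c q \<in> T c"
      using q chart_facts(3)[OF sm charts_atD(1)[OF c]] charts_atD(2)[OF c] by (auto simp: T_def)
    then show "q \<in> (\<Union>c\<in>charts M. {q \<in> cdom c. cmap c q \<in> T c})"
      using charts_atD[OF c] by blast
  qed
  ultimately show ?thesis by metis
qed

text \<open>The chart that \<^const>\<open>vdiff\<close> and \<^const>\<open>mdiff\<close> choose at a point.\<close>

definition pchart :: "('a, 'b::euclidean_space) manifold \<Rightarrow> 'a \<Rightarrow> ('a, 'b) chart" where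
  "pchart M p = (SOME c. c \<in> charts_at M p)"

definition vderiv :: "('a, 'b::euclidean_space) manifold \<Rightarrow> ('a \<Rightarrow> 'e::euclidean_space) \<Rightarrow> 'a \<Rightarrow> 'b \<Rightarrow> 'e" where
  "vderiv M f p = frechet_derivative (\<lambda>x. f (cinv (pchart M p) x)) (at (cmap (pchart M p) p))"

lemma vdiff_eq_vderiv: "vdiff M f p X = vderiv M f p (X (pchart M p))"
  by (simp add: vdiff_def vderiv_def pchart_def Let_def o_def)

lemma pchart_in_charts_at: "smooth_manifold M \<Longrightarrow> p \<in> carrier M \<Longrightarrow> pchart M p \<in> charts_at M p"
  unfolding pchart_def by (erule (1) exists_chart_at) (rule someI)

lemma cinv_cmap: "smooth_manifold M \<Longrightarrow> c \<in> charts_at M p \<Longrightarrow> cinv c (cmap c p) = p"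
  by (simp add: chart_facts(3) charts_atD)

lemma smooth_fun_has_derivative:
  assumes "smooth_manifold M" "p \<in> W" "smooth_fun M W f" "c \<in> charts_at M p"
  shows "((\<lambda>x. f (cinv c x)) has_derivative frechet_derivative (\<lambda>x. f (cinv c x)) (at (cmap c p)))
    (at (cmap c p))"
  using smooth_on_imp_has_derivative[OF smooth_funD[OF assms(3) charts_atD(1)[OF assms(4)]]]
    charts_atD(2)[OF assms(4)] assms(2) by blast

lemma has_derivative_vderiv:
  assumes "smooth_manifold M" "openin (mtop M) W" "p \<in> W" "smooth_fun M W f"
  shows "((\<lambda>x. f (cinv (pchart M p) x)) has_derivative vderiv M f p) (at (cmap (pchart M p) p))"
  unfolding vderiv_def
  using smooth_fun_has_derivative[OF assms(1,3,4)] pchart_in_charts_at[OF assms(1)] assms(2,3)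
  by (meson openin_subset subsetD)

lemma vderiv_eqI:
  "((\<lambda>x. f (cinv (pchart M p) x)) has_derivative D) (at (cmap (pchart M p) p)) \<Longrightarrow> vderiv M f p = D"
  unfolding vderiv_def using frechet_derivative_at by metis

lemma linear_vderiv:
  assumes "smooth_manifold M" "openin (mtop M) W" "p \<in> W" "smooth_fun M W f"
  shows "linear (vderiv M f p)"
  using has_derivative_linear[OF has_derivative_vderiv[OF assms]] .

lemma vdiff_chain:
  assumes "smooth_manifold M" "openin (mtop M) W" "p \<in> W" "smooth_fun M W f"
    and "(G has_derivative G') (at (f p))"
  shows "vdiff M (\<lambda>q. G (f q)) p X = G' (vdiff M f p X)"
proof -
  have p: "pchart M p \<in> charts_at M p"
    using pchart_in_charts_at[OF assms(1)] assms(2,3) openin_subset by blast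
  have "((\<lambda>x. G (f (cinv (pchart M p) x))) has_derivative (\<lambda>v. G' (vderiv M f p v)))
      (at (cmap (pchart M p) p))"
    by (rule has_derivative_compose[OF has_derivative_vderiv[OF assms(1-4)]])
      (simp add: cinv_cmap[OF assms(1) p] assms(5))
  then show ?thesis by (simp add: vdiff_eq_vderiv vderiv_eqI)
qed

lemma vdiff_linear_map:
  assumes "smooth_manifold M" "openin (mtop M) W" "p \<in> W" "smooth_fun M W f" "bounded_linear L"
  shows "vdiff M (\<lambda>q. L (f q)) p X = L (vdiff M f p X)"
  by (rule vdiff_chain[OF assms(1-4) bounded_linear_imp_has_derivative[OF assms(5)]])

lemma vdiff_bilinear:
  assumes "smooth_manifold M" "openin (mtop M) W" "p \<in> W" "smooth_fun M W f" "smooth_fun M W g"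
    and "bounded_bilinear B"
  shows "vdiff M (\<lambda>q. B (f q) (g q)) p X = B (f p) (vdiff M g p X) + B (vdiff M f p X) (g p)"
proof -
  have p: "pchart M p \<in> charts_at M p"
    using pchart_in_charts_at[OF assms(1)] assms(2,3) openin_subset by blast
  have "((\<lambda>x. B (f (cinv (pchart M p) x)) (g (cinv (pchart M p) x))) has_derivative
      (\<lambda>v. B (f p) (vderiv M g p v) + B (vderiv M f p v) (g p))) (at (cmap (pchart M p) p))"
    using bounded_bilinear.FDERIV[OF assms(6) has_derivative_vderiv[OF assms(1-4)]
        has_derivative_vderiv[OF assms(1-3,5)]]
    by (simp add: cinv_cmap[OF assms(1) p])
  then show ?thesis by (simp add: vdiff_eq_vderiv vderiv_eqI)
qed

lemma vdiff_add:
  assumes "smooth_manifold M" "openin (mtop M) W" "p \<in> W" "smooth_fun M W f" "smooth_fun M W g"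
  shows "vdiff M (\<lambda>q. f q + g q) p X = vdiff M f p X + vdiff M g p X"
proof -
  have "((\<lambda>x. f (cinv (pchart M p) x) + g (cinv (pchart M p) x)) has_derivative
      (\<lambda>v. vderiv M f p v + vderiv M g p v)) (at (cmap (pchart M p) p))"
    by (intro has_derivative_add has_derivative_vderiv[OF assms(1-4)]
        has_derivative_vderiv[OF assms(1-3,5)])
  then show ?thesis by (simp add: vdiff_eq_vderiv vderiv_eqI)
qed

lemma eventually_in_chart:
  assumes "smooth_manifold M" "openin (mtop M) W" "p \<in> W" "c \<in> charts_at M p"
  shows "eventually (\<lambda>x. cinv c x \<in> W) (nhds (cmap c p))"
proof -
  have "open (cmap c ` (cdom c \<inter> W))" "cmap c p \<in> cmap c ` (cdom c \<inter> W)"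
    using open_chart_image[OF assms(1) charts_atD(1)[OF assms(4)] assms(2)]
      charts_atD(2)[OF assms(4)] assms(3) by blast+
  then have "eventually (\<lambda>x. x \<in> cmap c ` (cdom c \<inter> W)) (nhds (cmap c p))"
    by (rule eventually_nhds_in_open)
  then show ?thesis
  proof (rule eventually_mono)
    fix x assume "x \<in> cmap c ` (cdom c \<inter> W)"
    then show "cinv c x \<in> W"
      using chart_facts(3)[OF assms(1) charts_atD(1)[OF assms(4)]] by auto
  qed
qed

lemma vdiff_cong:
  assumes "smooth_manifold M" "openin (mtop M) W" "p \<in> W" "smooth_fun M W f"
    and "\<And>q. q \<in> W \<Longrightarrow> f q = g q"
  shows "vdiff M f p X = vdiff M g p X"
proof -
  have p: "pchart M p \<in> charts_at M p"
    using pchart_in_charts_at[OF assms(1)] assms(2,3) openin_subset by blast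
  have ev: "eventually (\<lambda>x. f (cinv (pchart M p) x) = g (cinv (pchart M p) x)) (nhds (cmap (pchart M p) p))"
    using eventually_in_chart[OF assms(1-3) p] by eventually_elim (rule assms(5))
  have "((\<lambda>x. g (cinv (pchart M p) x)) has_derivative vderiv M f p) (at (cmap (pchart M p) p))"
    by (rule has_derivative_transform_nhds[OF has_derivative_vderiv[OF assms(1-4)] ev])
  then show ?thesis by (simp add: vdiff_eq_vderiv vderiv_eqI)
qed

lemma vdiff_const:
  assumes "smooth_manifold M" "openin (mtop M) W" "p \<in> W" "smooth_fun M W f" "\<And>q. q \<in> W \<Longrightarrow> f q = k"
  shows "vdiff M f p X = 0"
  using vdiff_cong[OF assms] vderiv_eqI[of "\<lambda>q. k" M p "\<lambda>v. 0"] by (simp add: vdiff_eq_vderiv)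

text \<open>By the chain rule, any chart computes the differential.\<close>

lemma vdiff_chart:
  assumes sm: "smooth_manifold M" and W: "openin (mtop M) W" "p \<in> W" and f: "smooth_fun M W f"
    and c: "c \<in> charts_at M p" and X: "X \<in> tangent_space M p"
  shows "vdiff M f p X = frechet_derivative (\<lambda>x. f (cinv c x)) (at (cmap c p)) (X c)"
proof -
  let ?d = "pchart M p"
  have d: "?d \<in> charts_at M p"
    using pchart_in_charts_at[OF sm] W openin_subset by blast
  have inj: "inj_on (cmap c) (cdom c)" "inj_on (cmap ?d) (cdom ?d)"
    using chart_facts(3)[OF sm charts_atD(1)] c d by blast+
  have t: "((\<lambda>x. cmap c (cinv ?d x)) has_derivative
      frechet_derivative (\<lambda>x. cmap c (cinv ?d x)) (at (cmap ?d p))) (at (cmap ?d p))"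
    using smooth_on_imp_has_derivative[OF smooth_transition[OF sm charts_atD(1)[OF d] charts_atD(1)[OF c]]]
      charts_atD(2)[OF d] charts_atD(2)[OF c] by blast
  have "((\<lambda>x. f (cinv c (cmap c (cinv ?d x)))) has_derivative
      (\<lambda>v. frechet_derivative (\<lambda>x. f (cinv c x)) (at (cmap c p))
        (frechet_derivative (\<lambda>x. cmap c (cinv ?d x)) (at (cmap ?d p)) v))) (at (cmap ?d p))"
    by (rule has_derivative_compose[OF t])
      (use smooth_fun_has_derivative[OF sm W(2) f c] in \<open>simp add: cinv_cmap[OF sm d]\<close>)
  moreover have "eventually (\<lambda>x. f (cinv c (cmap c (cinv ?d x))) = f (cinv ?d x)) (nhds (cmap ?d p))"
    using eventually_in_chart[OF sm chart_facts(1)[OF sm charts_atD(1)[OF c]] charts_atD(2)[OF c] d]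
    by eventually_elim (use inj in simp)
  ultimately have "((\<lambda>x. f (cinv ?d x)) has_derivative
      (\<lambda>v. frechet_derivative (\<lambda>x. f (cinv c x)) (at (cmap c p))
        (frechet_derivative (\<lambda>x. cmap c (cinv ?d x)) (at (cmap ?d p)) v))) (at (cmap ?d p))"
    by (rule has_derivative_transform_nhds)
  moreover have "X c = frechet_derivative (\<lambda>x. cmap c (cinv ?d x)) (at (cmap ?d p)) (X ?d)"
    using X c d unfolding tangent_space_def o_def by blast
  ultimately show ?thesis by (simp add: vdiff_eq_vderiv vderiv_eqI)
qed

text \<open>
  The transformation law gives an isomorphism of the tangent space with the model space for every
  chart; injectivity is stated here, surjectivity in \<open>tangent_space_exists\<close>.
\<close>

lemma tangent_space_determined:
  assumes "X \<in> tangent_space M p" "Y \<in> tangent_space M p" "c \<in> charts_at M p" "X c = Y c"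
  shows "X = Y"
proof
  fix d
  show "X d = Y d"
  proof (cases "d \<in> charts_at M p")
    case True
    have "Z d = frechet_derivative (cmap d \<circ> cinv c) (at (cmap c p)) (Z c)" if "Z \<in> tangent_space M p" for Z
      using that assms(3) True unfolding tangent_space_def by blast
    then show ?thesis using assms by metis
  next
    case False
    have "Z d = 0" if "Z \<in> tangent_space M p" for Z
      using that False unfolding tangent_space_def by blast
    then show ?thesis using assms(1,2) by metis
  qed
qed

lemma has_derivative_transition:
  assumes "smooth_manifold M" "c \<in> charts_at M p" "d \<in> charts_at M p"
  shows "((\<lambda>x. cmap d (cinv c x)) has_derivative frechet_derivative (\<lambda>x. cmap d (cinv c x)) (at (cmap c p)))
    (at (cmap c p))"
  using smooth_on_imp_has_derivative[OF smooth_transition[OF assms(1) charts_atD(1)[OF assms(2)]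
        charts_atD(1)[OF assms(3)]]]
    charts_atD(2)[OF assms(2)] charts_atD(2)[OF assms(3)] by blast

lemma tangent_space_exists:
  assumes sm: "smooth_manifold M" and c: "c \<in> charts_at M p"
  obtains X where "X \<in> tangent_space M p" "X c = v"
proof -
  define X where "X d = (if d \<in> charts_at M p
    then frechet_derivative (\<lambda>x. cmap d (cinv c x)) (at (cmap c p)) v else 0)" for d
  note inj = chart_facts(3)[OF sm charts_atD(1)]
  have comp: "frechet_derivative (\<lambda>x. cmap d (cinv b x)) (at (cmap b p))
      (frechet_derivative (\<lambda>x. cmap b (cinv c x)) (at (cmap c p)) u)
      = frechet_derivative (\<lambda>x. cmap d (cinv c x)) (at (cmap c p)) u"
    if b: "b \<in> charts_at M p" and d: "d \<in> charts_at M p" for b d u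
  proof -
    have "((\<lambda>x. cmap d (cinv b (cmap b (cinv c x)))) has_derivative
        (\<lambda>u. frechet_derivative (\<lambda>x. cmap d (cinv b x)) (at (cmap b p))
          (frechet_derivative (\<lambda>x. cmap b (cinv c x)) (at (cmap c p)) u))) (at (cmap c p))"
      by (rule has_derivative_compose[OF has_derivative_transition[OF sm c b]])
        (use has_derivative_transition[OF sm b d] in \<open>simp add: cinv_cmap[OF sm c]\<close>)
    moreover have "eventually (\<lambda>x. cmap d (cinv b (cmap b (cinv c x))) = cmap d (cinv c x)) (nhds (cmap c p))"
      using eventually_in_chart[OF sm chart_facts(1)[OF sm charts_atD(1)[OF b]] charts_atD(2)[OF b] c]
      by eventually_elim (use inj[OF b] in simp)
    ultimately have "((\<lambda>x. cmap d (cinv c x)) has_derivative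
        (\<lambda>u. frechet_derivative (\<lambda>x. cmap d (cinv b x)) (at (cmap b p))
          (frechet_derivative (\<lambda>x. cmap b (cinv c x)) (at (cmap c p)) u))) (at (cmap c p))"
      by (rule has_derivative_transform_nhds)
    from frechet_derivative_at[OF this] show ?thesis by metis
  qed
  have "((\<lambda>x. cmap c (cinv c x)) has_derivative (\<lambda>u. u)) (at (cmap c p))"
  proof (rule has_derivative_transform_within_open[OF has_derivative_ident])
    show "open (cmap c ` cdom c)" "cmap c p \<in> cmap c ` cdom c"
      using chart_facts(2)[OF sm charts_atD(1)[OF c]] charts_atD(2)[OF c] by auto
  qed (auto intro: f_inv_into_f[symmetric])
  from frechet_derivative_at[OF this]
  have id: "frechet_derivative (\<lambda>x. cmap c (cinv c x)) (at (cmap c p)) v = v" by metis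
  show thesis
  proof (rule that[of X])
    show "X c = v" using c id by (simp add: X_def)
    show "X \<in> tangent_space M p"
      unfolding tangent_space_def o_def using comp by (auto simp: X_def)
  qed
qed

lemma vdiff_image:
  assumes "smooth_manifold M" "p \<in> carrier M"
  shows "vdiff M f p ` tangent_space M p = range (vderiv M f p)"
proof (intro set_eqI iffI)
  fix y assume "y \<in> range (vderiv M f p)"
  then obtain v where v: "y = vderiv M f p v" by blast
  obtain X where "X \<in> tangent_space M p" "X (pchart M p) = v"
    using tangent_space_exists[OF assms(1) pchart_in_charts_at[OF assms]] .
  then show "y \<in> vdiff M f p ` tangent_space M p"
    using v by (auto simp: vdiff_eq_vderiv intro!: image_eqI[of _ _ X])
qed (auto simp: vdiff_eq_vderiv)

lemma inj_on_vdiff_iff: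
  assumes "smooth_manifold M" "p \<in> carrier M"
  shows "inj_on (vdiff M f p) (tangent_space M p) \<longleftrightarrow> inj (vderiv M f p)"
proof
  assume i: "inj_on (vdiff M f p) (tangent_space M p)"
  show "inj (vderiv M f p)"
  proof (rule injI)
    fix v w assume eq: "vderiv M f p v = vderiv M f p w"
    obtain X where X: "X \<in> tangent_space M p" "X (pchart M p) = v"
      using tangent_space_exists[OF assms(1) pchart_in_charts_at[OF assms]] .
    obtain Y where Y: "Y \<in> tangent_space M p" "Y (pchart M p) = w"
      using tangent_space_exists[OF assms(1) pchart_in_charts_at[OF assms]] .
    have "vdiff M f p X = vdiff M f p Y" using eq X Y by (simp add: vdiff_eq_vderiv)
    then show "v = w" using inj_onD[OF i _ X(1) Y(1)] X Y by metis
  qed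
next
  assume i: "inj (vderiv M f p)"
  show "inj_on (vdiff M f p) (tangent_space M p)"
  proof (rule inj_onI)
    fix X Y assume XY: "X \<in> tangent_space M p" "Y \<in> tangent_space M p" "vdiff M f p X = vdiff M f p Y"
    then have "X (pchart M p) = Y (pchart M p)" using i by (simp add: vdiff_eq_vderiv inj_eq)
    then show "X = Y" using tangent_space_determined[OF XY(1,2) pchart_in_charts_at[OF assms]] by blast
  qed
qed

lemma tscale_in_tangent_space:
  assumes "smooth_manifold M" "X \<in> tangent_space M p"
  shows "tscale r X \<in> tangent_space M p"
proof -
  have "r *\<^sub>R X d = frechet_derivative (cmap d \<circ> cinv c) (at (cmap c p)) (r *\<^sub>R X c)"
    if cd: "c \<in> charts_at M p" "d \<in> charts_at M p" for c d
  proof -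
    have "X d = frechet_derivative (cmap d \<circ> cinv c) (at (cmap c p)) (X c)"
      using assms(2) cd unfolding tangent_space_def by blast
    then show ?thesis
      using linear_cmul[OF has_derivative_linear[OF has_derivative_transition[OF assms(1) cd]]]
      by (simp add: o_def)
  qed
  moreover have "r *\<^sub>R X c = 0" if "c \<notin> charts_at M p" for c
  proof -
    have "X c = 0" using assms(2) that unfolding tangent_space_def by blast
    then show ?thesis by simp
  qed
  ultimately show ?thesis unfolding tangent_space_def tscale_def by blast
qed

lemma tzero_in_tangent_space: "smooth_manifold M \<Longrightarrow> tzero \<in> tangent_space M p"
  unfolding tangent_space_def tzero_def o_def
  using linear_0[OF has_derivative_linear[OF has_derivative_transition]] by auto

lemma vdiff_tscale:
  assumes "smooth_manifold M" "openin (mtop M) W" "p \<in> W" "smooth_fun M W f"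
  shows "vdiff M f p (tscale r X) = r *\<^sub>R vdiff M f p X"
  by (simp add: vdiff_eq_vderiv tscale_def linear_cmul[OF linear_vderiv[OF assms]])

text \<open>
  If a vector of the frame vanished, its coefficient in the representation of \<open>tzero\<close> would be arbitrary.
\<close>

lemma frame_at_nonzero:
  assumes "frame_at M p e" "smooth_manifold M"
  shows "e j \<in> tangent_space M p" "e j \<noteq> tzero"
proof -
  show "e j \<in> tangent_space M p" using assms(1) unfolding frame_at_def by blast
  have "\<exists>!r. tzero = (\<lambda>c. \<Sum>k\<in>UNIV. r k *\<^sub>R e k c)"
    using assms(1) tzero_in_tangent_space[OF assms(2)] unfolding frame_at_def by blast
  then obtain r0 where u: "\<forall>r. tzero = (\<lambda>c. \<Sum>k\<in>UNIV. r k *\<^sub>R e k c) \<longrightarrow> r = r0"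
    by (elim ex1E) (rule that)
  show "e j \<noteq> tzero"
  proof
    assume z: "e j = tzero"
    have "(\<lambda>k. 0 :: real) = r0"
      by (rule u[rule_format]) (simp add: tzero_def)
    moreover have "(\<lambda>k. if k = j then 1 else 0 :: real) = r0"
      by (rule u[rule_format])
        (use z in \<open>simp add: tzero_def if_distrib[of "\<lambda>r. r *\<^sub>R _"] cong: if_cong\<close>)
    ultimately
    have "(\<lambda>k. 0 :: real) = (\<lambda>k. if k = j then 1 else 0)" by simp
    then show False by (metis zero_neq_one)
  qed
qed

section \<open>Maps into the projective space and their lifts\<close>

text \<open>
  All differentials of maps into the projective space are computed with a lift \<open>g\<close>, horizontal or not.
\<close>

lemma mdiff_cline:
  assumes sm: "smooth_manifold M" and W: "openin (mtop M) W" "p \<in> W" and g: "smooth_fun M W g"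
    and f: "\<And>q. q \<in> W \<Longrightarrow> f q = cline (g q)"
  shows "mdiff M CP f p X = dhopf (g p) (vdiff M g p X)"
proof -
  have p: "pchart M p \<in> charts_at M p"
    using pchart_in_charts_at[OF sm] W openin_subset by blast
  have ev: "eventually (\<lambda>x. (f \<circ> cinv (pchart M p)) x = cline (g (cinv (pchart M p) x))) (nhds (cmap (pchart M p) p))"
    using eventually_in_chart[OF sm W p] by eventually_elim (simp add: f)
  show ?thesis
    using push_eq_dhopf[OF has_derivative_vderiv[OF sm W g] ev, of "X (pchart M p)"]
    by (simp add: mdiff_def pchart_def[symmetric] Let_def o_def vdiff_eq_vderiv cinv_cmap[OF sm p])
qed

lemma smooth_on_acoord:
  assumes "open S" "smooth_on S g" "\<And>x. x \<in> S \<Longrightarrow> g x $ \<sigma> None \<noteq> 0"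
  shows "smooth_on S (\<lambda>x. acoord \<sigma> (g x))"
  unfolding acoord_def
  by (intro smooth_on_vec_lambda smooth_on_divide smooth_on_vec_nth assms) (use assms in auto)

lemma smooth_map_cline:
  fixes g :: "'a \<Rightarrow> complex ^ 'k::finite option"
  assumes sm: "smooth_manifold M" and U: "openin (mtop M) U" and g: "smooth_fun M U g"
    and f: "\<And>q. q \<in> U \<Longrightarrow> g q \<noteq> 0" "\<And>q. q \<in> U \<Longrightarrow> f q = cline (g q)"
  shows "smooth_map M CP U f"
  unfolding smooth_map_def
proof
  fix p assume p: "p \<in> U"
  then have "p \<in> carrier M" using openin_subset[OF U] by blast
  then obtain c where c: "c \<in> charts_at M p" by (rule exists_chart_at[OF sm])
  note inj = chart_facts(3)[OF sm charts_atD(1)[OF c]]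
  obtain \<sigma> :: "'k option \<Rightarrow> 'k option" where s: "bij \<sigma>" "g p $ \<sigma> None \<noteq> 0"
    using exists_affine_chart[OF f(1)[OF p]] .
  define W where "W = cdom c \<inter> {q \<in> U. g q \<in> {z. z $ \<sigma> None \<noteq> 0}}"
  have "open {z :: complex ^ 'k option. z $ \<sigma> None \<noteq> 0}"
    by (intro open_Collect_neq continuous_intros)
  then have W: "openin (mtop M) W"
    unfolding W_def
    by (intro openin_Int openin_smooth_preimage[OF sm U g] chart_facts(1)[OF sm charts_atD(1)[OF c]])
  have Wc: "W \<subseteq> U \<inter> cdom c" by (auto simp: W_def)
  have oW: "open (cmap c ` W)"
    using open_chart_image[OF sm charts_atD(1)[OF c] W] Wc by (simp add: Int_absorb1)
  have fW: "f q = cline (g q)" "g q $ \<sigma> None \<noteq> 0" if "q \<in> W" for q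
    using that f(2) by (auto simp: W_def)
  have "smooth_on (cmap c ` W) (\<lambda>x. g (cinv c x))"
    by (rule smooth_on_subset[OF smooth_funD[OF g charts_atD(1)[OF c]]]) (use Wc in auto)
  then have "smooth_on (cmap c ` W) (\<lambda>x. acoord \<sigma> (g (cinv c x)))"
    by (rule smooth_on_acoord[OF oW]) (use fW(2) cinv_in_cdom[OF _ _ inj] Wc in auto)
  then have "smooth_on (cmap c ` W) (cmap (affine_chart \<sigma>) \<circ> f \<circ> cinv c)"
  proof (rule smooth_on_cong[OF oW, rotated])
    fix x assume "x \<in> cmap c ` W"
    then have "cinv c x \<in> W" using cinv_in_cdom[OF _ _ inj] Wc by blast
    then show "acoord \<sigma> (g (cinv c x)) = (cmap (affine_chart \<sigma>) \<circ> f \<circ> cinv c) x"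
      using fW by (simp add: cmap_cline)
  qed
  moreover have "p \<in> W" using p s(2) charts_atD(2)[OF c] by (simp add: W_def)
  moreover have "f ` W \<subseteq> cdom (affine_chart \<sigma>)" using fW by (auto simp: cline_in_cdom)
  moreover have "affine_chart \<sigma> \<in> charts_at CP (f p)"
    using affine_chart_in_charts_at[OF s] f(2)[OF p] by simp
  ultimately show "\<exists>c\<in>charts_at M p. \<exists>d\<in>charts_at CP (f p). \<exists>W. openin (mtop M) W \<and> p \<in> W \<and>
      W \<subseteq> U \<inter> cdom c \<and> f ` W \<subseteq> cdom d \<and> smooth_on (cmap c ` W) (cmap d \<circ> f \<circ> cinv c)"
    using c W Wc by blast
qed

lemma smooth_on_norm:
  fixes f :: "'a::real_normed_vector \<Rightarrow> 'b::euclidean_space"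
  assumes "open S" "smooth_on S f" "\<And>x. x \<in> S \<Longrightarrow> f x \<noteq> 0"
  shows "smooth_on S (\<lambda>x. norm (f x))"
  unfolding norm_eq_sqrt_inner
  by (intro smooth_on_sqrt smooth_on_inner assms) (use assms in auto)

text \<open>
  Composing the coordinate representation of \<open>f\<close> with the section \<open>alift \<sigma>\<close> and normalising gives a local
  lift to the unit sphere.
\<close>

lemma smooth_map_lift:
  fixes f :: "'a \<Rightarrow> 'k::finite cp"
  assumes sm: "smooth_manifold M" and f: "smooth_map M CP U f" and p: "p \<in> U"
  obtains W g where "openin (mtop M) W" "p \<in> W" "W \<subseteq> U" "smooth_fun M W g"
    "\<And>q. q \<in> W \<Longrightarrow> norm (g q) = 1" "\<And>q. q \<in> W \<Longrightarrow> f q = cline (g q)"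
proof -
  obtain c d W where c: "c \<in> charts_at M p" and d: "d \<in> charts_at CP (f p)"
    and W: "openin (mtop M) W" "p \<in> W" "W \<subseteq> U \<inter> cdom c" "f ` W \<subseteq> cdom d"
    and smf: "smooth_on (cmap c ` W) (cmap d \<circ> f \<circ> cinv c)"
    using f p unfolding smooth_map_def by blast
  obtain \<sigma> where s: "bij \<sigma>" "d = affine_chart \<sigma>"
    using d by (auto simp: charts_at_def charts_CP)
  have oW: "open (cmap c ` W)"
    using open_chart_image[OF sm charts_atD(1)[OF c] W(1)] W(3) by (simp add: Int_absorb1)
  define h where "h q = alift \<sigma> (cmap d (f q))" for q
  define g where "g q = (1 / norm (h q)) *\<^sub>R h q" for q
  have h0: "h q \<noteq> 0" for q using s(1) by (simp add: h_def)
  have "smooth_on (cmap c ` W) (\<lambda>x. alift \<sigma> 0 + adir \<sigma> (cmap d (f (cinv c x))))"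
    using smf unfolding o_def
    by (intro smooth_on_add smooth_on_const smooth_on_bounded_linear[OF _ bounded_linear_adir] oW s)
  then have h: "smooth_on (cmap c ` W) (\<lambda>x. h (cinv c x))"
    by (simp add: h_def alift_eq[OF s(1), symmetric])
  have "smooth_on (cmap c ` W) (\<lambda>x. g (cinv c x))"
    unfolding g_def
    by (intro smooth_on_scaleR smooth_on_divide smooth_on_const smooth_on_norm oW h) (use h0 in auto)
  then have "smooth_fun M W g"
    by (intro smooth_funI_chart[OF sm charts_atD(1)[OF c] W(1)]) (use W(3) in auto)
  moreover have "norm (g q) = 1" for q using h0[of q] by (simp add: g_def)
  moreover have "f q = cline (g q)" if "q \<in> W" for q
  proof -
    have "f q \<in> cdom (affine_chart \<sigma>)" using W(4) that s(2) by blast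
    then obtain z where z: "f q = cline z" "z $ \<sigma> None \<noteq> 0"
      by (auto simp: affine_chart_def)
    then have "h q = (1 / z $ \<sigma> None) *s z"
      using s by (simp add: h_def cmap_cline alift_acoord)
    then have "cline (h q) = f q" using z by (simp add: cline_scale)
    then show ?thesis using h0[of q] by (simp add: g_def scaleR_eq_scale cline_scale)
  qed
  ultimately show thesis using that[OF W(1,2) _ _] W(3) by blast
qed

section \<open>The Levi-Civita connection of the Fubini-Study metric\<close>

definition hpart :: "complex ^ 'm::finite \<Rightarrow> complex ^ 'm \<Rightarrow> complex ^ 'm" where
  "hpart z v = v - (herm v z / herm z z) *s z"

lemma herm_hpart: "z \<noteq> 0 \<Longrightarrow> herm (hpart z v) z = 0"
  unfolding hpart_def by (rule herm_horizontal_part)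

lemma dhopf_hpart: "dhopf z (hpart z v) = dhopf z v"
  unfolding hpart_def by (rule dhopf_horizontal_part[symmetric])

lemma herm_hpart_hpart:
  assumes "z \<noteq> 0"
  shows "herm (hpart z u) (hpart z v) = herm u v - herm u z * herm z v / herm z z"
proof -
  have "herm (hpart z u) (hpart z v) = herm (hpart z u) v"
    using herm_hpart[OF assms, of u] by (simp add: hpart_def[of z v] herm_simps)
  then show ?thesis by (simp add: hpart_def herm_simps)
qed

text \<open>Rescaling the representative reduces the general case to the unit sphere.\<close>

lemma gFS_dhopf_hpart:
  assumes "z \<noteq> 0"
  shows "gFS (cline z) (dhopf z u) (dhopf z v) = hpart z u \<bullet> hpart z v / (z \<bullet> z)"
proof -
  define r where "r = 1 / norm z"
  have r: "r \<noteq> 0" using assms by (simp add: r_def)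
  have n: "norm (of_real r *s z) = 1"
    unfolding scaleR_eq_scale[symmetric] using assms by (simp add: r_def)
  have d: "dhopf z w = dhopf (of_real r *s z) (of_real r *s hpart z w)" for w
    using dhopf_homogeneous[of "of_real r" z "hpart z w" 0] r dhopf_hpart[of z w] by simp
  have h: "herm (of_real r *s hpart z w) (of_real r *s z) = 0" for w
    using herm_hpart[OF assms] by (simp add: herm_simps)
  have "gFS (cline z) (dhopf z u) (dhopf z v) = (of_real r *s hpart z u) \<bullet> (of_real r *s hpart z v)"
    using gFS_dhopf[OF n h[of u] h[of v]] cline_scale[of "of_real r" z] r
    unfolding d[of u] d[of v] by simp
  then show ?thesis
    using assms unfolding scaleR_eq_scale[symmetric]
    by (simp add: r_def power2_norm_eq_inner[symmetric] power2_eq_square)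
qed

text \<open>
  The Fubini-Study metric in affine coordinates.
\<close>

definition fs :: "complex ^ 'k::finite \<Rightarrow> complex ^ 'k \<Rightarrow> complex ^ 'k \<Rightarrow> real" where
  "fs x u v = Re (herm u v) / (1 + x \<bullet> x) - Re (herm u x * herm x v) / (1 + x \<bullet> x)\<^sup>2"

lemma push_cinv_affine_chart:
  assumes "bij \<sigma>"
  shows "push CP (cinv (affine_chart \<sigma>)) x u = dhopf (alift \<sigma> x) (adir \<sigma> u)"
  by (rule push_eq_dhopf[OF has_derivative_alift[OF assms]]) (simp add: cinv_affine_chart[OF assms])

lemma one_plus_inner_pos: "1 + x \<bullet> x > 0" for x :: "'a::real_inner"
  using inner_ge_zero[of x] by linarith

lemma metric_coeff_hpart:
  assumes "bij \<sigma>"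
  shows "metric_coeff CP gFS (affine_chart \<sigma>) x u v
    = hpart (alift \<sigma> x) (adir \<sigma> u) \<bullet> hpart (alift \<sigma> x) (adir \<sigma> v) / (1 + x \<bullet> x)"
proof -
  have "alift \<sigma> x \<bullet> alift \<sigma> x = 1 + x \<bullet> x"
    using herm_adir(3)[OF assms, of x] by (simp add: Re_herm[symmetric])
  then show ?thesis
    using assms by (simp add: metric_coeff_def push_cinv_affine_chart cinv_affine_chart gFS_dhopf_hpart)
qed

lemma metric_coeff_eq_fs:
  assumes "bij \<sigma>"
  shows "metric_coeff CP gFS (affine_chart \<sigma>) x u v = fs x u v"
proof -
  let ?n = "1 + x \<bullet> x"
  have n: "herm (alift \<sigma> x) (alift \<sigma> x) = of_real ?n"
    unfolding herm_adir(3)[OF assms] by (simp add: herm_self)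
  have s: "herm (alift \<sigma> x) (adir \<sigma> v) = herm x v"
    using herm_adir(2)[OF assms, of v x] by (metis cnj_herm)
  have "herm (hpart (alift \<sigma> x) (adir \<sigma> u)) (hpart (alift \<sigma> x) (adir \<sigma> v))
      = herm u v - herm u x * herm x v / of_real ?n"
    by (simp add: herm_hpart_hpart assms n s herm_adir(1,2)[OF assms])
  then show ?thesis
    using one_plus_inner_pos[of x]
    by (simp add: metric_coeff_hpart[OF assms] Re_herm[symmetric] fs_def power2_eq_square diff_divide_distrib)
qed

lemma has_derivative_fs:
  "((\<lambda>x. fs x u v) has_derivative (\<lambda>a.
      - Re (herm u v) * (2 * Re (herm a x)) / (1 + x \<bullet> x)\<^sup>2
      - Re (herm u a * herm x v + herm u x * herm a v) / (1 + x \<bullet> x)\<^sup>2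
      + 2 * Re (herm u x * herm x v) * (2 * Re (herm a x)) / (1 + x \<bullet> x)^3)) (at x)"
proof -
  have h1: "((\<lambda>x. herm u x) has_derivative (\<lambda>a. herm u a)) (at x)"
    by (rule bounded_linear_imp_has_derivative[OF bounded_bilinear.bounded_linear_right[OF bounded_bilinear_herm]])
  have h2: "((\<lambda>x. herm x v) has_derivative (\<lambda>a. herm a v)) (at x)"
    by (rule bounded_linear_imp_has_derivative[OF bounded_bilinear.bounded_linear_left[OF bounded_bilinear_herm]])
  have h3: "((\<lambda>x. Re (herm u x * herm x v)) has_derivative
      (\<lambda>a. Re (herm u a * herm x v + herm u x * herm a v))) (at x)"
    by (rule has_derivative_eq_rhs[OF bounded_linear.has_derivative[OF bounded_linear_Re
            has_derivative_mult[OF h1 h2]]]) (simp add: add.commute)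
  have n: "((\<lambda>x. 1 + x \<bullet> x) has_derivative (\<lambda>a. 2 * Re (herm a x))) (at x)"
    by (auto intro!: derivative_eq_intros simp: Re_herm inner_commute)
  have n0: "1 + x \<bullet> x \<noteq> 0" using one_plus_inner_pos[of x] by simp
  have n2: "((\<lambda>x. (1 + x \<bullet> x)\<^sup>2) has_derivative (\<lambda>a. 2 * (2 * Re (herm a x)) * (1 + x \<bullet> x))) (at x)"
    using has_derivative_power[OF n, of 2] by (simp add: mult_ac)
  have n02: "(1 + x \<bullet> x)\<^sup>2 \<noteq> 0" using n0 by simp
  have alg: "(0 * m - P * b) / (m * m) - (Q * m\<^sup>2 - S * (2 * b * m)) / (m\<^sup>2 * m\<^sup>2)
      = - P * b / m\<^sup>2 - Q / m\<^sup>2 + 2 * S * b / m^3" if "m \<noteq> 0" for m P Q S b :: real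
    using that by (simp add: field_simps power2_eq_square power3_eq_cube)
  show ?thesis
    unfolding fs_def
    by (rule has_derivative_eq_rhs[OF has_derivative_diff[OF
            has_derivative_divide'[OF has_derivative_const n n0] has_derivative_divide'[OF h3 n2 n02]]])
      (rule ext, rule alg[OF n0])
qed

text \<open>
  The Koszul formula in terms of the Hermitian products \<open>\<alpha> = \<langle>u, x\<rangle>\<close>, \<open>\<beta> = \<langle>y, x\<rangle>\<close>, \<open>\<gamma> = \<langle>w, x\<rangle>\<close>,
  \<open>p = \<langle>y, w\<rangle>\<close>, \<open>q = \<langle>u, w\<rangle>\<close>, \<open>r = \<langle>u, y\<rangle>\<close> and \<open>n = 1 + |x|\<^sup>2\<close>. The three brackets on the right are
  derivatives of the metric as given by \<open>has_derivative_fs\<close>.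
\<close>

lemma koszul_algebra:
  fixes \<alpha> \<beta> \<gamma> p q r :: complex and n :: real
  assumes "n \<noteq> 0"
  shows "Re (- (\<alpha> * p + \<beta> * q)) / n\<^sup>2 + 2 * Re (\<alpha> * \<beta> * cnj \<gamma>) / n^3 =
    ((- Re p * (2 * Re \<alpha>) / n\<^sup>2 - Re (cnj r * cnj \<gamma> + \<beta> * q) / n\<^sup>2 + 2 * Re (\<beta> * cnj \<gamma>) * (2 * Re \<alpha>) / n^3)
     + (- Re q * (2 * Re \<beta>) / n\<^sup>2 - Re (r * cnj \<gamma> + \<alpha> * p) / n\<^sup>2 + 2 * Re (\<alpha> * cnj \<gamma>) * (2 * Re \<beta>) / n^3)
     - (- Re r * (2 * Re \<gamma>) / n\<^sup>2 - Re (q * cnj \<beta> + \<alpha> * cnj p) / n\<^sup>2 + 2 * Re (\<alpha> * cnj \<beta>) * (2 * Re \<gamma>) / n^3)) / 2"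
proof -
  obtain a b where "\<alpha> = Complex a b" by (cases \<alpha>)
  moreover obtain c d where "\<beta> = Complex c d" by (cases \<beta>)
  moreover obtain e f where "\<gamma> = Complex e f" by (cases \<gamma>)
  moreover obtain g h where "p = Complex g h" by (cases p)
  moreover obtain i j where "q = Complex i j" by (cases q)
  moreover obtain k l where "r = Complex k l" by (cases r)
  ultimately show ?thesis
    using assms by (simp add: field_simps power2_eq_square power3_eq_cube)
qed

text \<open>
  The vector \<open>- (\<langle>u, x\<rangle> y + \<langle>y, x\<rangle> u) / (1 + |x|\<^sup>2)\<close> is the value of the Christoffel symbols of the
  Fubini-Study metric in an affine chart.
\<close>

lemma fs_christoffel:
  fixes x u y w :: "complex ^ 'k::finite"
  defines "G \<equiv> - (1 / (1 + x \<bullet> x)) *\<^sub>R (herm u x *s y + herm y x *s u)"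
  shows "fs x G w = (frechet_derivative (\<lambda>x. fs x y w) (at x) u
    + frechet_derivative (\<lambda>x. fs x u w) (at x) y - frechet_derivative (\<lambda>x. fs x u y) (at x) w) / 2"
proof -
  let ?n = "1 + x \<bullet> x"
  have n: "?n \<noteq> 0" using one_plus_inner_pos[of x] by simp
  have c: "herm x u = cnj (herm u x)" "herm x y = cnj (herm y x)" "herm x w = cnj (herm w x)"
    "herm y u = cnj (herm u y)" "herm w y = cnj (herm y w)"
    by (simp_all add: cnj_herm)
  have "fs x G w = Re (- (herm u x * herm y w + herm y x * herm u w)) / ?n\<^sup>2
      + 2 * Re (herm u x * herm y x * cnj (herm w x)) / ?n^3"
  proof -
    have Gw: "herm G w = of_real (- (1 / ?n)) * (herm u x * herm y w + herm y x * herm u w)"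
      and Gx: "herm G x = of_real (- (1 / ?n)) * (2 * (herm u x * herm y x))"
      unfolding G_def herm_scaleR_left herm_add_left herm_scale_left by simp_all
    have alg: "Re (of_real (- (1 / m)) * A) / m - Re (of_real (- (1 / m)) * (2 * B) * C) / m\<^sup>2
        = Re (- A) / m\<^sup>2 + 2 * Re (B * C) / m^3" if "m \<noteq> 0" for m :: real and A B C :: complex
      using that by (simp add: field_simps power2_eq_square power3_eq_cube)
    show ?thesis
      unfolding fs_def Gw Gx c(3) by (rule alg[OF n])
  qed
  also note koszul_algebra[OF n, of "herm u x" "herm y w" "herm y x" "herm u w" "herm w x" "herm u y"]
  finally show ?thesis
    unfolding frechet_derivative_at[OF has_derivative_fs, symmetric] c .
qed

text \<open>
  For a horizontal vector the coefficient \<open>- \<langle>u, x\<rangle> / (1 + |x|\<^sup>2)\<close> in the Christoffel term is a ratio of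
  components of the representatives, since \<open>\<langle>v, z\<rangle> = 0\<close> determines the product of \<open>v - (v\<^sub>0 / z\<^sub>0) z\<close> with \<open>z\<close>.
\<close>

lemma herm_dacoord_acoord:
  fixes z :: "complex ^ 'k::finite option" and \<sigma> :: "'k option \<Rightarrow> 'k option"
  assumes "bij \<sigma>" "z $ \<sigma> None \<noteq> 0" "herm v z = 0"
  defines "x \<equiv> acoord \<sigma> z"
  shows "herm (dacoord \<sigma> z v) x = - of_real (1 + x \<bullet> x) * (v $ \<sigma> None / z $ \<sigma> None)"
proof -
  have n: "of_real (1 + x \<bullet> x) = herm (alift \<sigma> x) (alift \<sigma> x)"
    unfolding herm_adir(3)[OF assms(1)] by (simp add: herm_self)
  have "herm (dacoord \<sigma> z v) x = herm (adir \<sigma> (dacoord \<sigma> z v)) (alift \<sigma> x)"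
    by (simp add: herm_adir(2)[OF assms(1)])
  then show ?thesis
    unfolding n using assms(2,3)
    by (simp add: adir_dacoord[OF assms(1,2)] x_def alift_acoord[OF assms(1,2)] herm_simps
        power2_eq_square mult_ac)
qed

text \<open>
  As for every Riemannian submersion, the connection is the projection of the derivative of a
  horizontal lift of the field. It is enough to know the field along one curve, and that the direction
  and the lift are horizontal at the point in question.
\<close>

lemma levi_civita_CP:
  fixes z :: "complex ^ 'k::finite option"
  assumes W: "openin (mtop CP) W" and \<xi>: "smooth_field CP W \<xi>" and zW: "cline z \<in> W" and z0: "z \<noteq> 0"
    and k: "(k has_vector_derivative v) (at 0)" "k 0 = z"
    and h: "(h has_vector_derivative h') (at 0)"
    and ev: "eventually (\<lambda>t. \<xi> (cline (k t)) = dhopf (k t) (h t)) (nhds 0)"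
    and hor: "herm v z = 0" "herm (h 0) z = 0"
  shows "levi_civita CP gFS (cline z) (dhopf z v) \<xi> = dhopf z h'"
proof -
  have \<xi>z: "\<xi> (cline z) = dhopf z (h 0)"
    using eventually_nhds_x_imp_x[OF ev] k(2) by simp
  \<comment> \<open>\<open>DY c\<close> is the derivative of the components of \<open>\<xi>\<close> in the chart \<open>c\<close>; it differs from the
    components of \<open>dhopf z h'\<close> by the Christoffel term, in every affine chart.\<close>
  define DY where "DY c = frechet_derivative (\<lambda>x'. \<xi> (cinv c x') c) (at (cmap c (cline z))) (dhopf z v c)" for c
  have christoffel: "dhopf z h' (affine_chart \<sigma>) - DY (affine_chart \<sigma>) =
      - (1 / (1 + x \<bullet> x)) *\<^sub>R (herm u x *s y + herm y x *s u)"
    if s: "bij \<sigma>" "z $ \<sigma> None \<noteq> 0" and xuy: "x = acoord \<sigma> z" "u = dacoord \<sigma> z v" "y = dacoord \<sigma> z (h 0)"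
    for \<sigma> x u y
  proof -
    let ?c = "affine_chart \<sigma>"
    let ?Y = "\<lambda>x'. \<xi> (cinv ?c x') ?c"
    have sm: "smooth_on (cmap ?c ` (cdom ?c \<inter> W)) ?Y"
      using \<xi> s(1) unfolding smooth_field_def charts_CP by blast
    have xin: "x \<in> cmap ?c ` (cdom ?c \<inter> W)"
      using s zW xuy by (simp add: cmap_image_affine_chart alift_acoord cline_scale)
    have dY: "(?Y has_derivative frechet_derivative ?Y (at x)) (at x)"
      by (rule smooth_on_imp_has_derivative[OF sm xin])
    have kd: "(k has_derivative (\<lambda>t. t *\<^sub>R v)) (at 0)"
      using k(1) by (simp add: has_vector_derivative_def)
    have "((\<lambda>t. acoord \<sigma> (k t)) has_derivative (\<lambda>t. dacoord \<sigma> z (t *\<^sub>R v))) (at 0)"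
      by (rule has_derivative_compose[OF kd]) (use has_derivative_acoord[of z \<sigma>] s k(2) in simp)
    then have "((\<lambda>t. ?Y (acoord \<sigma> (k t))) has_derivative
        (\<lambda>t. frechet_derivative ?Y (at x) (dacoord \<sigma> z (t *\<^sub>R v)))) (at 0)"
      by (rule has_derivative_compose) (use dY k(2) xuy in simp)
    then have D1: "((\<lambda>t. ?Y (acoord \<sigma> (k t))) has_vector_derivative frechet_derivative ?Y (at x) u) (at 0)"
      unfolding has_vector_derivative_def
      by (simp add: linear_cmul[OF linear_dacoord] linear_cmul[OF has_derivative_linear[OF dY[unfolded xuy(1)]]] xuy)
    have "isCont (\<lambda>t. k t $ \<sigma> None) 0"
      using has_derivative_continuous[OF kd] by (intro continuous_intros)
    then have "((\<lambda>t. k t $ \<sigma> None) \<longlongrightarrow> k 0 $ \<sigma> None) (nhds 0)"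
      unfolding isCont_def by (rule tendsto_at_iff_tendsto_nhds[THEN iffD1])
    then have nz: "eventually (\<lambda>t. k t $ \<sigma> None \<noteq> 0) (nhds 0)"
      by (rule tendsto_imp_eventually_ne) (use s k(2) in simp)
    have "eventually (\<lambda>t. ?Y (acoord \<sigma> (k t)) = dacoord \<sigma> (k t) (h t)) (nhds 0)"
      using nz ev
      by eventually_elim (use s in \<open>simp add: cinv_affine_chart alift_acoord cline_scale dhopf_affine_chart\<close>)
    then have D2: "((\<lambda>t. dacoord \<sigma> (k t) (h t)) has_vector_derivative frechet_derivative ?Y (at x) u) (at 0)"
      unfolding has_vector_derivative_def
      by (rule has_derivative_transform_nhds[OF D1[unfolded has_vector_derivative_def]])
    have "DY ?c = frechet_derivative ?Y (at x) u"
      unfolding DY_def using s xuy by (simp add: cmap_cline dhopf_affine_chart)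
    also have "\<dots> = (\<chi> i. ((h' $ \<sigma> (Some i) * z $ \<sigma> None + h 0 $ \<sigma> (Some i) * v $ \<sigma> None
          - (z $ \<sigma> (Some i) * h' $ \<sigma> None + v $ \<sigma> (Some i) * h 0 $ \<sigma> None)) * (z $ \<sigma> None)\<^sup>2
          - (h 0 $ \<sigma> (Some i) * z $ \<sigma> None - z $ \<sigma> (Some i) * h 0 $ \<sigma> None)
            * (2 * v $ \<sigma> None * z $ \<sigma> None)) / ((z $ \<sigma> None)\<^sup>2 * (z $ \<sigma> None)\<^sup>2))"
      (is "_ = ?R")
    proof -
      have nth: "((\<lambda>t. f t $ j) has_derivative (\<lambda>t. t *\<^sub>R (f' $ j))) (at 0)"
        if "(f has_vector_derivative f') (at 0)" for f f' and j :: "'k option"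
        using bounded_linear.has_derivative[OF bounded_linear_vec_nth[of j]
            that[unfolded has_vector_derivative_def]] by simp
      note kn = nth[OF k(1)] and hn = nth[OF h]
      have "((\<lambda>t. (h t $ \<sigma> (Some i) * k t $ \<sigma> None - k t $ \<sigma> (Some i) * h t $ \<sigma> None) / (k t $ \<sigma> None * k t $ \<sigma> None))
          has_derivative (\<lambda>t. t *\<^sub>R (?R $ i))) (at 0)" for i
        by (rule has_derivative_eq_rhs[OF has_derivative_divide[OF has_derivative_diff[OF
                  has_derivative_mult[OF hn kn] has_derivative_mult[OF kn hn]] has_derivative_mult[OF kn kn]]])
          (use s k(2) in \<open>simp_all add: fun_eq_iff scaleR_conv_of_real field_simps power2_eq_square\<close>)
      then have "((\<lambda>t. \<chi> i. (h t $ \<sigma> (Some i) * k t $ \<sigma> None - k t $ \<sigma> (Some i) * h t $ \<sigma> None) / (k t $ \<sigma> None * k t $ \<sigma> None))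
          has_derivative (\<lambda>t. \<chi> i. t *\<^sub>R (?R $ i))) (at 0)"
        by (rule has_derivative_vec_lambda)
      moreover have "(\<chi> i. t *\<^sub>R (?R $ i)) = t *\<^sub>R ?R" for t by (simp add: vec_eq_iff)
      ultimately have "((\<lambda>t. dacoord \<sigma> (k t) (h t)) has_vector_derivative ?R) (at 0)"
        unfolding has_vector_derivative_def dacoord_def power2_eq_square by simp
      with D2 show ?thesis by (rule vector_derivative_unique_at)
    qed
    finally have DY: "DY ?c = ?R" .
    let ?n = "of_real (1 + x \<bullet> x) :: complex"
    have hu: "herm u x = - ?n * (v $ \<sigma> None / z $ \<sigma> None)"
      and hy: "herm y x = - ?n * (h 0 $ \<sigma> None / z $ \<sigma> None)"
      unfolding xuy by (rule herm_dacoord_acoord[OF s hor(1)], rule herm_dacoord_acoord[OF s hor(2)])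
    have n: "?n \<noteq> 0" using one_plus_inner_pos[of x] by (simp only: of_real_eq_0_iff)
    have "- (1 / (1 + x \<bullet> x)) *\<^sub>R (herm u x *s y + herm y x *s u)
        = (v $ \<sigma> None / z $ \<sigma> None) *s y + (h 0 $ \<sigma> None / z $ \<sigma> None) *s u"
    proof -
      have alg: "- (1 / N) * (- N * a * b + - N * a' * b') = a * b + a' * b'"
        if "N \<noteq> 0" for N a b a' b' :: complex
        using that by (simp add: field_simps)
      show ?thesis
        unfolding hu hy scaleR_eq_scale of_real_minus of_real_divide of_real_1 vec_eq_iff
          vector_smult_component vector_add_component
        by (intro allI alg[OF n])
    qed
    also have "\<dots> = dhopf z h' ?c - DY ?c"
      unfolding DY using s(2) by (simp add: vec_eq_iff dhopf_affine_chart[OF s] xuy dacoord_def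
          field_simps power2_eq_square)
    finally show ?thesis by simp
  qed
  show ?thesis
    unfolding levi_civita_def
  proof (rule the_equality, goal_cases)
    case 1
    show ?case
    proof (intro conjI ballI allI)
      show "dhopf z h' \<in> tangent_space CP (cline z)"
        using tangent_space_CP[OF z0] by blast
      fix c and w :: "complex ^ 'k" assume "c \<in> charts_at CP (cline z)"
      then obtain \<sigma> where s: "bij \<sigma>" "c = affine_chart \<sigma>" "z $ \<sigma> None \<noteq> 0" by (rule charts_at_CP_E)
      have DY: "frechet_derivative (\<lambda>x'. \<xi> (cinv (affine_chart \<sigma>) x') (affine_chart \<sigma>)) (at (acoord \<sigma> z))
          (dacoord \<sigma> z v) = DY (affine_chart \<sigma>)"
        by (simp add: DY_def cmap_cline[of z \<sigma>, OF s(3)] dhopf_affine_chart[OF s(1,3)])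
      note chr = christoffel[OF s(1,3) refl refl refl, unfolded dhopf_affine_chart[OF s(1,3)]]
      show "let x = cmap c (cline z); u = dhopf z v c; y = \<xi> (cline z) c;
          DY = frechet_derivative (\<lambda>x'. \<xi> (cinv c x') c) (at x) u
        in metric_coeff CP gFS c x (dhopf z h' c - DY) w =
             (frechet_derivative (\<lambda>x'. metric_coeff CP gFS c x' y w) (at x) u
            + frechet_derivative (\<lambda>x'. metric_coeff CP gFS c x' u w) (at x) y
            - frechet_derivative (\<lambda>x'. metric_coeff CP gFS c x' u y) (at x) w) / 2"
        unfolding Let_def s(2) \<xi>z metric_coeff_eq_fs[OF s(1)] cmap_cline[of z \<sigma>, OF s(3)]
          dhopf_affine_chart[OF s(1,3)] DY chr
        by (rule fs_christoffel)
    qed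
  next
    case (2 Z)
    obtain \<sigma> :: "'k option \<Rightarrow> 'k option" where s: "bij \<sigma>" "z $ \<sigma> None \<noteq> 0"
      using exists_affine_chart[OF z0] .
    let ?c = "affine_chart \<sigma>" and ?x = "acoord \<sigma> z"
    have c: "?c \<in> charts_at CP (cline z)" by (rule affine_chart_in_charts_at[OF s])
    have eq: "fs ?x (Z ?c - DY ?c) w = fs ?x (dhopf z h' ?c - DY ?c) w" for w
    proof -
      have "fs ?x (Z ?c - DY ?c) w = (frechet_derivative (\<lambda>x'. fs x' (dhopf z (h 0) ?c) w) (at ?x) (dhopf z v ?c)
            + frechet_derivative (\<lambda>x'. fs x' (dhopf z v ?c) w) (at ?x) (dhopf z (h 0) ?c)
            - frechet_derivative (\<lambda>x'. fs x' (dhopf z v ?c) (dhopf z (h 0) ?c)) (at ?x) w) / 2"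
        using 2[THEN conjunct2, rule_format, OF c, of w]
        unfolding Let_def DY_def \<xi>z metric_coeff_eq_fs[OF s(1)] cmap_cline[of z \<sigma>, OF s(2)] .
      also have "\<dots> = fs ?x (dhopf z h' ?c - DY ?c) w"
        unfolding christoffel[OF s refl refl refl, unfolded dhopf_affine_chart[OF s]] dhopf_affine_chart[OF s]
        by (rule fs_christoffel[symmetric])
      finally show ?thesis .
    qed
    \<comment> \<open>Uniqueness: the difference has vanishing length, so it lifts to a multiple of the
      representative \<open>alift \<sigma> ?x\<close>, whose entry at \<open>\<sigma> None\<close> is \<open>1\<close>, while that of the lift is \<open>0\<close>.\<close>
    define d where "d = Z ?c - dhopf z h' ?c"
    have "fs ?x d d = fs ?x (Z ?c - DY ?c) d - fs ?x (dhopf z h' ?c - DY ?c) d"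
      by (simp add: fs_def d_def herm_simps diff_divide_distrib ring_distribs)
    then have "fs ?x d d = 0" using eq by simp
    then have "hpart (alift \<sigma> ?x) (adir \<sigma> d) = 0"
      using one_plus_inner_pos[of ?x]
      by (simp add: metric_coeff_eq_fs[OF s(1), symmetric] metric_coeff_hpart[OF s(1)])
    then have "adir \<sigma> d = (herm (adir \<sigma> d) (alift \<sigma> ?x) / herm (alift \<sigma> ?x) (alift \<sigma> ?x)) *s alift \<sigma> ?x"
      by (simp add: hpart_def)
    then obtain e where e: "adir \<sigma> d = e *s alift \<sigma> ?x" by blast
    then have "(adir \<sigma> d) $ \<sigma> None = (e *s alift \<sigma> ?x) $ \<sigma> None" by (rule arg_cong)
    then have "e = 0" using s(1) by simp
    then have "adir \<sigma> d = 0" using e by simp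
    then have "d = 0" using adir_nth(2)[OF s(1), of d] by (simp add: vec_eq_iff)
    then have "Z ?c = dhopf z h' ?c" by (simp add: d_def)
    then show ?case
      using tangent_space_determined[OF 2[THEN conjunct1] _ c] tangent_space_CP[OF z0] by blast
  qed
qed

section \<open>The quadric and its shape operators\<close>

text \<open>
  The cone over the quadric consists of the vectors \<open>z\<close> with \<open>herm z (cconj z) = 0\<close>. Its tangent
  space at \<open>z\<close>, modulo the line of \<open>z\<close>, is represented by the vectors orthogonal to \<open>z\<close> and \<open>cconj z\<close>.
\<close>

definition qhor :: "complex ^ 'm::finite \<Rightarrow> (complex ^ 'm) set" where
  "qhor z = {v. herm v z = 0 \<and> herm v (cconj z) = 0}"

lemma cline_in_Quadric_iff:
  assumes "z \<noteq> 0"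
  shows "cline z \<in> Quadric \<longleftrightarrow> herm z (cconj z) = 0"
proof
  assume "cline z \<in> Quadric"
  then obtain w where w: "cline z = cline w" "herm w (cconj w) = 0"
    by (auto simp: Quadric_def sum_squares_eq_herm)
  then obtain c where "z = c *s w" using cline_eqD[OF w(1) assms] by blast
  then show "herm z (cconj z) = 0" using w(2) by (simp add: cconj_simps herm_simps)
next
  assume z: "herm z (cconj z) = 0"
  let ?w = "(1 / norm z) *\<^sub>R z"
  have "cline ?w = cline z" using assms by (simp add: scaleR_eq_scale cline_scale)
  moreover have "?w \<in> sphere 0 1" using assms by simp
  moreover have "herm ?w (cconj ?w) = 0" using z by (simp add: cconj_simps herm_simps)
  ultimately show "cline z \<in> Quadric"
    unfolding Quadric_def sum_squares_eq_herm by blast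
qed

text \<open>
  A curve in the cone over the quadric with velocity \<open>v\<close> at \<open>z\<close>. The straight line \<open>z + tv\<close> leaves the cone
  with the error \<open>t\<^sup>2 herm v (cconj v)\<close>; the multiple of \<open>cconj z\<close> compensates it exactly, because \<open>cconj z\<close> is
  itself in the cone and pairs trivially with \<open>v\<close>.
\<close>

definition qcurve :: "complex ^ 'm::finite \<Rightarrow> complex ^ 'm \<Rightarrow> real \<Rightarrow> complex ^ 'm" where
  "qcurve z v t = z + t *\<^sub>R v + (t * t) *\<^sub>R (- (herm v (cconj v) / (2 * herm z z)) *s cconj z)"

lemma qcurve_0: "qcurve z v 0 = z"
  by (simp add: qcurve_def)

lemma has_vector_derivative_qcurve: "(qcurve z v has_vector_derivative v) (at 0)"
  unfolding qcurve_def by (auto intro!: derivative_eq_intros)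

lemma herm_qcurve_cconj:
  assumes "z \<noteq> 0" "herm z (cconj z) = 0" "v \<in> qhor z"
  shows "herm (qcurve z v t) (cconj (qcurve z v t)) = 0"
proof -
  have 1: "herm v (cconj z) = 0" "herm z (cconj v) = 0" "herm v z = 0" "herm (cconj z) (cconj v) = 0"
    "herm (cconj z) z = 0"
    using assms herm_cconj_commute[of z v] herm_cconj_cconj[of z v]
    by (auto simp: qhor_def) (metis herm_eq_0_commute)
  show ?thesis
    using assms(1,2) 1
    by (simp add: qcurve_def cconj_simps herm_simps herm_cconj_cconj)
qed

lemma qcurve_nonzero:
  assumes "z \<noteq> 0" "herm z (cconj z) = 0" "v \<in> qhor z"
  shows "qcurve z v t \<noteq> 0"
proof
  assume "qcurve z v t = 0"
  then have "herm (qcurve z v t) z = 0" by simp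
  moreover have "herm (cconj z) z = 0" using assms(2) by (metis herm_eq_0_commute)
  ultimately show False
    using assms by (simp add: qcurve_def herm_simps qhor_def)
qed

lemma smooth_on_qcurve: "smooth_on UNIV (qcurve z v)"
  unfolding qcurve_def
  by (intro smooth_on_add smooth_on_scaleR smooth_on_const smooth_on_mult smooth_on_ident open_UNIV)

lemma dhopf_in_quadric_tangent:
  fixes z :: "complex ^ 'k::finite option"
  assumes z: "z \<noteq> 0" "herm z (cconj z) = 0" and v: "v \<in> qhor z"
  shows "dhopf z v \<in> quadric_tangent (cline z)"
proof -
  define \<gamma> where "\<gamma> t = cline (qcurve z v t)" for t
  have nz: "qcurve z v t \<noteq> 0" for t by (rule qcurve_nonzero[OF z v])
  have "push CP \<gamma> 0 1 = dhopf (qcurve z v 0) (1 *\<^sub>R v)"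
    by (rule push_eq_dhopf) (use has_vector_derivative_qcurve in \<open>auto simp: has_vector_derivative_def \<gamma>_def\<close>)
  then have "push CP \<gamma> 0 1 = dhopf z v" by (simp add: qcurve_0)
  moreover have "\<gamma> t \<in> Quadric" for t
    unfolding \<gamma>_def cline_in_Quadric_iff[OF nz] by (rule herm_qcurve_cconj[OF z v])
  moreover have "smooth_curve CP {-1<..<1} \<gamma>"
    unfolding smooth_curve_def
  proof
    fix t :: real assume t: "t \<in> {-1<..<1}"
    obtain \<sigma> :: "'k option \<Rightarrow> 'k option" where s: "bij \<sigma>" "qcurve z v t $ \<sigma> None \<noteq> 0"
      using exists_affine_chart[OF nz] .
    let ?S = "{s. qcurve z v s $ \<sigma> None \<noteq> 0} \<inter> {-1<..<1}"
    have "continuous_on UNIV (\<lambda>s. qcurve z v s $ \<sigma> None)"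
      by (intro continuous_intros smooth_on_imp_continuous_on[OF smooth_on_qcurve])
    then have "open ?S"
      by (intro open_Int open_Collect_neq continuous_on_const) auto
    then obtain \<delta> where d: "\<delta> > 0" "ball t \<delta> \<subseteq> ?S"
      using s(2) t by (auto elim!: openE)
    have "smooth_on (ball t \<delta>) (\<lambda>s. acoord \<sigma> (qcurve z v s))"
      by (rule smooth_on_acoord[OF _ smooth_on_subset[OF smooth_on_qcurve]]) (use d(2) in auto)
    then have "smooth_on (ball t \<delta>) (cmap (affine_chart \<sigma>) \<circ> \<gamma>)"
      by (rule smooth_on_cong[rotated 2]) (use d(2) in \<open>auto simp: \<gamma>_def cmap_cline subset_iff\<close>)
    moreover have "affine_chart \<sigma> \<in> charts_at CP (\<gamma> t)"
      using affine_chart_in_charts_at[OF s] by (simp add: \<gamma>_def)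
    moreover have "\<gamma> ` ball t \<delta> \<subseteq> cdom (affine_chart \<sigma>)"
      using d(2) by (auto simp: \<gamma>_def cline_in_cdom)
    ultimately show "\<exists>d\<in>charts_at CP (\<gamma> t). \<exists>\<delta>>0. ball t \<delta> \<subseteq> {-1<..<1} \<and>
        \<gamma> ` ball t \<delta> \<subseteq> cdom d \<and> smooth_on (ball t \<delta>) (cmap d \<circ> \<gamma>)"
      using d by (intro bexI[of _ "affine_chart \<sigma>"] exI[of _ \<delta>]) auto
  qed
  moreover have "\<gamma> 0 = cline z" by (simp add: \<gamma>_def qcurve_0)
  ultimately show ?thesis
    unfolding quadric_tangent_def by (intro CollectI exI[of _ \<gamma>] conjI exI[of _ 1]) auto
qed

text \<open>
  The quadratic equation of the cone, differentiated along any lift of a curve in the quadric, gives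
  \<open>herm v (cconj z) = 0\<close>; conversely \<open>qcurve\<close> realises all such \<open>v\<close>.
\<close>

lemma quadric_tangent_cline:
  fixes z :: "complex ^ 'k::finite option"
  assumes z: "z \<noteq> 0" "herm z (cconj z) = 0"
  shows "quadric_tangent (cline z) = dhopf z ` qhor z"
proof
  show "dhopf z ` qhor z \<subseteq> quadric_tangent (cline z)"
    using dhopf_in_quadric_tangent[OF z] by blast
  show "quadric_tangent (cline z) \<subseteq> dhopf z ` qhor z"
  proof
    fix X assume "X \<in> quadric_tangent (cline z)"
    then obtain \<gamma> \<epsilon> where X: "X = push CP \<gamma> 0 (1::real)" and g0: "\<gamma> 0 = cline z" and e: "\<epsilon> > 0"
      and sc: "smooth_curve CP {-\<epsilon><..<\<epsilon>} \<gamma>" and Q: "\<And>t. t \<in> {-\<epsilon><..<\<epsilon>} \<Longrightarrow> \<gamma> t \<in> Quadric"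
      unfolding quadric_tangent_def by blast
    obtain d \<delta> where d: "d \<in> charts_at CP (\<gamma> 0)" "\<delta> > 0" "ball 0 \<delta> \<subseteq> {-\<epsilon><..<\<epsilon>}"
      "\<gamma> ` ball 0 \<delta> \<subseteq> cdom d" "smooth_on (ball 0 \<delta>) (cmap d \<circ> \<gamma>)"
      using sc e unfolding smooth_curve_def by (metis greaterThanLessThan_iff neg_less_0_iff_less)
    obtain \<sigma> where s: "bij \<sigma>" "d = affine_chart \<sigma>"
      using d(1) by (auto simp: charts_at_def charts_CP)
    define k where "k t = alift \<sigma> (cmap d (\<gamma> t))" for t
    have k0: "k t \<noteq> 0" for t using s by (simp add: k_def)
    have gk: "\<gamma> t = cline (k t)" if "t \<in> ball 0 \<delta>" for t
    proof -
      have "\<gamma> t \<in> cdom (affine_chart \<sigma>)" using d(4) that s(2) by blast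
      then obtain w where "\<gamma> t = cline w" "w $ \<sigma> None \<noteq> 0"
        by (auto simp: affine_chart_def)
      then show ?thesis using s by (simp add: k_def cmap_cline alift_acoord cline_scale)
    qed
    have in0: "0 \<in> ball 0 \<delta>" using d(2) by simp
    have "((cmap d \<circ> \<gamma>) has_derivative frechet_derivative (cmap d \<circ> \<gamma>) (at 0)) (at 0)"
      by (rule smooth_on_imp_has_derivative[OF d(5) in0])
    from has_derivative_compose[OF this has_derivative_alift[OF s(1)]]
    obtain k' where k': "(k has_derivative k') (at 0)"
      unfolding k_def[abs_def] o_def by blast
    have X': "X = dhopf (k 0) (k' 1)"
      unfolding X
      by (rule push_eq_dhopf[OF k']) (use gk d(2) in \<open>auto intro!: eventually_nhds_in_open[THEN eventually_mono, of "ball 0 \<delta>"]\<close>)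
    have kQ: "herm (k t) (cconj (k t)) = 0" if "t \<in> ball 0 \<delta>" for t
      using cline_in_Quadric_iff[OF k0, of t] Q[of t] gk[OF that] d(3) that by auto
    have "((\<lambda>t. herm (k t) (cconj (k t))) has_derivative
        (\<lambda>t. herm (k 0) (cconj (k' t)) + herm (k' t) (cconj (k 0)))) (at 0)"
      by (rule bounded_bilinear.FDERIV[OF bounded_bilinear_herm k'
            bounded_linear.has_derivative[OF bounded_linear_cconj k']])
    moreover have "((\<lambda>t. herm (k t) (cconj (k t))) has_derivative (\<lambda>t. 0)) (at 0)"
      by (rule has_derivative_transform_within_open[OF has_derivative_const[of 0] open_ball in0])
        (simp add: kQ)
    ultimately have "(\<lambda>t. herm (k 0) (cconj (k' t)) + herm (k' t) (cconj (k 0))) = (\<lambda>t. 0)"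
      by (rule has_derivative_unique)
    then have "herm (k 0) (cconj (k' 1)) + herm (k' 1) (cconj (k 0)) = 0" by metis
    then have tang: "herm (k' 1) (cconj (k 0)) = 0"
      using herm_cconj_commute[of "k 0" "k' 1"] by simp
    have "cline z = cline (k 0)" using g0 gk[OF in0] by simp
    then obtain c where c: "c \<noteq> 0" "z = c *s k 0" using cline_eqD[OF _ z(1)] by blast
    have "X = dhopf z (c *s k' 1)"
      unfolding X' c(2) using dhopf_homogeneous[OF c(1), of "k 0" "k' 1" 0] by simp
    then have "X = dhopf z (hpart z (c *s k' 1))" by (simp add: dhopf_hpart)
    moreover have "hpart z (c *s k' 1) \<in> qhor z"
      using z tang by (simp add: qhor_def herm_hpart)
        (simp add: hpart_def herm_simps c(2) cconj_simps)
    ultimately show "X \<in> dhopf z ` qhor z" by blast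
  qed
qed

lemma qhor_scale: "v \<in> qhor z \<Longrightarrow> c *s v \<in> qhor z"
  and qhor_add: "v \<in> qhor z \<Longrightarrow> w \<in> qhor z \<Longrightarrow> v + w \<in> qhor z"
  and qhor_diff: "v \<in> qhor z \<Longrightarrow> w \<in> qhor z \<Longrightarrow> v - w \<in> qhor z"
  and qhor_cconj: "v \<in> qhor z \<Longrightarrow> cconj v \<in> qhor z"
proof -
  assume v: "v \<in> qhor z"
  have "herm (cconj v) z = cnj (herm v (cconj z))"
    by (metis cconj_simps(5) cnj_herm herm_cconj_cconj)
  moreover have "herm (cconj v) (cconj z) = cnj (herm v z)"
    by (simp add: herm_cconj_cconj cnj_herm)
  ultimately show "cconj v \<in> qhor z" using v by (simp add: qhor_def)
qed (simp_all add: qhor_def herm_simps)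

text \<open>
  Since \<open>qhor z\<close> is a complex subspace, the orthogonal complement of the tangent space of the quadric
  is the complex line spanned by the projection of \<open>cconj z\<close>.
\<close>

lemma unit_normal_eq:
  fixes z :: "complex ^ 'k::finite option"
  assumes z: "norm z = 1" "herm z (cconj z) = 0"
    and Y: "Y \<in> tangent_space CP (cline z)" "gFS (cline z) Y Y = 1"
      "\<And>X. X \<in> quadric_tangent (cline z) \<Longrightarrow> gFS (cline z) Y X = 0"
  obtains c where "norm c = 1" "Y = dhopf z (c *s cconj z)"
proof -
  have z0: "z \<noteq> 0" using z(1) by auto
  obtain y where y: "herm y z = 0" "Y = dhopf z y"
    using tangent_space_CP_horizontal[OF z0 Y(1)] .
  have zz: "herm z z = 1" "herm (cconj z) (cconj z) = 1"
    unfolding herm_cconj_cconj using z(1) by (simp_all add: herm_self_norm)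
  have zc: "herm (cconj z) z = 0" using z(2) by (metis herm_eq_0_commute)
  define c where "c = herm y (cconj z)"
  define w where "w = y - c *s cconj z"
  have w: "w \<in> qhor z" using y zz zc by (simp add: w_def c_def qhor_def herm_simps)
  have wz: "herm w z = 0" "herm w (cconj z) = 0" using w by (auto simp: qhor_def)
  have "dhopf z w \<in> quadric_tangent (cline z)"
    by (rule dhopf_in_quadric_tangent[OF z0 z(2) w])
  from Y(3)[OF this] have "y \<bullet> w = 0" using gFS_dhopf[OF z(1) y(1) wz(1)] y(2) by simp
  moreover have "y \<bullet> w = w \<bullet> w"
  proof -
    have "herm w (c *s cconj z) = 0" using wz by (simp add: herm_simps)
    then have "w \<bullet> (c *s cconj z) = 0" by (metis Re_herm zero_complex.sel(1))
    moreover have "y = w + c *s cconj z" by (simp add: w_def)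
    ultimately show ?thesis by (simp add: inner_add_left inner_add_right inner_commute)
  qed
  ultimately have yc: "y = c *s cconj z" by (simp add: w_def)
  have "y \<bullet> y = 1" using Y(2) gFS_dhopf[OF z(1) y(1) y(1)] y(2) by simp
  then have "herm y y = 1" by (simp add: herm_self)
  then have "c * cnj c = 1" by (simp add: yc herm_simps zz mult_ac)
  then have "norm c = 1"
    by (metis complex_norm_square norm_ge_zero of_real_eq_1_iff power2_eq_1_iff abs_of_nonneg
        abs_neg_one norm_minus_cancel)
  then show thesis using that y(2) yc by blast
qed

lemma unit_normal_field_eq:
  fixes z :: "complex ^ 'k::finite option"
  assumes \<xi>: "unit_normal_field W \<xi>" and z: "z \<noteq> 0" "herm z (cconj z) = 0" "cline z \<in> W"
  obtains c where "norm c = 1" "\<xi> (cline z) = dhopf z (c *s cconj z)"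
proof -
  let ?r = "complex_of_real (1 / norm z)"
  have r: "?r \<noteq> 0" using z(1) by simp
  have n: "norm (?r *s z) = 1" unfolding scaleR_eq_scale[symmetric] using z(1) by simp
  have e: "cline (?r *s z) = cline z" by (rule cline_scale[OF r])
  have h: "herm (?r *s z) (cconj (?r *s z)) = 0" using z(2) by (simp add: cconj_simps herm_simps)
  have Q: "cline z \<in> Quadric \<inter> W" using cline_in_Quadric_iff[OF z(1)] z by blast
  obtain c where c: "norm c = 1" "\<xi> (cline z) = dhopf (?r *s z) (c *s cconj (?r *s z))"
  proof (rule unit_normal_eq[OF n h, unfolded e])
    show "\<xi> (cline z) \<in> tangent_space CP (cline z)"
      using \<xi> z(3) unfolding unit_normal_field_def smooth_field_def by blast
    show "gFS (cline z) (\<xi> (cline z)) (\<xi> (cline z)) = 1"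
      using \<xi> Q unfolding unit_normal_field_def by blast
    show "gFS (cline z) (\<xi> (cline z)) X = 0" if "X \<in> quadric_tangent (cline z)" for X
      using \<xi> Q that unfolding unit_normal_field_def by blast
  qed
  have "c *s cconj (?r *s z) = ?r *s (c *s cconj z) + 0 *s z"
    unfolding cconj_simps complex_cnj_complex_of_real by (simp add: mult.commute)
  then have "\<xi> (cline z) = dhopf z (c *s cconj z)"
    using c(2) dhopf_homogeneous[OF r] by metis
  then show thesis using that c(1) by blast
qed

text \<open>
  The coefficient of a normal vector, read off in an affine chart: pairing the components with those of \<open>z\<close>
  isolates it because \<open>\<Sum> z\<^sub>j\<^sup>2 = 0\<close>. The formula shows that the coefficient of a smooth normal field is smooth.
\<close>

definition ncoeff :: "('k option \<Rightarrow> 'k option) \<Rightarrow> complex ^ 'k option \<Rightarrow> complex ^ 'k::finite \<Rightarrow> complex" where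
  "ncoeff \<sigma> z Y = z $ \<sigma> None * (\<Sum>i\<in>UNIV. Y $ i * z $ \<sigma> (Some i)) / herm z z"

lemma ncoeff_dhopf:
  assumes "z \<noteq> 0" "herm z (cconj z) = 0" "bij \<sigma>" "z $ \<sigma> None \<noteq> 0"
  shows "ncoeff \<sigma> z (dhopf z (c *s cconj z) (affine_chart \<sigma>)) = c"
proof -
  let ?z0 = "z $ \<sigma> None"
  have 1: "(\<Sum>i\<in>UNIV. z $ \<sigma> (Some i) * z $ \<sigma> (Some i)) = - (?z0 * ?z0)"
    using assms(2) sum_bij_option[OF assms(3), of "\<lambda>j. z $ j * z $ j"]
    by (simp add: sum_squares_eq_herm[symmetric] power2_eq_square eq_neg_iff_add_eq_0 add.commute)
  have 2: "(\<Sum>i\<in>UNIV. cnj (z $ \<sigma> (Some i)) * z $ \<sigma> (Some i)) = herm z z - ?z0 * cnj ?z0"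
    using sum_bij_option[OF assms(3), of "\<lambda>j. z $ j * cnj (z $ j)"]
    by (simp add: herm_def mult.commute)
  have "(\<Sum>i\<in>UNIV. dhopf z (c *s cconj z) (affine_chart \<sigma>) $ i * z $ \<sigma> (Some i))
      = (\<Sum>i\<in>UNIV. (c / ?z0) * (cnj (z $ \<sigma> (Some i)) * z $ \<sigma> (Some i))
          - (c * cnj ?z0 / ?z0\<^sup>2) * (z $ \<sigma> (Some i) * z $ \<sigma> (Some i)))"
    by (rule sum.cong) (use assms(4) in \<open>auto simp: dhopf_affine_chart[OF assms(3,4)] dacoord_def cconj_def
        field_simps power2_eq_square\<close>)
  also have "\<dots> = (c / ?z0) * (herm z z - ?z0 * cnj ?z0) + c * cnj ?z0"
    using assms(4) by (simp only: sum_subtractf sum_distrib_left[symmetric] 1 2)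
      (simp add: power2_eq_square)
  also have "\<dots> = (c / ?z0) * herm z z"
    using assms(4) by (simp add: field_simps)
  finally show ?thesis
    using assms(1,4) by (simp add: ncoeff_def)
qed

lemma tangential_dhopf:
  fixes z :: "complex ^ 'k::finite option"
  assumes z: "norm z = 1" "herm z (cconj z) = 0" and w: "w \<in> qhor z"
  shows "tangential (cline z) (dhopf z (w + d *s cconj z)) = dhopf z w"
proof -
  have z0: "z \<noteq> 0" using z(1) by auto
  have zc: "herm (cconj z) z = 0" using z(2) by (metis herm_eq_0_commute)
  have hor: "herm y z = 0" if "y \<in> qhor z" for y using that by (simp add: qhor_def)
  have perp: "gFS (cline z) (dhopf z (w + d *s cconj z) - dhopf z t) (dhopf z y) = (w - t) \<bullet> y"
    if "t \<in> qhor z" "y \<in> qhor z" for t y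
  proof -
    have a: "herm (w + d *s cconj z - t) z = 0"
      using hor[OF w] hor[OF that(1)] zc by (simp add: herm_simps)
    have "herm y (d *s cconj z) = 0" using that(2) by (simp add: qhor_def herm_simps)
    then have "y \<bullet> (d *s cconj z) = 0" by (metis Re_herm zero_complex.sel(1))
    then show ?thesis
      unfolding dhopf_diff gFS_dhopf[OF z(1) a hor[OF that(2)]]
      by (simp add: algebra_simps inner_commute)
  qed
  show ?thesis
    unfolding tangential_def
  proof (rule the_equality)
    show "dhopf z w \<in> quadric_tangent (cline z) \<and>
        (\<forall>Y\<in>quadric_tangent (cline z). gFS (cline z) (dhopf z (w + d *s cconj z) - dhopf z w) Y = 0)"
      unfolding quadric_tangent_cline[OF z0 z(2)] using w perp[OF w] by auto
    fix T assume T: "T \<in> quadric_tangent (cline z) \<and>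
        (\<forall>Y\<in>quadric_tangent (cline z). gFS (cline z) (dhopf z (w + d *s cconj z) - T) Y = 0)"
    then obtain t where t: "t \<in> qhor z" "T = dhopf z t"
      unfolding quadric_tangent_cline[OF z0 z(2)] by blast
    have wt: "w - t \<in> qhor z" by (rule qhor_diff[OF w t(1)])
    then have "(w - t) \<bullet> (w - t) = 0"
      using T perp[OF t(1) wt] t(2) unfolding quadric_tangent_cline[OF z0 z(2)] by auto
    then show "T = dhopf z w" using t(2) by simp
  qed
qed

text \<open>
  Along a curve \<open>qcurve z v\<close> a unit normal field is the projection of \<open>\<kappa>(t) cconj (qcurve z v t)\<close>. Its
  derivative is \<open>\<kappa>' cconj z + \<kappa> cconj v\<close>, and only the second term is tangential to the quadric.
\<close>

lemma shape_operator_formula: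
  fixes z :: "complex ^ 'k::finite option"
  assumes \<xi>: "unit_normal_field W \<xi>" and z: "norm z = 1" "herm z (cconj z) = 0" "cline z \<in> W"
    and c: "\<xi> (cline z) = dhopf z (c *s cconj z)" and v: "v \<in> qhor z"
  shows "tangential (cline z) (levi_civita CP gFS (cline z) (dhopf z v) \<xi>) = dhopf z (c *s cconj v)"
proof -
  have z0: "z \<noteq> 0" using z(1) by auto
  have W: "openin (mtop CP) W" and sf: "smooth_field CP W \<xi>"
    using \<xi> by (auto simp: unit_normal_field_def)
  have zc: "herm (cconj z) z = 0" using z(2) by (metis herm_eq_0_commute)
  let ?k = "qcurve z v"
  have k0: "?k t \<noteq> 0" and kQ: "herm (?k t) (cconj (?k t)) = 0" for t
    using qcurve_nonzero[OF z0 z(2) v] herm_qcurve_cconj[OF z0 z(2) v] .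
  have kd: "(?k has_derivative (\<lambda>t. t *\<^sub>R v)) (at 0)"
    using has_vector_derivative_qcurve by (simp add: has_vector_derivative_def)
  obtain \<sigma> :: "'k option \<Rightarrow> 'k option" where s: "bij \<sigma>" "z $ \<sigma> None \<noteq> 0"
    using exists_affine_chart[OF z0] .
  let ?Y = "\<lambda>x. \<xi> (cinv (affine_chart \<sigma>) x) (affine_chart \<sigma>)"
  define \<kappa> where "\<kappa> t = ncoeff \<sigma> (?k t) (?Y (acoord \<sigma> (?k t)))" for t
  have "open {z. z \<noteq> 0 \<and> cline z \<in> W}" by (rule open_cone[OF W])
  moreover have "open {z :: complex ^ 'k option. z $ \<sigma> None \<noteq> 0}"
    by (intro open_Collect_neq continuous_intros)
  moreover have tend: "(?k \<longlongrightarrow> z) (nhds 0)"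
    using has_derivative_continuous[OF kd] qcurve_0[of z v]
    by (metis continuous_within isCont_def tendsto_at_iff_tendsto_nhds)
  ultimately have ev: "eventually (\<lambda>t. cline (?k t) \<in> W \<and> ?k t $ \<sigma> None \<noteq> 0) (nhds 0)"
    using topological_tendstoD[OF tend, of "{z. z \<noteq> 0 \<and> cline z \<in> W}"]
      topological_tendstoD[OF tend, of "{z. z $ \<sigma> None \<noteq> 0}"] z0 z(3) s(2)
    by (auto elim: eventually_elim2)
  have \<xi>k: "\<xi> (cline (?k t)) = dhopf (?k t) (\<kappa> t *s cconj (?k t))"
    if kt: "cline (?k t) \<in> W" "?k t $ \<sigma> None \<noteq> 0" for t
  proof -
    obtain b where b: "\<xi> (cline (?k t)) = dhopf (?k t) (b *s cconj (?k t))"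
      using unit_normal_field_eq[OF \<xi> k0 kQ kt(1)] by blast
    have "?Y (acoord \<sigma> (?k t)) = \<xi> (cline (?k t)) (affine_chart \<sigma>)"
      using s kt by (simp add: cinv_affine_chart alift_acoord cline_scale)
    then have "\<kappa> t = b"
      unfolding \<kappa>_def b using ncoeff_dhopf[OF k0 kQ s(1) kt(2)] by metis
    then show ?thesis using b by simp
  qed
  have Yd: "(?Y has_derivative frechet_derivative ?Y (at (acoord \<sigma> z))) (at (acoord \<sigma> z))"
  proof (rule smooth_on_imp_has_derivative)
    show "smooth_on (cmap (affine_chart \<sigma>) ` (cdom (affine_chart \<sigma>) \<inter> W)) ?Y"
      using sf s(1) unfolding smooth_field_def charts_CP by blast
    show "acoord \<sigma> z \<in> cmap (affine_chart \<sigma>) ` (cdom (affine_chart \<sigma>) \<inter> W)"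
      using s z(3) by (simp add: cmap_image_affine_chart alift_acoord cline_scale)
  qed
  have "((\<lambda>t. acoord \<sigma> (?k t)) has_derivative (\<lambda>t. dacoord \<sigma> z (t *\<^sub>R v))) (at 0)"
    by (rule has_derivative_compose[OF kd]) (use has_derivative_acoord[of z \<sigma>] s qcurve_0[of z v] in simp)
  then have "(\<lambda>t. ?Y (acoord \<sigma> (?k t))) differentiable (at 0)"
    by (rule differentiableI[OF has_derivative_compose]) (use Yd qcurve_0[of z v] in simp)
  then have Ydiff: "(\<lambda>t. ?Y (acoord \<sigma> (?k t)) $ i) differentiable (at 0)" for i
    unfolding differentiable_def using bounded_linear.has_derivative[OF bounded_linear_vec_nth] by blast
  have kdiff: "(\<lambda>t. ?k t $ j) differentiable (at 0)" for j
    unfolding differentiable_def using bounded_linear.has_derivative[OF bounded_linear_vec_nth kd] by blast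
  have "(\<lambda>t. herm (?k t) (?k t)) differentiable (at 0)"
    unfolding differentiable_def using bounded_bilinear.FDERIV[OF bounded_bilinear_herm kd kd] by blast
  then have "\<kappa> differentiable (at 0)"
    unfolding \<kappa>_def[abs_def] ncoeff_def
    by (intro differentiable_divide differentiable_mult differentiable_sum ballI Ydiff kdiff finite)
      (use z0 in \<open>auto simp: qcurve_0\<close>)
  then obtain \<kappa>' where k': "(\<kappa> has_vector_derivative \<kappa>') (at 0)"
    using vector_derivative_works by blast
  have hd: "((\<lambda>t. \<kappa> t *s cconj (?k t)) has_vector_derivative \<kappa> 0 *s cconj v + \<kappa>' *s cconj z) (at 0)"
    using bounded_bilinear.FDERIV[OF bounded_bilinear_scale k'[unfolded has_vector_derivative_def]
        bounded_linear.has_derivative[OF bounded_linear_cconj kd]]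
    by (simp add: has_vector_derivative_def cconj_simps qcurve_0 scaleR_add_right)
      (simp add: scaleR_eq_scale scaleR_conv_of_real[where 'a = complex] mult_ac)
  have ev': "eventually (\<lambda>t. \<xi> (cline (?k t)) = dhopf (?k t) (\<kappa> t *s cconj (?k t))) (nhds 0)"
    using ev by eventually_elim (use \<xi>k in blast)
  have lc: "levi_civita CP gFS (cline z) (dhopf z v) \<xi> = dhopf z (\<kappa> 0 *s cconj v + \<kappa>' *s cconj z)"
    by (rule levi_civita_CP[OF W sf z(3) z0 has_vector_derivative_qcurve qcurve_0 hd ev'])
      (use v zc in \<open>simp_all add: qhor_def herm_simps qcurve_0\<close>)
  have "\<kappa> 0 = c"
  proof -
    have "dhopf z (c *s cconj z) = dhopf z (\<kappa> 0 *s cconj z)"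
      using \<xi>k[of 0] z(3) s(2) c by (simp add: qcurve_0)
    then have "c *s cconj z = \<kappa> 0 *s cconj z"
      using zc dhopf_eq_horizontal_iff[OF z0] by (simp add: herm_simps)
    moreover have "cconj z \<noteq> 0" using z0 by (metis cconj_simps(5) herm_cconj_cconj herm_self_eq_0)
    ultimately show ?thesis by (metis vector_mul_rcancel)
  qed
  then show ?thesis
    unfolding lc using tangential_dhopf[OF z(1,2) qhor_scale[OF qhor_cconj[OF v]]] by simp
qed

section \<open>Hypersurfaces of the sphere and their Gauss maps\<close>

lemma cvec_simps:
  "cvec (u + u') (v + v') = cvec u v + cvec u' v'"
  "r *\<^sub>R cvec u v = cvec (r *\<^sub>R u) (r *\<^sub>R v)"
  "\<i> *s cvec u v = cvec (- v) u"
  "cconj (cvec u v) = cvec u (- v)"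
  "- cvec u v = cvec (- u) (- v)"
  "cvec u v - cvec u' v' = cvec (u - u') (v - v')"
  by (simp_all add: cvec_def cconj_def vec_eq_iff complex_eq_iff)

lemma cvec_eq_iff: "cvec u v = cvec u' v' \<longleftrightarrow> u = u' \<and> v = v'"
  by (auto simp: cvec_def vec_eq_iff complex_eq_iff)

lemma cvec_surj: obtains u v where "z = cvec u v"
proof
  show "z = cvec (\<chi> j. Re (z $ j)) (\<chi> j. Im (z $ j))"
    by (simp add: cvec_def vec_eq_iff)
qed

lemma herm_cvec: "herm (cvec u v) (cvec u' v') = Complex (u \<bullet> u' + v \<bullet> v') (v \<bullet> u' - u \<bullet> v')"
  by (simp add: herm_def cvec_def complex_eq_iff inner_vec_def sum.distrib sum_subtractf algebra_simps)

lemma inner_cvec: "cvec u v \<bullet> cvec u' v' = u \<bullet> u' + v \<bullet> v'"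
  by (simp add: Re_herm[symmetric] herm_cvec)

lemma bounded_linear_cvec: "bounded_linear (\<lambda>u :: real ^ 'm::finite. cvec u 0)" "bounded_linear (\<lambda>v :: real ^ 'm. cvec 0 v)"
  by (auto intro!: linear_conv_bounded_linear[THEN iffD1] linearI simp: cvec_def vec_eq_iff complex_eq_iff)

lemma cvec_split: "cvec u v = cvec u 0 + cvec 0 v"
  by (simp add: cvec_simps(1)[symmetric])

definition glift :: "('a \<Rightarrow> real ^ 'm) \<Rightarrow> ('a \<Rightarrow> real ^ 'm) \<Rightarrow> 'a \<Rightarrow> complex ^ 'm::finite" where
  "glift a b p = (1 / sqrt 2) *\<^sub>R cvec (a p) (b p)"

lemma gauss_map_glift: "gauss_map a b p = cline (glift a b p)"
  by (simp add: gauss_map_def glift_def scaleR_eq_scale cline_scale)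

lemma smooth_fun_cvec:
  assumes "smooth_manifold M" "openin (mtop M) U" "smooth_fun M U a" "smooth_fun M U b"
  shows "smooth_fun M U (\<lambda>q. cvec (a q) (b q))"
proof (rule smooth_funI[OF assms(1,2)])
  fix c assume "c \<in> charts M" "open (cmap c ` (cdom c \<inter> U))"
  then show "smooth_on (cmap c ` (cdom c \<inter> U)) (\<lambda>x. cvec (a (cinv c x)) (b (cinv c x)))"
    by (subst cvec_split) (intro smooth_on_add smooth_on_bounded_linear[where L = "\<lambda>u. cvec u 0"]
        smooth_on_bounded_linear[where L = "\<lambda>u. cvec 0 u"] bounded_linear_cvec smooth_funD[OF assms(3)] smooth_funD[OF assms(4)])
qed

lemma vdiff_cvec:
  assumes "smooth_manifold M" "openin (mtop M) U" "p \<in> U" "smooth_fun M U a" "smooth_fun M U b"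
  shows "vdiff M (\<lambda>q. cvec (a q) (b q)) p X = cvec (vdiff M a p X) (vdiff M b p X)"
proof -
  have s: "smooth_fun M U (\<lambda>q. cvec (a q) 0)" "smooth_fun M U (\<lambda>q. cvec 0 (b q))"
    by (auto intro!: smooth_funI[OF assms(1,2)] smooth_on_bounded_linear[where L = "\<lambda>u. cvec u 0"]
        smooth_on_bounded_linear[where L = "\<lambda>u. cvec 0 u"] bounded_linear_cvec smooth_funD[OF assms(4)] smooth_funD[OF assms(5)])
  have "vdiff M (\<lambda>q. cvec (a q) 0 + cvec 0 (b q)) p X = cvec (vdiff M a p X) 0 + cvec 0 (vdiff M b p X)"
    by (simp add: vdiff_add[OF assms(1-3) s] vdiff_linear_map[OF assms(1-3) _ bounded_linear_cvec(1)]
        vdiff_linear_map[OF assms(1-3) _ bounded_linear_cvec(2)] assms(4,5))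
  then show ?thesis by (simp add: cvec_split[symmetric])
qed

lemma smooth_fun_glift:
  assumes "smooth_manifold M" "openin (mtop M) U" "smooth_fun M U a" "smooth_fun M U b"
  shows "smooth_fun M U (glift a b)"
proof (rule smooth_funI[OF assms(1,2)])
  fix c assume "c \<in> charts M" "open (cmap c ` (cdom c \<inter> U))"
  then show "smooth_on (cmap c ` (cdom c \<inter> U)) (\<lambda>x. glift a b (cinv c x))"
    unfolding glift_def
    by (intro smooth_on_scaleR smooth_on_const smooth_funD[OF smooth_fun_cvec[OF assms]])
qed

lemma vdiff_glift:
  assumes "smooth_manifold M" "openin (mtop M) U" "p \<in> U" "smooth_fun M U a" "smooth_fun M U b"
  shows "vdiff M (glift a b) p X = (1 / sqrt 2) *\<^sub>R cvec (vdiff M a p X) (vdiff M b p X)"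
  unfolding glift_def[abs_def]
  using vdiff_linear_map[OF assms(1-3) smooth_fun_cvec[OF assms(1,2,4,5)] bounded_linear_scaleR_right]
  by (simp add: vdiff_cvec[OF assms])

lemma orthonormal_glift:
  fixes a b :: "'a \<Rightarrow> real ^ 'b::finite"
  assumes "norm (a p) = 1" "norm (b p) = 1" "b p \<bullet> a p = 0"
  shows "norm (glift a b p) = 1" "herm (glift a b p) (cconj (glift a b p)) = 0"
    "qhor (glift a b p) = {cvec u v |u v. a p \<bullet> u = 0 \<and> b p \<bullet> u = 0 \<and> a p \<bullet> v = 0 \<and> b p \<bullet> v = 0}"
proof -
  have ab: "a p \<bullet> a p = 1" "b p \<bullet> b p = 1" "a p \<bullet> b p = 0" "b p \<bullet> a p = 0"
    using assms by (simp_all add: norm_eq_1 inner_commute)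
  have "herm (glift a b p) (glift a b p) = 1"
    using ab by (simp add: glift_def herm_simps herm_cvec complex_eq_iff field_simps flip: of_real_mult)
  then show "norm (glift a b p) = 1" by (simp add: norm_eq_1 Re_herm[symmetric])
  show "herm (glift a b p) (cconj (glift a b p)) = 0"
    using ab by (simp add: glift_def cconj_simps cvec_simps(4) herm_simps herm_cvec complex_eq_iff inner_commute)
  have iff: "cvec u v \<in> qhor (glift a b p) \<longleftrightarrow> a p \<bullet> u = 0 \<and> b p \<bullet> u = 0 \<and> a p \<bullet> v = 0 \<and> b p \<bullet> v = 0" for u v
    by (auto simp: qhor_def glift_def cconj_simps cvec_simps(4) herm_simps herm_cvec complex_eq_iff inner_commute)
  show "qhor (glift a b p) = {cvec u v |u v. a p \<bullet> u = 0 \<and> b p \<bullet> u = 0 \<and> a p \<bullet> v = 0 \<and> b p \<bullet> v = 0}"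
  proof (intro set_eqI)
    fix y :: "complex ^ 'b"
    obtain u v where y: "y = cvec u v" by (rule cvec_surj)
    show "y \<in> qhor (glift a b p) \<longleftrightarrow>
        y \<in> {cvec u v |u v. a p \<bullet> u = 0 \<and> b p \<bullet> u = 0 \<and> a p \<bullet> v = 0 \<and> b p \<bullet> v = 0}"
      unfolding y iff by (auto simp: cvec_eq_iff)
  qed
qed

text \<open>
  The orthogonal complement of two orthonormal vectors in \<open>real ^ 'n option option\<close> has dimension
  \<open>CARD('n)\<close>, which is why the image of \<open>da\<close> is everything orthogonal to \<open>a\<close> and \<open>b\<close>.
\<close>

lemma range_eq_orthogonal_complement:
  fixes L :: "real ^ 'n::finite \<Rightarrow> real ^ 'n option option"
  assumes L: "linear L" "inj L" and ab: "norm a = 1" "norm b = 1" "b \<bullet> a = 0"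
    and orth: "\<And>v. a \<bullet> L v = 0" "\<And>v. b \<bullet> L v = 0"
  shows "range L = {y. a \<bullet> y = 0 \<and> b \<bullet> y = 0}"
proof -
  have a0: "a \<noteq> 0" "b \<noteq> 0" "a \<noteq> b" using ab by (auto simp: norm_eq_1)
  have "pairwise orthogonal {a, b}"
    using ab by (auto simp: pairwise_def orthogonal_def inner_commute)
  then have "independent {a, b}"
    using a0 by (intro pairwise_orthogonal_independent) auto
  then have "dim (span {a, b}) = 2"
    using a0 by (simp add: dim_eq_card_independent)
  moreover have "dim {y \<in> UNIV. \<forall>x\<in>span {a, b}. orthogonal x y} + dim (span {a, b})
      = dim (UNIV :: (real ^ 'n option option) set)"
    by (rule dim_subspace_orthogonal_to_vectors) auto
  moreover have "{y \<in> UNIV. \<forall>x\<in>span {a, b}. orthogonal x y} = {y. a \<bullet> y = 0 \<and> b \<bullet> y = 0}"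
  proof -
    have "(\<forall>x\<in>span {a, b}. orthogonal x y) \<longleftrightarrow> a \<bullet> y = 0 \<and> b \<bullet> y = 0" for y
    proof
      assume "a \<bullet> y = 0 \<and> b \<bullet> y = 0"
      then have o: "orthogonal y x" if "x \<in> {a, b}" for x
        using that by (auto simp: orthogonal_def inner_commute)
      show "\<forall>x\<in>span {a, b}. orthogonal x y"
      proof
        fix x assume "x \<in> span {a, b}"
        then have "orthogonal y x" by (rule orthogonal_to_span) (rule o)
        then show "orthogonal x y" by (simp add: orthogonal_commute)
      qed
    next
      assume "\<forall>x\<in>span {a, b}. orthogonal x y"
      then show "a \<bullet> y = 0 \<and> b \<bullet> y = 0" by (auto simp: orthogonal_def span_base)
    qed
    then show ?thesis by auto
  qed
  ultimately have "dim {y. a \<bullet> y = 0 \<and> b \<bullet> y = 0} = CARD('n)"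
    by simp
  moreover have "dim (range L) = CARD('n)"
    using dim_image_eq[of L UNIV] L by (simp add: inj_on_def inj_def)
  ultimately show ?thesis
    by (intro subspace_dim_equal)
      (auto intro!: subspaceI linear_subspace_image L(1) simp: orth inner_add_right)
qed

text \<open>
  The orthogonality relations come from differentiating the constant products \<open>a \<bullet> a\<close>, \<open>b \<bullet> b\<close> and \<open>b \<bullet> a\<close>.
\<close>

lemma hypersurface_facts:
  fixes M :: "('a, real ^ 'n::finite) manifold"
  assumes sm: "smooth_manifold M" and h: "hypersurface M U a b" and p: "p \<in> U"
  shows "openin (mtop M) U" "p \<in> carrier M" "smooth_fun M U a" "smooth_fun M U b"
    "norm (a p) = 1" "norm (b p) = 1" "b p \<bullet> a p = 0"
    "inj_on (vdiff M a p) (tangent_space M p)"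
    "X \<in> tangent_space M p \<Longrightarrow> a p \<bullet> vdiff M a p X = 0"
    "X \<in> tangent_space M p \<Longrightarrow> b p \<bullet> vdiff M a p X = 0"
    "X \<in> tangent_space M p \<Longrightarrow> a p \<bullet> vdiff M b p X = 0"
    "X \<in> tangent_space M p \<Longrightarrow> b p \<bullet> vdiff M b p X = 0"
    "vdiff M a p ` tangent_space M p = {y. a p \<bullet> y = 0 \<and> b p \<bullet> y = 0}"
proof -
  show U: "openin (mtop M) U" and sa: "smooth_fun M U a" and sb: "smooth_fun M U b"
    using h by (auto simp: hypersurface_def)
  show pM: "p \<in> carrier M" using openin_subset[OF U] p by blast
  have pw: "\<And>q. q \<in> U \<Longrightarrow> norm (a q) = 1 \<and> norm (b q) = 1 \<and> b q \<bullet> a q = 0"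
    using h unfolding hypersurface_def by blast
  show n: "norm (a p) = 1" "norm (b p) = 1" "b p \<bullet> a p = 0" using pw p by blast+
  show inj: "inj_on (vdiff M a p) (tangent_space M p)"
    using h p unfolding hypersurface_def by blast
  have s: "smooth_fun M U (\<lambda>q. F q \<bullet> G q)" if "smooth_fun M U F" "smooth_fun M U G" for F G :: "'a \<Rightarrow> real ^ 'n option option"
    by (intro smooth_funI[OF sm U] smooth_on_inner smooth_funD[OF that(1)] smooth_funD[OF that(2)])
  have d: "F p \<bullet> vdiff M G p X + vdiff M F p X \<bullet> G p = 0"
    if "smooth_fun M U F" "smooth_fun M U G" "\<And>q. q \<in> U \<Longrightarrow> F q \<bullet> G q = k"
    for F G :: "'a \<Rightarrow> real ^ 'n option option" and X k
    using vdiff_bilinear[OF sm U p that(1,2) bounded_bilinear_inner, of X]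
      vdiff_const[OF sm U p s[OF that(1,2)] that(3), of X] by simp
  show aa: "a p \<bullet> vdiff M a p X = 0" if "X \<in> tangent_space M p" for X
    using d[OF sa sa, of 1 X] pw by (simp add: norm_eq_1 inner_commute)
  show "b p \<bullet> vdiff M b p X = 0" if "X \<in> tangent_space M p"
    using d[OF sb sb, of 1 X] pw by (simp add: norm_eq_1 inner_commute)
  show ba: "b p \<bullet> vdiff M a p X = 0" if "X \<in> tangent_space M p" for X
    using h p that unfolding hypersurface_def by blast
  show "a p \<bullet> vdiff M b p X = 0" if "X \<in> tangent_space M p"
    using d[OF sb sa, of 0 X] pw ba[OF that] by (simp add: inner_commute)
  have "range (vderiv M a p) = {y. a p \<bullet> y = 0 \<and> b p \<bullet> y = 0}"
  proof (rule range_eq_orthogonal_complement[OF linear_vderiv[OF sm U p sa] _ n])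
    show "inj (vderiv M a p)" using inj inj_on_vdiff_iff[OF sm pM] by blast
    fix v
    have "vderiv M a p v \<in> vdiff M a p ` tangent_space M p"
      using vdiff_image[OF sm pM, of a] by blast
    then show "a p \<bullet> vderiv M a p v = 0" "b p \<bullet> vderiv M a p v = 0" using aa ba by auto
  qed
  then show "vdiff M a p ` tangent_space M p = {y. a p \<bullet> y = 0 \<and> b p \<bullet> y = 0}"
    using vdiff_image[OF sm pM, of a] by simp
qed

text \<open>
  The second fundamental form is symmetric: differentiating \<open>b \<bullet> da(v) = 0\<close> expresses it by the
  second derivative of \<open>a\<close>.
\<close>

lemma second_fundamental_form_symmetric:
  fixes M :: "('a, real ^ 'n::finite) manifold"
  assumes sm: "smooth_manifold M" and h: "hypersurface M U a b" and p: "p \<in> U"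
    and X: "X \<in> tangent_space M p" and Y: "Y \<in> tangent_space M p"
  shows "vdiff M b p X \<bullet> vdiff M a p Y = vdiff M b p Y \<bullet> vdiff M a p X"
proof -
  note hf = hypersurface_facts[OF sm h]
  note U = hf(1)[OF p] and pM = hf(2)[OF p] and sa = hf(3)[OF p] and sb = hf(4)[OF p]
  obtain c where c: "c \<in> charts_at M p" using exists_chart_at[OF sm pM] .
  let ?S = "cmap c ` (cdom c \<inter> U)" and ?x = "cmap c p"
  let ?a = "\<lambda>x. a (cinv c x)" and ?b = "\<lambda>x. b (cinv c x)"
  note cc = charts_atD[OF c]
  have o: "open ?S" by (rule open_chart_image[OF sm cc(1) U])
  have x: "?x \<in> ?S" using cc(2) p by blast
  have as: "smooth_on ?S ?a" and bs: "smooth_on ?S ?b"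
    using smooth_funD[OF sa cc(1)] smooth_funD[OF sb cc(1)] .
  have orth: "?b y \<bullet> frechet_derivative ?a (at y) v = 0" if "y \<in> ?S" for y v
  proof -
    from that obtain q where q: "q \<in> cdom c" "q \<in> U" "y = cmap c q" by blast
    have cq: "c \<in> charts_at M q" using cc(1) q by (simp add: charts_at_def)
    obtain Z where Z: "Z \<in> tangent_space M q" "Z c = v" using tangent_space_exists[OF sm cq] .
    have "vdiff M a q Z = frechet_derivative ?a (at y) v"
      using vdiff_chart[OF sm U q(2) sa cq Z(1)] Z(2) q(3) by simp
    then show ?thesis using hf(10)[OF q(2) Z(1)] q(3) by (simp add: cinv_cmap[OF sm cq])
  qed
  have main: "frechet_derivative ?b (at ?x) u \<bullet> frechet_derivative ?a (at ?x) v
      = - (b p \<bullet> frechet_derivative (\<lambda>y. frechet_derivative ?a (at y) v) (at ?x) u)" for u v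
  proof -
    have "((\<lambda>y. ?b y \<bullet> frechet_derivative ?a (at y) v) has_derivative
        (\<lambda>u. ?b ?x \<bullet> frechet_derivative (\<lambda>y. frechet_derivative ?a (at y) v) (at ?x) u
          + frechet_derivative ?b (at ?x) u \<bullet> frechet_derivative ?a (at ?x) v)) (at ?x)"
      by (intro bounded_bilinear.FDERIV[OF bounded_bilinear_inner] smooth_on_imp_has_derivative[OF bs x]
          smooth_on_imp_has_derivative[OF smooth_on_frechet_derivative_const[OF as] x])
    moreover have "((\<lambda>y. ?b y \<bullet> frechet_derivative ?a (at y) v) has_derivative (\<lambda>u. 0)) (at ?x)"
      by (rule has_derivative_transform_within_open[OF has_derivative_const[of 0] o x]) (simp add: orth)
    ultimately have "(\<lambda>u. ?b ?x \<bullet> frechet_derivative (\<lambda>y. frechet_derivative ?a (at y) v) (at ?x) u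
          + frechet_derivative ?b (at ?x) u \<bullet> frechet_derivative ?a (at ?x) v) = (\<lambda>u. 0)"
      by (rule has_derivative_unique)
    then have "?b ?x \<bullet> frechet_derivative (\<lambda>y. frechet_derivative ?a (at y) v) (at ?x) u
          + frechet_derivative ?b (at ?x) u \<bullet> frechet_derivative ?a (at ?x) v = 0" by metis
    then show ?thesis by (simp add: cinv_cmap[OF sm c])
  qed
  show ?thesis
    unfolding vdiff_chart[OF sm U p sa c X] vdiff_chart[OF sm U p sb c X]
      vdiff_chart[OF sm U p sa c Y] vdiff_chart[OF sm U p sb c Y] main
    using second_derivative_symmetric[OF o as x] by simp
qed

text \<open>
  The image of \<open>db\<close> is contained in that of the injective map \<open>da\<close>, so the description that defines
  \<^const>\<open>shape_op\<close> has exactly one solution.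
\<close>

lemma shape_op_eq_iff:
  fixes M :: "('a, real ^ 'n::finite) manifold"
  assumes sm: "smooth_manifold M" and h: "hypersurface M U a b" and p: "p \<in> U"
    and X: "X \<in> tangent_space M p"
  shows "shape_op M a b p X = tscale \<kappa> X \<longleftrightarrow> vdiff M b p X = - \<kappa> *\<^sub>R vdiff M a p X"
proof -
  note hf = hypersurface_facts[OF sm h p]
  have sc: "vdiff M a p (tscale \<kappa> X) = \<kappa> *\<^sub>R vdiff M a p X"
    by (rule vdiff_tscale[OF sm hf(1) p hf(3)])
  have "- vdiff M b p X \<in> vdiff M a p ` tangent_space M p"
    unfolding hf(13) using hf(11,12)[OF X] by simp
  then obtain Y where "Y \<in> tangent_space M p" "- vdiff M b p X = vdiff M a p Y" by blast
  then have Y: "Y \<in> tangent_space M p" "vdiff M b p X = - vdiff M a p Y"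
    by (simp_all add: minus_equation_iff[of "vdiff M b p X"])
  have S: "shape_op M a b p X = Z" if "Z \<in> tangent_space M p" "vdiff M b p X = - vdiff M a p Z" for Z
    unfolding shape_op_def by (rule the_equality) (use that inj_onD[OF hf(8)] in auto)
  show ?thesis
  proof
    assume "shape_op M a b p X = tscale \<kappa> X"
    then have "Y = tscale \<kappa> X" using S[OF Y] by simp
    then show "vdiff M b p X = - \<kappa> *\<^sub>R vdiff M a p X" using Y(2) sc by simp
  next
    assume "vdiff M b p X = - \<kappa> *\<^sub>R vdiff M a p X"
    then show "shape_op M a b p X = tscale \<kappa> X"
      using S[OF tscale_in_tangent_space[OF sm X]] sc by simp
  qed
qed

lemma vdiff_nonzero:
  assumes sm: "smooth_manifold M" and W: "openin (mtop M) W" "p \<in> W" "smooth_fun M W a"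
    and inj: "inj_on (vdiff M a p) (tangent_space M p)"
    and X: "X \<in> tangent_space M p" "X \<noteq> tzero"
  shows "vdiff M a p X \<noteq> 0"
proof
  assume "vdiff M a p X = 0"
  moreover have "vdiff M a p tzero = 0"
    using vdiff_tscale[OF sm W, of 0 X] by (simp add: tscale_def tzero_def)
  ultimately have "X = tzero"
    using inj_onD[OF inj _ X(1) tzero_in_tangent_space[OF sm]] by simp
  then show False using X(2) by simp
qed

section \<open>The Gauss map is a Lagrangian immersion\<close>

lemma glift_facts:
  fixes M :: "('a, real ^ 'n::finite) manifold"
  assumes sm: "smooth_manifold M" and h: "hypersurface M U a b" and p: "p \<in> U"
  shows "norm (glift a b p) = 1" "glift a b p \<noteq> 0" "herm (glift a b p) (cconj (glift a b p)) = 0"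
    "qhor (glift a b p) = (\<lambda>(X, Y). cvec (vdiff M a p X) (vdiff M a p Y)) ` (tangent_space M p \<times> tangent_space M p)"
    "X \<in> tangent_space M p \<Longrightarrow> cvec (vdiff M a p X) (vdiff M b p X) \<in> qhor (glift a b p)"
proof -
  note hf = hypersurface_facts[OF sm h p] and on = orthonormal_glift[of a p b]
  show n: "norm (glift a b p) = 1" "herm (glift a b p) (cconj (glift a b p)) = 0"
    using on(1,2) hf(5-7) by blast+
  show "glift a b p \<noteq> 0" using n(1) by auto
  have q: "qhor (glift a b p) = {cvec u v |u v. a p \<bullet> u = 0 \<and> b p \<bullet> u = 0 \<and> a p \<bullet> v = 0 \<and> b p \<bullet> v = 0}"
    by (rule on(3)[OF hf(5-7)])
  also have "\<dots> = {cvec u v |u v. u \<in> vdiff M a p ` tangent_space M p \<and> v \<in> vdiff M a p ` tangent_space M p}"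
    unfolding hf(13) by simp
  finally show "qhor (glift a b p) = (\<lambda>(X, Y). cvec (vdiff M a p X) (vdiff M a p Y)) ` (tangent_space M p \<times> tangent_space M p)"
    by auto
  show "cvec (vdiff M a p X) (vdiff M b p X) \<in> qhor (glift a b p)" if "X \<in> tangent_space M p"
    unfolding q using hf(9-12)[OF that] by blast
qed

lemma mdiff_gauss_map:
  fixes M :: "('a, real ^ 'n::finite) manifold"
  assumes sm: "smooth_manifold M" and h: "hypersurface M U a b" and p: "p \<in> U"
    and f: "\<And>q. q \<in> U \<Longrightarrow> f q = gauss_map a b q"
  shows "mdiff M CP f p X = dhopf (glift a b p) ((1 / sqrt 2) *\<^sub>R cvec (vdiff M a p X) (vdiff M b p X))"
proof -
  note hf = hypersurface_facts[OF sm h p]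
  have "mdiff M CP f p X = dhopf (glift a b p) (vdiff M (glift a b) p X)"
    by (rule mdiff_cline[OF sm hf(1) p smooth_fun_glift[OF sm hf(1,3,4)]]) (simp add: f gauss_map_glift)
  then show ?thesis by (simp add: vdiff_glift[OF sm hf(1) p hf(3,4)])
qed

lemma scaleR_in_qhor: "v \<in> qhor z \<Longrightarrow> r *\<^sub>R v \<in> qhor z"
  unfolding scaleR_eq_scale by (rule qhor_scale)

text \<open>
  With \<open>w(X) = da(X) + i db(X)\<close>, the products \<open>i w(X) \<bullet> w(Y)\<close> vanish by the symmetry of the second fundamental
  form. Conversely a tangent vector of the quadric lifts to \<open>da(X\<^sub>1) + i da(X\<^sub>2)\<close>; if it is orthogonal to all
  \<open>w(X)\<close>, the same symmetry gives \<open>da(X\<^sub>1) = - db(X\<^sub>2)\<close>, and multiplication by \<open>i\<close> turns it into \<open>- w(X\<^sub>2)\<close>.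
\<close>

lemma lagrangian_gauss_map:
  fixes M :: "('a, real ^ 'n::finite) manifold"
  assumes sm: "smooth_manifold M" and h: "hypersurface M (carrier M) a b"
  shows "lagrangian_immersion M (gauss_map a b)"
proof -
  have U: "openin (mtop M) (carrier M)" by simp
  note hf = hypersurface_facts[OF sm h] and gf = glift_facts[OF sm h]
  have md: "mdiff M CP (gauss_map a b) p X
      = dhopf (glift a b p) ((1 / sqrt 2) *\<^sub>R cvec (vdiff M a p X) (vdiff M b p X))"
    if "p \<in> carrier M" for p X
    by (rule mdiff_gauss_map[OF sm h that]) simp
  have hor: "herm v (glift a b p) = 0" if "v \<in> qhor (glift a b p)" for v p
    using that by (simp add: qhor_def)
  have r2: "1 / sqrt 2 \<noteq> (0::real)" by simp
  have imm: "immersion_into_quadric M (gauss_map a b)"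
    unfolding immersion_into_quadric_def
  proof (intro conjI ballI)
    show "smooth_map M CP (carrier M) (gauss_map a b)"
    proof (cases "carrier M = {}")
      case False
      then obtain p0 where p0: "p0 \<in> carrier M" by blast
      show ?thesis
        by (rule smooth_map_cline[OF sm U smooth_fun_glift[OF sm U hf(3,4)[OF p0]]])
          (rule gf(2) gauss_map_glift, assumption?)+
    qed (simp add: smooth_map_def)
    fix p assume p: "p \<in> carrier M"
    show "gauss_map a b p \<in> Quadric"
      unfolding gauss_map_glift using cline_in_Quadric_iff[OF gf(2)[OF p]] gf(3)[OF p] by blast
    show "inj_on (mdiff M CP (gauss_map a b) p) (tangent_space M p)"
    proof (rule inj_onI)
      fix X Y assume XY: "X \<in> tangent_space M p" "Y \<in> tangent_space M p"
        and eq: "mdiff M CP (gauss_map a b) p X = mdiff M CP (gauss_map a b) p Y"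
      have "cvec (vdiff M a p X) (vdiff M b p X) = cvec (vdiff M a p Y) (vdiff M b p Y)"
        using eq r2 unfolding md[OF p]
          dhopf_eq_horizontal_iff[OF gf(2)[OF p] hor[OF scaleR_in_qhor[OF gf(5)[OF p XY(1)]]]
            hor[OF scaleR_in_qhor[OF gf(5)[OF p XY(2)]]]]
        by (simp only: real_vector.scale_cancel_left) simp
      then show "X = Y" using inj_onD[OF hf(8)[OF p] _ XY] by (simp add: cvec_eq_iff)
    qed
  qed
  have lag: "cpJ (gauss_map a b p) ` mdiff M CP (gauss_map a b) p ` tangent_space M p
        \<subseteq> normal_space M (gauss_map a b) p \<and>
      cpJ (gauss_map a b p) ` normal_space M (gauss_map a b) p
        \<subseteq> mdiff M CP (gauss_map a b) p ` tangent_space M p" if p: "p \<in> carrier M" for p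
  proof -
    let ?z = "glift a b p"
    note n = gf(1)[OF p] and z0 = gf(2)[OF p] and zQ = gf(3)[OF p]
    have w: "(1 / sqrt 2) *\<^sub>R cvec (vdiff M a p X) (vdiff M b p X) \<in> qhor ?z" if "X \<in> tangent_space M p" for X
      by (rule scaleR_in_qhor[OF gf(5)[OF p that]])
    have J: "cpJ (gauss_map a b p) (dhopf ?z v) = dhopf ?z (\<i> *s v)" if "v \<in> qhor ?z" for v
      unfolding gauss_map_glift by (rule cpJ_dhopf[OF n hor[OF that]])
    have g: "gFS (gauss_map a b p) (dhopf ?z u) (dhopf ?z v) = u \<bullet> v" if "u \<in> qhor ?z" "v \<in> qhor ?z" for u v
      unfolding gauss_map_glift by (rule gFS_dhopf[OF n hor[OF that(1)] hor[OF that(2)]])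
    have qt: "quadric_tangent (gauss_map a b p) = dhopf ?z ` qhor ?z"
      unfolding gauss_map_glift by (rule quadric_tangent_cline[OF z0 zQ])
    have 1: "cpJ (gauss_map a b p) (mdiff M CP (gauss_map a b) p X) \<in> normal_space M (gauss_map a b) p"
      if X: "X \<in> tangent_space M p" for X
    proof -
      have iw: "\<i> *s (1 / sqrt 2) *\<^sub>R cvec (vdiff M a p X) (vdiff M b p X) \<in> qhor ?z"
        by (rule qhor_scale[OF w[OF X]])
      have "(\<i> *s (1 / sqrt 2) *\<^sub>R cvec (vdiff M a p X) (vdiff M b p X)) \<bullet>
          ((1 / sqrt 2) *\<^sub>R cvec (vdiff M a p Y) (vdiff M b p Y)) = 0" if "Y \<in> tangent_space M p" for Y
        using second_fundamental_form_symmetric[OF sm h p X that]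
        by (simp add: cvec_simps inner_cvec inner_commute)
      then show ?thesis
        unfolding normal_space_def md[OF p] J[OF w[OF X]] qt using iw g[OF iw w] by auto
    qed
    have 2: "cpJ (gauss_map a b p) N \<in> mdiff M CP (gauss_map a b) p ` tangent_space M p"
      if N: "N \<in> normal_space M (gauss_map a b) p" for N
    proof -
      obtain y where y: "y \<in> qhor ?z" "N = dhopf ?z y"
        using N unfolding normal_space_def qt by blast
      obtain X1 X2 where XX: "X1 \<in> tangent_space M p" "X2 \<in> tangent_space M p"
        "y = cvec (vdiff M a p X1) (vdiff M a p X2)"
        using y(1) unfolding gf(4)[OF p] by auto
      have perp: "(vdiff M a p X1 + vdiff M b p X2) \<bullet> vdiff M a p X = 0" if X: "X \<in> tangent_space M p" for X
      proof -
        have "gFS (gauss_map a b p) N (mdiff M CP (gauss_map a b) p X) = 0"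
          using N X unfolding normal_space_def by blast
        then have "y \<bullet> ((1 / sqrt 2) *\<^sub>R cvec (vdiff M a p X) (vdiff M b p X)) = 0"
          unfolding md[OF p] y(2) g[OF y(1) w[OF X]] .
        then have "cvec (vdiff M a p X1) (vdiff M a p X2) \<bullet> cvec (vdiff M a p X) (vdiff M b p X) = 0"
          unfolding XX(3) by simp
        then show ?thesis
          using second_fundamental_form_symmetric[OF sm h p X XX(2)]
          by (simp add: inner_cvec inner_add_left inner_add_right inner_commute)
      qed
      have "vdiff M a p X1 + vdiff M b p X2 \<in> vdiff M a p ` tangent_space M p"
        unfolding hf(13)[OF p] using hf(9-12)[OF p] XX(1,2) by (simp add: inner_add_right)
      then obtain Z where Z: "Z \<in> tangent_space M p" "vdiff M a p X1 + vdiff M b p X2 = vdiff M a p Z"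
        by (rule imageE)
      then have "vdiff M a p X1 + vdiff M b p X2 = 0" using perp[OF Z(1)] by simp
      then have "\<i> *s y = - cvec (vdiff M a p X2) (vdiff M b p X2)"
        unfolding XX(3) by (simp add: cvec_simps cvec_eq_iff eq_neg_iff_add_eq_0)
      then have "cpJ (gauss_map a b p) N = dhopf ?z (- cvec (vdiff M a p X2) (vdiff M b p X2))"
        using J[OF y(1)] y(2) by simp
      also have "\<dots> = mdiff M CP (gauss_map a b) p (tscale (- sqrt 2) X2)"
        unfolding md[OF p] vdiff_tscale[OF sm hf(1)[OF p] p hf(3)[OF p]] vdiff_tscale[OF sm hf(1)[OF p] p hf(4)[OF p]]
        by (simp add: cvec_simps)
      finally show ?thesis using tscale_in_tangent_space[OF sm XX(2)] by blast
    qed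
    show ?thesis using 1 2 by blast
  qed
  show ?thesis unfolding lagrangian_immersion_def using imm lag by blast
qed

lemma horizontal_lift_glift:
  fixes M :: "('a, real ^ 'n::finite) manifold"
  assumes sm: "smooth_manifold M" and h: "hypersurface M (carrier M) a b"
  shows "horizontal_lift M (gauss_map a b) (glift a b)"
  unfolding horizontal_lift_def
proof (intro conjI ballI)
  have ab: "smooth_fun M (carrier M) a" "smooth_fun M (carrier M) b"
    using h by (auto simp: hypersurface_def)
  show "smooth_fun M (carrier M) (glift a b)"
    by (rule smooth_fun_glift[OF sm _ ab]) simp
  fix p assume p: "p \<in> carrier M"
  note hf = hypersurface_facts[OF sm h p]
  show "cline (glift a b p) = gauss_map a b p" by (simp add: gauss_map_glift)
  show "glift a b p \<in> Vset"
    unfolding Vset_def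
  proof (intro CollectI exI conjI)
    show "glift a b p = cvec ((1 / sqrt 2) *\<^sub>R a p) ((1 / sqrt 2) *\<^sub>R b p)"
      by (simp add: glift_def cvec_simps)
  qed (use hf(5-7) in \<open>simp_all add: norm_eq_1 inner_commute\<close>)
  show "vdiff M (glift a b) p ` tangent_space M p \<subseteq> horizontal (glift a b p)"
    using scaleR_in_qhor[OF glift_facts(5)[OF sm h p]]
    by (auto simp: vdiff_glift[OF sm hf(1) p hf(3,4)] horizontal_iff qhor_def)
qed

section \<open>Angle functions and principal curvatures\<close>

text \<open>
  Multiplication by \<open>cis (\<theta> - \<psi> / 2)\<close> makes the two sides conjugate to each other up to sign.
\<close>

lemma angle_equation:
  fixes u v \<theta> \<psi> :: real
  shows "- (cis \<psi> * Complex u (- v)) = cis (- 2 * \<theta>) * Complex u v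
    \<longleftrightarrow> cos (\<theta> + \<psi> / 2) * u + sin (\<theta> + \<psi> / 2) * v = 0"
proof -
  let ?t = "\<theta> + \<psi> / 2"
  have "- (cis \<psi> * Complex u (- v)) = cis (- 2 * \<theta>) * Complex u v
      \<longleftrightarrow> cis (\<theta> - \<psi> / 2) * (- (cis \<psi> * Complex u (- v))) = cis (\<theta> - \<psi> / 2) * (cis (- 2 * \<theta>) * Complex u v)"
    by (simp only: mult_cancel_left cis_neq_zero) simp
  also have "cis (\<theta> - \<psi> / 2) * (- (cis \<psi> * Complex u (- v))) = - (cis ?t * Complex u (- v))"
  proof -
    have "cis (\<theta> - \<psi> / 2) * cis \<psi> = cis ?t" by (simp add: cis_mult add.commute)
    then show ?thesis by (metis mult.assoc mult_minus_right)
  qed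
  also have "cis (\<theta> - \<psi> / 2) * (cis (- 2 * \<theta>) * Complex u v) = cis (- ?t) * Complex u v"
  proof -
    have "cis (\<theta> - \<psi> / 2) * cis (- 2 * \<theta>) = cis (- ?t)" by (simp add: cis_mult)
    then show ?thesis by (metis mult.assoc)
  qed
  also have "- (cis t * Complex u (- v)) = cis (- t) * Complex u v \<longleftrightarrow> cos t * u + sin t * v = 0" for t
    by (auto simp: complex_eq_iff algebra_simps)
  finally show ?thesis .
qed

text \<open>
  For \<open>w = da(e) + i db(e)\<close> the defining equation of an angle reads \<open>- cis \<psi> * cconj w = cis (- 2\<theta>) * w\<close>.
\<close>

lemma has_angle_iff:
  fixes M :: "('a, real ^ 'n::finite) manifold"
  assumes sm: "smooth_manifold M" and h: "hypersurface M U a b" and p: "p \<in> U"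
    and f: "\<And>q. q \<in> U \<Longrightarrow> f q = gauss_map a b q"
    and A: "\<And>v. v \<in> qhor (glift a b p) \<Longrightarrow>
      A (dhopf (glift a b p) v) = - dhopf (glift a b p) (cis \<psi> *s cconj v)"
    and e: "e \<in> tangent_space M p"
  shows "has_angle M f A p e \<theta> \<longleftrightarrow>
    cos (\<theta> + \<psi> / 2) *\<^sub>R vdiff M a p e + sin (\<theta> + \<psi> / 2) *\<^sub>R vdiff M b p e = 0"
proof -
  let ?z = "glift a b p" and ?u = "vdiff M a p e" and ?v = "vdiff M b p e"
  let ?w = "(1 / sqrt 2) *\<^sub>R cvec ?u ?v"
  note gf = glift_facts[OF sm h p]
  have w: "?w \<in> qhor ?z" by (rule scaleR_in_qhor[OF gf(5)[OF e]])
  have hor: "herm y ?z = 0" if "y \<in> qhor ?z" for y using that by (simp add: qhor_def)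
  have md: "mdiff M CP f p e = dhopf ?z ?w" by (rule mdiff_gauss_map[OF sm h p f])
  have J: "cpJ (f p) (dhopf ?z ?w) = dhopf ?z (\<i> *s ?w)"
    unfolding f[OF p] gauss_map_glift by (rule cpJ_dhopf[OF gf(1) hor[OF w]])
  have rhs: "tscale (cos (2 * \<theta>)) (dhopf ?z ?w) - tscale (sin (2 * \<theta>)) (dhopf ?z (\<i> *s ?w))
      = dhopf ?z (cis (- 2 * \<theta>) *s ?w)"
    unfolding tscale_dhopf dhopf_diff
    by (rule arg_cong[where f = "dhopf ?z"])
      (simp add: vec_eq_iff vec_scaleR_nth complex_eq_iff algebra_simps add_divide_distrib diff_divide_distrib
        del: vector_scaleR_component)
  have "has_angle M f A p e \<theta> \<longleftrightarrow> dhopf ?z (- (cis \<psi> *s cconj ?w)) = dhopf ?z (cis (- 2 * \<theta>) *s ?w)"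
    unfolding has_angle_def md J rhs A[OF w] dhopf_minus ..
  also have "\<dots> \<longleftrightarrow> - (cis \<psi> *s cconj ?w) = cis (- 2 * \<theta>) *s ?w"
    by (rule dhopf_eq_horizontal_iff[OF gf(2)])
      (use hor[OF qhor_scale[OF qhor_cconj[OF w]]] hor[OF qhor_scale[OF w]] in \<open>simp_all add: herm_minus_left\<close>)
  also have "\<dots> \<longleftrightarrow> (1 / sqrt 2) *\<^sub>R (- (cis \<psi> *s cconj (cvec ?u ?v))) = (1 / sqrt 2) *\<^sub>R (cis (- 2 * \<theta>) *s cvec ?u ?v)"
    by (simp add: cconj_simps scaleR_eq_scale mult.commute vector_smult_assoc)
  also have "\<dots> \<longleftrightarrow> - (cis \<psi> *s cconj (cvec ?u ?v)) = cis (- 2 * \<theta>) *s cvec ?u ?v"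
    by (simp only: real_vector.scale_cancel_left) simp
  also have "\<dots> \<longleftrightarrow> (\<forall>j. - (cis \<psi> * Complex (?u $ j) (- (?v $ j))) = cis (- 2 * \<theta>) * Complex (?u $ j) (?v $ j))"
    unfolding cvec_simps(4) by (simp add: vec_eq_iff cvec_def)
  also have "\<dots> \<longleftrightarrow> cos (\<theta> + \<psi> / 2) *\<^sub>R ?u + sin (\<theta> + \<psi> / 2) *\<^sub>R ?v = 0"
    unfolding angle_equation by (simp add: vec_eq_iff)
  finally show ?thesis .
qed

lemma lift_shape_operator_dhopf:
  assumes "z \<noteq> 0" "v \<in> qhor z"
  shows "lift_shape_operator z (dhopf z v) = - dhopf z (cis 0 *s cconj v)"
  using assms hlift_dhopf[of z v] by (simp add: lift_shape_operator_def qhor_def)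

lemma cot_of_cos_eq:
  assumes "cos t = \<kappa> * sin t"
  shows "sin t \<noteq> 0" "\<kappa> = cot t"
proof -
  show s: "sin t \<noteq> 0"
    using assms sin_cos_squared_add[of t] by auto
  show "\<kappa> = cot t" using s by (simp add: cot_def assms)
qed

lemma cot_diff_of_cos_eq:
  assumes "cos s = \<kappa> * sin s" "cos t = \<mu> * sin t" "\<kappa> \<noteq> \<mu>"
  shows "sin (s - t) \<noteq> 0" "cot (s - t) = - ((\<kappa> * \<mu> + 1) / (\<kappa> - \<mu>))"
proof -
  have n: "sin s \<noteq> 0" "sin t \<noteq> 0" using cot_of_cos_eq assms by blast+
  have S: "sin (s - t) = sin s * sin t * (\<mu> - \<kappa>)"
    by (simp add: sin_diff assms(1,2) algebra_simps)
  have C: "cos (s - t) = sin s * sin t * (\<kappa> * \<mu> + 1)"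
    by (simp add: cos_diff assms(1,2) algebra_simps)
  show "sin (s - t) \<noteq> 0" using S n assms(3) by simp
  show "cot (s - t) = - ((\<kappa> * \<mu> + 1) / (\<kappa> - \<mu>))"
    unfolding cot_def S C using n assms(3) by (simp add: field_simps)
qed

lemma cos_arccot: "cos (pi / 2 - arctan \<kappa>) = \<kappa> * sin (pi / 2 - arctan \<kappa>)"
proof -
  have "tan (arctan \<kappa>) = \<kappa>" by (rule tan_arctan)
  then have "sin (arctan \<kappa>) = \<kappa> * cos (arctan \<kappa>)"
    using cos_arctan_not_zero[of \<kappa>] by (simp add: tan_def field_simps)
  then show ?thesis by (simp add: cos_diff sin_diff)
qed

lemma gauss_map_angles:
  fixes M :: "('a, real ^ 'n::finite) manifold" and e :: "'n \<Rightarrow> ('a, real ^ 'n) tvec"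
  assumes sm: "smooth_manifold M" and h: "hypersurface M (carrier M) a b" and p: "p \<in> carrier M"
  defines "A \<equiv> lift_shape_operator (glift a b p)"
  shows "principal_frame_at M a b p e \<kappa> \<Longrightarrow> (\<And>j. has_angle M (gauss_map a b) A p (e j) (\<theta> j)) \<Longrightarrow>
      sin (\<theta> j) \<noteq> 0 \<and> \<kappa> j = cot (\<theta> j)"
    and "principal_frame_at M a b p e \<kappa> \<Longrightarrow> \<exists>\<theta>. \<forall>j. has_angle M (gauss_map a b) A p (e j) (\<theta> j)"
    and "frame_at M p e \<Longrightarrow> (\<And>j. has_angle M (gauss_map a b) A p (e j) (\<theta> j)) \<Longrightarrow>
      \<exists>\<kappa>. principal_frame_at M a b p e \<kappa>"
proof -
  note hf = hypersurface_facts[OF sm h p] and gf = glift_facts[OF sm h p]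
  have iff: "has_angle M (gauss_map a b) A p X t \<longleftrightarrow> cos t *\<^sub>R vdiff M a p X + sin t *\<^sub>R vdiff M b p X = 0"
    if "X \<in> tangent_space M p" for X t
    using has_angle_iff[OF sm h p refl, of A 0 X t] lift_shape_operator_dhopf[OF gf(2)] that
    by (simp add: A_def)
  have nz: "vdiff M a p X \<noteq> 0" if "X \<in> tangent_space M p" "X \<noteq> tzero" for X
    by (rule vdiff_nonzero[OF sm hf(1) p hf(3,8) that])
  have pr: "has_angle M (gauss_map a b) A p (e j) t \<longleftrightarrow> cos t = \<kappa> j * sin t"
    if "principal_frame_at M a b p e \<kappa>" for \<kappa> j t
  proof -
    have fr: "frame_at M p e" and so: "shape_op M a b p (e j) = tscale (\<kappa> j) (e j)"
      using that by (auto simp: principal_frame_at_def)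
    note ej = frame_at_nonzero[OF fr sm, of j]
    have "vdiff M b p (e j) = - \<kappa> j *\<^sub>R vdiff M a p (e j)"
      using shape_op_eq_iff[OF sm h p ej(1)] so by blast
    then have "has_angle M (gauss_map a b) A p (e j) t \<longleftrightarrow> (cos t - \<kappa> j * sin t) *\<^sub>R vdiff M a p (e j) = 0"
      unfolding iff[OF ej(1)] by (simp add: algebra_simps)
    then show ?thesis using nz[OF ej] by simp
  qed
  show "sin (\<theta> j) \<noteq> 0 \<and> \<kappa> j = cot (\<theta> j)"
    if "principal_frame_at M a b p e \<kappa>" "\<And>j. has_angle M (gauss_map a b) A p (e j) (\<theta> j)"
    using that(2)[of j] cot_of_cos_eq unfolding pr[OF that(1)] by blast
  show "\<exists>\<theta>. \<forall>j. has_angle M (gauss_map a b) A p (e j) (\<theta> j)" if "principal_frame_at M a b p e \<kappa>"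
    unfolding pr[OF that] using cos_arccot by (intro exI[of _ "\<lambda>j. pi / 2 - arctan (\<kappa> j)"]) blast
  show "\<exists>\<kappa>. principal_frame_at M a b p e \<kappa>"
    if fr: "frame_at M p e" and ang: "\<And>j. has_angle M (gauss_map a b) A p (e j) (\<theta> j)"
  proof -
    have "\<forall>j. shape_op M a b p (e j) = tscale (cot (\<theta> j)) (e j)"
    proof
      fix j
      note ej = frame_at_nonzero[OF fr sm, of j]
      have eq: "cos (\<theta> j) *\<^sub>R vdiff M a p (e j) + sin (\<theta> j) *\<^sub>R vdiff M b p (e j) = 0"
        using ang iff[OF ej(1)] by blast
      have s: "sin (\<theta> j) \<noteq> 0"
      proof
        assume "sin (\<theta> j) = 0"
        moreover from this have "cos (\<theta> j) \<noteq> 0" using sin_cos_squared_add[of "\<theta> j"] by auto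
        ultimately show False using eq nz[OF ej] by simp
      qed
      have "sin (\<theta> j) *\<^sub>R vdiff M b p (e j) = sin (\<theta> j) *\<^sub>R (- cot (\<theta> j) *\<^sub>R vdiff M a p (e j))"
        using eq s by (simp add: cot_def eq_neg_iff_add_eq_0 add.commute)
      then have "vdiff M b p (e j) = - cot (\<theta> j) *\<^sub>R vdiff M a p (e j)"
        using s by (simp only: real_vector.scale_cancel_left) simp
      then show "shape_op M a b p (e j) = tscale (cot (\<theta> j)) (e j)"
        using shape_op_eq_iff[OF sm h p ej(1)] by blast
    qed
    then show ?thesis
      using fr unfolding principal_frame_at_def by (intro exI[of _ "\<lambda>j. cot (\<theta> j)"] conjI)
  qed
qed

section \<open>Closed one-forms on balls are exact\<close>

text \<open>
  The primitive is the integral along the rays from the centre. Its derivative along a segment is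
  found by differentiating under the integral sign: closedness turns the integrand into
  \<open>d/dt (t \<alpha>\<^bsub>y(t)\<^esub>(v))\<close>.
\<close>

lemma radial_integral_derivative:
  fixes \<alpha> :: "'a::euclidean_space \<Rightarrow> 'a \<Rightarrow> real"
  assumes sm: "\<And>v. smooth_on (ball x0 r) (\<lambda>x. \<alpha> x v)"
    and lin: "\<And>x. x \<in> ball x0 r \<Longrightarrow> linear (\<alpha> x)"
    and closed: "\<And>x u v. x \<in> ball x0 r \<Longrightarrow>
      frechet_derivative (\<lambda>x. \<alpha> x u) (at x) v = frechet_derivative (\<lambda>x. \<alpha> x v) (at x) u"
    and x: "x \<in> ball x0 r" "x + v \<in> ball x0 r"
  defines "\<phi> \<equiv> \<lambda>z. integral (cbox 0 1) (\<lambda>t. \<alpha> (x0 + t *\<^sub>R (z - x0)) (z - x0))"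
  obtains s where "0 < s" "s < 1" "\<phi> (x + v) - \<phi> x = \<alpha> (x + s *\<^sub>R v) v"
proof -
  let ?S = "ball x0 r"
  let ?w = "\<lambda>s. x + s *\<^sub>R v - x0"
  let ?y = "\<lambda>s t. x0 + t *\<^sub>R ?w s"
  let ?D = "\<lambda>u. \<lambda>y. frechet_derivative (\<lambda>x. \<alpha> x u) (at y)"
  have seg: "x + s *\<^sub>R v \<in> ?S" if "0 \<le> s" "s \<le> 1" for s
    using convexD_alt[OF convex_ball x that] by (simp add: algebra_simps)
  have yS: "?y s t \<in> ?S" if "0 \<le> s" "s \<le> 1" "0 \<le> t" "t \<le> 1" for s t
  proof -
    have "r > 0" using x(1) by (metis ball_eq_empty empty_iff not_le)
    then have "x0 \<in> ?S" by simp
    from convexD_alt[OF convex_ball this seg[OF that(1,2)] that(3,4)]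
    show ?thesis by (simp add: algebra_simps)
  qed
  have D: "((\<lambda>x. \<alpha> x u) has_derivative ?D u y) (at y)" if "y \<in> ?S" for u y
    by (rule smooth_on_imp_has_derivative[OF sm that])
  have contD: "continuous_on ?S (\<lambda>y. ?D u y b)" for u b
    by (rule smooth_on_imp_continuous_on[OF smooth_on_frechet_derivative_const[OF sm]])
  have cont\<alpha>: "continuous_on ?S (\<lambda>y. \<alpha> y u)" for u
    by (rule smooth_on_imp_continuous_on[OF sm])
  have sum\<alpha>: "\<alpha> y u = (\<Sum>b\<in>Basis. (u \<bullet> b) *\<^sub>R \<alpha> y b)" if "y \<in> ?S" for y u
    by (rule linear_eq_sum_Basis[OF lin[OF that]])
  define fx where "fx s t = \<alpha> (?y s t) v + t * (\<Sum>b\<in>Basis. (?w s \<bullet> b) * ?D v (?y s t) b)" for s t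
  have fx_eq: "fx s t = \<alpha> (?y s t) v + t * ?D v (?y s t) (?w s)" if "?y s t \<in> ?S" for s t
    unfolding fx_def using linear_eq_sum_Basis[OF has_derivative_linear[OF D[OF that]], of v "?w s"]
    by simp
  have d_s: "((\<lambda>s. \<alpha> (?y s t) (?w s)) has_field_derivative fx s t) (at s within {0..1})"
    if st: "s \<in> {0..1}" "t \<in> cbox 0 1" for s t
  proof -
    have y: "?y s t \<in> ?S" using yS st by auto
    have "((\<lambda>s. ?y s t) has_derivative (\<lambda>h. h *\<^sub>R t *\<^sub>R v)) (at s within {0..1})"
      by (auto intro!: derivative_eq_intros)
    then have a: "((\<lambda>s. \<alpha> (?y s t) b) has_derivative (\<lambda>h. ?D b (?y s t) (h *\<^sub>R t *\<^sub>R v))) (at s within {0..1})" for b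
      by (rule has_derivative_compose) (rule D[OF y])
    have w: "((\<lambda>s. ?w s \<bullet> b) has_derivative (\<lambda>h. h * (v \<bullet> b))) (at s within {0..1})" for b
      by (auto intro!: derivative_eq_intros simp: inner_diff_left inner_add_left)
    have "((\<lambda>s. \<Sum>b\<in>Basis. (?w s \<bullet> b) *\<^sub>R \<alpha> (?y s t) b) has_derivative
        (\<lambda>h. \<Sum>b\<in>Basis. (?w s \<bullet> b) *\<^sub>R ?D b (?y s t) (h *\<^sub>R t *\<^sub>R v) + (h * (v \<bullet> b)) *\<^sub>R \<alpha> (?y s t) b))
        (at s within {0..1})"
      by (intro has_derivative_sum has_derivative_scaleR w a)
    moreover have "(\<Sum>b\<in>Basis. (?w s \<bullet> b) *\<^sub>R ?D b (?y s t) (h *\<^sub>R t *\<^sub>R v) + (h * (v \<bullet> b)) *\<^sub>R \<alpha> (?y s t) b)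
        = fx s t * h" for h
    proof -
      have "?D b (?y s t) (h *\<^sub>R t *\<^sub>R v) = h * t * ?D v (?y s t) b" for b
        using closed[OF y, of b v] linear_cmul[OF has_derivative_linear[OF D[OF y]]] by simp
      then have "(\<Sum>b\<in>Basis. (?w s \<bullet> b) *\<^sub>R ?D b (?y s t) (h *\<^sub>R t *\<^sub>R v) + (h * (v \<bullet> b)) *\<^sub>R \<alpha> (?y s t) b)
          = h * t * (\<Sum>b\<in>Basis. (?w s \<bullet> b) * ?D v (?y s t) b) + h * (\<Sum>b\<in>Basis. (v \<bullet> b) *\<^sub>R \<alpha> (?y s t) b)"
        by (simp add: sum.distrib sum_distrib_left mult_ac)
      then show ?thesis unfolding sum\<alpha>[OF y, symmetric] fx_def by (simp add: algebra_simps)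
    qed
    ultimately have "((\<lambda>s. \<Sum>b\<in>Basis. (?w s \<bullet> b) *\<^sub>R \<alpha> (?y s t) b) has_field_derivative fx s t)
        (at s within {0..1})"
      unfolding has_field_derivative_def by simp
    moreover have "\<alpha> (?y s' t) (?w s') = (\<Sum>b\<in>Basis. (?w s' \<bullet> b) *\<^sub>R \<alpha> (?y s' t) b)" if "s' \<in> {0..1}" for s'
      by (rule sum\<alpha>) (use yS that st in auto)
    ultimately show ?thesis
      using st(1) by (subst has_field_derivative_cong_eventually[where g = "\<lambda>s. \<Sum>b\<in>Basis. (?w s \<bullet> b) *\<^sub>R \<alpha> (?y s t) b"])
        (auto simp: eventually_at_filter)
  qed
  have comp: "continuous_on T (\<lambda>p. F (?y (fst p) (snd p)))"
    if "continuous_on ?S F" "T \<subseteq> {0..1} \<times> {0..1}" for F :: "'a \<Rightarrow> real" and T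
    by (rule continuous_on_compose2[OF that(1)])
      (use that(2) yS in \<open>auto intro!: continuous_intros simp: subset_iff\<close>)
  have cfx: "continuous_on ({0..1} \<times> cbox 0 1) (\<lambda>(s, t). fx s t)"
    unfolding fx_def split_def
    by (intro continuous_intros comp[OF cont\<alpha>] comp[OF contD]) auto
  have cf: "continuous_on (cbox 0 1) (\<lambda>t. \<alpha> (?y s t) (?w s))" if "s \<in> {0..1}" for s
    by (rule continuous_on_compose2[OF cont\<alpha>])
      (use that yS in \<open>auto intro!: continuous_intros\<close>)
  have d\<phi>: "((\<lambda>s. \<phi> (x + s *\<^sub>R v)) has_field_derivative integral (cbox 0 1) (fx s)) (at s within {0..1})"
    if "s \<in> {0..1}" for s
    unfolding \<phi>_def
    by (rule leibniz_rule_field_derivative[OF d_s integrable_continuous[OF cf] cfx that convex_closed_interval])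
  have int: "integral (cbox 0 1) (fx s) = \<alpha> (x + s *\<^sub>R v) v" if s: "s \<in> {0..1}" for s
  proof -
    have "((\<lambda>t. t * \<alpha> (?y s t) v) has_vector_derivative fx s t) (at t within {0..1})" if t: "t \<in> {0..1}" for t
    proof -
      have y: "?y s t \<in> ?S" using yS s t by auto
      have "((\<lambda>t. ?y s t) has_derivative (\<lambda>h. h *\<^sub>R ?w s)) (at t within {0..1})"
        by (auto intro!: derivative_eq_intros)
      then have "((\<lambda>t. \<alpha> (?y s t) v) has_derivative (\<lambda>h. ?D v (?y s t) (h *\<^sub>R ?w s))) (at t within {0..1})"
        by (rule has_derivative_compose) (rule D[OF y])
      then have "((\<lambda>t. t * \<alpha> (?y s t) v) has_derivative
          (\<lambda>h. t * ?D v (?y s t) (h *\<^sub>R ?w s) + h * \<alpha> (?y s t) v)) (at t within {0..1})"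
        by (intro has_derivative_mult has_derivative_ident)
      moreover have "t * ?D v (?y s t) (h *\<^sub>R ?w s) + h * \<alpha> (?y s t) v = h *\<^sub>R fx s t" for h
      proof -
        have "?D v (?y s t) (h *\<^sub>R ?w s) = h * ?D v (?y s t) (?w s)"
          unfolding linear_cmul[OF has_derivative_linear[OF D[OF y]]] real_scaleR_def ..
        then show ?thesis unfolding fx_eq[OF y] by (simp only: real_scaleR_def distrib_left mult_ac add_ac)
      qed
      ultimately show ?thesis unfolding has_vector_derivative_def by simp
    qed
    from fundamental_theorem_of_calculus[of 0 1, OF _ this]
    have "(fx s has_integral \<alpha> (x + s *\<^sub>R v) v) {0..1}" by simp
    then show ?thesis by (simp add: integral_unique)
  qed
  have "\<exists>s\<in>{0<..<1}. \<phi> (x + 1 *\<^sub>R v) - \<phi> (x + 0 *\<^sub>R v) = (\<lambda>h. \<alpha> (x + s *\<^sub>R v) v * h) (1 - 0)"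
  proof (rule mvt_simple)
    fix s :: real assume "0 \<le> s" "s \<le> 1"
    then show "((\<lambda>s. \<phi> (x + s *\<^sub>R v)) has_derivative (\<lambda>h. \<alpha> (x + s *\<^sub>R v) v * h)) (at s within {0..1})"
      using d\<phi>[of s] int[of s] by (simp add: has_field_derivative_def)
  qed simp
  then show thesis using that by auto
qed

text \<open>
  A primitive along all segments is a primitive in the Frechet sense, because \<open>\<alpha>\<close> is continuous.
\<close>

lemma poincare_lemma_ball:
  fixes \<alpha> :: "'a::euclidean_space \<Rightarrow> 'a \<Rightarrow> real"
  assumes sm: "\<And>v. smooth_on (ball x0 r) (\<lambda>x. \<alpha> x v)"
    and lin: "\<And>x. x \<in> ball x0 r \<Longrightarrow> linear (\<alpha> x)"
    and closed: "\<And>x u v. x \<in> ball x0 r \<Longrightarrow>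
      frechet_derivative (\<lambda>x. \<alpha> x u) (at x) v = frechet_derivative (\<lambda>x. \<alpha> x v) (at x) u"
  obtains \<phi> where "smooth_on (ball x0 r) \<phi>" "\<And>x. x \<in> ball x0 r \<Longrightarrow> (\<phi> has_derivative \<alpha> x) (at x)"
proof -
  let ?S = "ball x0 r"
  define \<phi> where "\<phi> z = integral (cbox 0 1) (\<lambda>t. \<alpha> (x0 + t *\<^sub>R (z - x0)) (z - x0))" for z
  have d: "(\<phi> has_derivative \<alpha> x) (at x)" if x: "x \<in> ?S" for x
  proof -
    have "\<exists>d>0. \<forall>y. norm (y - x) < d \<longrightarrow> norm (\<phi> y - \<phi> x - \<alpha> x (y - x)) \<le> e * norm (y - x)"
      if e: "e > 0" for e
    proof -
      \<comment> \<open>The error is estimated in each of the \<open>DIM('a)\<close> basis directions.\<close>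
      define e' where "e' = e / DIM('a)"
      have e': "e' > 0" using e by (simp add: e'_def)
      have "\<exists>T. open T \<and> x \<in> T \<and> T \<subseteq> ?S \<and> (\<forall>y\<in>T. \<bar>\<alpha> y b - \<alpha> x b\<bar> < e')" for b
      proof -
        have c: "continuous_on ?S (\<lambda>y. \<alpha> y b)" by (rule smooth_on_imp_continuous_on[OF sm])
        have "open (?S \<inter> (\<lambda>y. \<alpha> y b) -` ball (\<alpha> x b) e')"
          by (rule continuous_open_preimage[OF c open_ball open_ball])
        then show ?thesis
          using x e' by (intro exI[of _ "?S \<inter> (\<lambda>y. \<alpha> y b) -` ball (\<alpha> x b) e'"]) (auto simp: dist_real_def)
      qed
      then obtain T where T: "\<And>b. open (T b)" "\<And>b. x \<in> T b" "\<And>b. T b \<subseteq> ?S"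
        "\<And>b y. y \<in> T b \<Longrightarrow> \<bar>\<alpha> y b - \<alpha> x b\<bar> < e'" by metis
      have "open (?S \<inter> (\<Inter>b\<in>Basis. T b))"
        by (intro open_Int open_ball open_INT finite_Basis ballI T(1))
      moreover have "x \<in> ?S \<inter> (\<Inter>b\<in>Basis. T b)"
        using T(2) x by blast
      ultimately obtain d where d: "d > 0" "ball x d \<subseteq> ?S \<inter> (\<Inter>b\<in>Basis. T b)"
        by (meson open_contains_ball)
      have "norm (\<phi> y - \<phi> x - \<alpha> x (y - x)) \<le> e * norm (y - x)" if y: "norm (y - x) < d" for y
      proof -
        have yS: "y \<in> ?S" using d(2) y by (auto simp: dist_norm norm_minus_commute subset_iff)
        obtain s where s: "0 < s" "s < 1" "\<phi> (x + (y - x)) - \<phi> x = \<alpha> (x + s *\<^sub>R (y - x)) (y - x)"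
          using radial_integral_derivative[OF sm lin closed x, of "y - x"] yS unfolding \<phi>_def by auto
        let ?p = "x + s *\<^sub>R (y - x)"
        have "norm (s *\<^sub>R (y - x)) \<le> 1 * norm (y - x)"
          using s by (simp add: mult_left_le_one_le)
        then have p: "?p \<in> ball x d" using y by (simp add: dist_norm)
        then have pS: "?p \<in> ?S" using d(2) by blast
        have "\<phi> y - \<phi> x - \<alpha> x (y - x) = \<alpha> ?p (y - x) - \<alpha> x (y - x)" using s(3) by simp
        also have "\<dots> = (\<Sum>b\<in>Basis. ((y - x) \<bullet> b) *\<^sub>R (\<alpha> ?p b - \<alpha> x b))"
          using linear_eq_sum_Basis[OF lin[OF pS], of "y - x"] linear_eq_sum_Basis[OF lin[OF x], of "y - x"]
          by (simp add: sum_subtractf scaleR_diff_right right_diff_distrib)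
        finally have "norm (\<phi> y - \<phi> x - \<alpha> x (y - x)) \<le> (\<Sum>b\<in>Basis. norm (((y - x) \<bullet> b) *\<^sub>R (\<alpha> ?p b - \<alpha> x b)))"
          by (simp only: norm_sum)
        also have "\<dots> \<le> (\<Sum>b\<in>(Basis :: 'a set). norm (y - x) * e')"
        proof (rule sum_mono)
          fix b :: 'a assume b: "b \<in> Basis"
          have "\<bar>\<alpha> ?p b - \<alpha> x b\<bar> < e'" using T(4) d(2) p b by blast
          moreover have "\<bar>(y - x) \<bullet> b\<bar> \<le> norm (y - x)" using b by (rule Basis_le_norm)
          ultimately show "norm (((y - x) \<bullet> b) *\<^sub>R (\<alpha> ?p b - \<alpha> x b)) \<le> norm (y - x) * e'"
            by (simp add: abs_mult mult_mono)
        qed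
        also have "\<dots> = e * norm (y - x)" by (simp add: e'_def)
        finally show ?thesis .
      qed
      then show ?thesis using d(1) by blast
    qed
    moreover have "bounded_linear (\<alpha> x)" using lin[OF x] by (simp add: linear_conv_bounded_linear)
    ultimately show ?thesis unfolding has_derivative_at_alt by blast
  qed
  show thesis
    by (rule that[OF smooth_onI_has_derivative[OF open_ball d sm] d])
qed

section \<open>Local horizontal lifts of Lagrangian immersions\<close>

text \<open>
  The connection form of the Hopf fibration pulled back by a lift \<open>g\<close> is \<open>Im (herm dg g)\<close>. Its
  differential is a multiple of \<open>Im (herm dg dg)\<close>, the pulled back Kaehler form, and vanishes for a
  Lagrangian immersion: the vertical parts of \<open>dg\<close> are imaginary multiples of \<open>g\<close> and contribute
  real products only.
\<close>

lemma lagrangian_lift_isotropic: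
  fixes M :: "('a, real ^ 'n::finite) manifold"
  assumes sm: "smooth_manifold M" and lag: "lagrangian_immersion M f" and W: "openin (mtop M) W"
    and g: "smooth_fun M W g" "\<And>q. q \<in> W \<Longrightarrow> norm (g q) = 1" "\<And>q. q \<in> W \<Longrightarrow> f q = cline (g q)"
    and p: "p \<in> W" and X: "X \<in> tangent_space M p" and Y: "Y \<in> tangent_space M p"
  shows "Re (herm (vdiff M g p X) (g p)) = 0" "Im (herm (vdiff M g p X) (vdiff M g p Y)) = 0"
proof -
  have pM: "p \<in> carrier M" using openin_subset[OF W] p by blast
  have re: "Re (herm (vdiff M g p Z) (g p)) = 0" for Z
  proof -
    have s: "smooth_fun M W (\<lambda>q. g q \<bullet> g q)"
      by (intro smooth_funI[OF sm W] smooth_on_inner smooth_funD[OF g(1)])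
    have "g p \<bullet> vdiff M g p Z + vdiff M g p Z \<bullet> g p = 0"
      using vdiff_bilinear[OF sm W p g(1) g(1) bounded_bilinear_inner, of Z]
        vdiff_const[OF sm W p s, of 1 Z] g(2) by (simp add: norm_eq_1)
    then show ?thesis by (simp add: Re_herm inner_commute)
  qed
  then show "Re (herm (vdiff M g p X) (g p)) = 0" .
  let ?z = "g p"
  have n: "norm ?z = 1" by (rule g(2)[OF p])
  then have z0: "?z \<noteq> 0" by auto
  have zz: "herm ?z ?z = 1" using n by (simp add: herm_self_norm)
  have md: "mdiff M CP f p Z = dhopf ?z (hpart ?z (vdiff M g p Z))" for Z
    unfolding dhopf_hpart by (rule mdiff_cline[OF sm W p g(1,3)])
  have hh: "herm (hpart ?z u) ?z = 0" for u by (rule herm_hpart[OF z0])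
  have ih: "herm (\<i> *s hpart ?z u) ?z = 0" for u by (simp add: herm_simps hh)
  have "cpJ (f p) (mdiff M CP f p X) \<in> normal_space M f p"
    using lag pM X unfolding lagrangian_immersion_def by blast
  then have "gFS (f p) (cpJ (f p) (mdiff M CP f p X)) (mdiff M CP f p Y) = 0"
    using Y unfolding normal_space_def by blast
  then have "(\<i> *s hpart ?z (vdiff M g p X)) \<bullet> hpart ?z (vdiff M g p Y) = 0"
    unfolding md g(3)[OF p] cpJ_dhopf[OF n hh] gFS_dhopf[OF n ih hh] .
  then have "Im (herm (hpart ?z (vdiff M g p X)) (hpart ?z (vdiff M g p Y))) = 0"
    by (simp add: Re_herm[symmetric] herm_simps)
  then have "Im (herm (vdiff M g p X) (vdiff M g p Y)) = Im (herm (vdiff M g p X) ?z * herm ?z (vdiff M g p Y))"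
    by (simp add: herm_hpart_hpart[OF z0] zz)
  also have "\<dots> = 0"
    using re[of X] re[of Y] by (simp add: cnj_herm[of "vdiff M g p Y" ?z, symmetric])
  finally show "Im (herm (vdiff M g p X) (vdiff M g p Y)) = 0" .
qed

text \<open>
  If \<open>d\<phi> = \<alpha> = - Im (herm dh h)\<close> then \<open>e\<^sup>i\<^sup>\<phi> h\<close> is horizontal, as \<open>herm dh h\<close> is purely imaginary.
\<close>

lemma horizontal_lift_exists:
  fixes M :: "('a, real ^ 'n::finite) manifold" and f :: "'a \<Rightarrow> 'n option cp"
  assumes sm: "smooth_manifold M" and lag: "lagrangian_immersion M f" and p: "p \<in> carrier M"
  obtains W g where "openin (mtop M) W" "p \<in> W" "smooth_fun M W g"
    "\<And>q. q \<in> W \<Longrightarrow> norm (g q) = 1" "\<And>q. q \<in> W \<Longrightarrow> f q = cline (g q)"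
    "\<And>q X. q \<in> W \<Longrightarrow> X \<in> tangent_space M q \<Longrightarrow> herm (vdiff M g q X) (g q) = 0"
proof -
  have "smooth_map M CP (carrier M) f"
    using lag by (simp add: lagrangian_immersion_def immersion_into_quadric_def)
  then obtain V h where V: "openin (mtop M) V" "p \<in> V"
    and h: "smooth_fun M V h" "\<And>q. q \<in> V \<Longrightarrow> norm (h q) = 1" "\<And>q. q \<in> V \<Longrightarrow> f q = cline (h q)"
    using smooth_map_lift[OF sm _ p] by metis
  obtain c where c: "c \<in> charts_at M p" using exists_chart_at[OF sm p] .
  note cc = charts_atD[OF c] and inj = chart_facts(3)[OF sm charts_atD(1)[OF c]]
  have "open (cmap c ` (cdom c \<inter> V))" "cmap c p \<in> cmap c ` (cdom c \<inter> V)"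
    using open_chart_image[OF sm cc(1) V(1)] cc(2) V(2) by blast+
  then obtain r where r: "r > 0" "ball (cmap c p) r \<subseteq> cmap c ` (cdom c \<inter> V)"
    by (meson open_contains_ball)
  let ?B = "ball (cmap c p) r"
  define \<gamma> where "\<gamma> x = h (cinv c x)" for x
  let ?D = "\<lambda>x. frechet_derivative \<gamma> (at x)"
  have \<gamma>: "smooth_on ?B \<gamma>"
    unfolding \<gamma>_def by (rule smooth_on_subset[OF smooth_funD[OF h(1) cc(1)] r(2)])
  have pt: "cinv c x \<in> V" "c \<in> charts_at M (cinv c x)" "cmap c (cinv c x) = x" if "x \<in> ?B" for x
  proof -
    have x: "x \<in> cmap c ` (cdom c \<inter> V)" using r(2) that by blast
    then show "cinv c x \<in> V" "c \<in> charts_at M (cinv c x)" "cmap c (cinv c x) = x"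
      using inj cc(1) by (auto simp: charts_at_def)
  qed
  have vd: "\<exists>X. X \<in> tangent_space M (cinv c x) \<and> vdiff M h (cinv c x) X = ?D x v" if x: "x \<in> ?B" for x v
  proof -
    obtain X where X: "X \<in> tangent_space M (cinv c x)" "X c = v"
      using tangent_space_exists[OF sm pt(2)[OF x]] .
    then have "vdiff M h (cinv c x) X = ?D x v"
      using vdiff_chart[OF sm V(1) pt(1)[OF x] h(1) pt(2)[OF x] X(1)] pt(3)[OF x] by (simp add: \<gamma>_def[abs_def])
    then show ?thesis using X(1) by blast
  qed
  have re: "Re (herm (?D x v) (\<gamma> x)) = 0" if x: "x \<in> ?B" for x v
  proof -
    obtain X where "X \<in> tangent_space M (cinv c x)" "vdiff M h (cinv c x) X = ?D x v"
      using vd[OF x] by blast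
    then show ?thesis
      using lagrangian_lift_isotropic(1)[OF sm lag V(1) h pt(1)[OF x], of X X] by (simp add: \<gamma>_def)
  qed
  have im: "Im (herm (?D x u) (?D x v)) = 0" if x: "x \<in> ?B" for x u v
  proof -
    obtain X Y where "X \<in> tangent_space M (cinv c x)" "vdiff M h (cinv c x) X = ?D x u"
      "Y \<in> tangent_space M (cinv c x)" "vdiff M h (cinv c x) Y = ?D x v"
      using vd[OF x] by metis
    then show ?thesis
      using lagrangian_lift_isotropic(2)[OF sm lag V(1) h pt(1)[OF x], of X Y] by simp
  qed
  define \<alpha> where "\<alpha> x v = - Im (herm (?D x v) (\<gamma> x))" for x v
  have D: "(\<gamma> has_derivative ?D x) (at x)" if "x \<in> ?B" for x
    by (rule smooth_on_imp_has_derivative[OF \<gamma> that])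
  have lin: "linear (\<alpha> x)" if "x \<in> ?B" for x
    unfolding \<alpha>_def using has_derivative_linear[OF D[OF that]]
    by (intro linearI) (simp_all add: linear_add linear_cmul herm_simps)
  have sm\<alpha>: "smooth_on ?B (\<lambda>x. \<alpha> x v)" for v
    unfolding \<alpha>_def
    by (intro smooth_on_minus smooth_on_bounded_linear[OF _ bounded_linear_Im]
        smooth_on_bilinear[OF _ bounded_bilinear_herm] smooth_on_frechet_derivative_const \<gamma> open_ball)
  have closed: "frechet_derivative (\<lambda>x. \<alpha> x u) (at x) v = frechet_derivative (\<lambda>x. \<alpha> x v) (at x) u"
    if x: "x \<in> ?B" for x u v
  proof -
    have "frechet_derivative (\<lambda>x. \<alpha> x u) (at x) v = - Im (herm (frechet_derivative (\<lambda>x. ?D x u) (at x) v) (\<gamma> x))"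
      for u v
    proof -
      have "((\<lambda>x. \<alpha> x u) has_derivative (\<lambda>v. - Im (herm (?D x u) (?D x v)
          + herm (frechet_derivative (\<lambda>x. ?D x u) (at x) v) (\<gamma> x)))) (at x)"
        unfolding \<alpha>_def
        by (intro has_derivative_minus bounded_linear.has_derivative[OF bounded_linear_Im]
            bounded_bilinear.FDERIV[OF bounded_bilinear_herm] D[OF x]
            smooth_on_imp_has_derivative[OF smooth_on_frechet_derivative_const[OF \<gamma>] x])
      from frechet_derivative_at[OF this, symmetric] show ?thesis using im[OF x] by simp
    qed
    then show ?thesis using second_derivative_symmetric[OF open_ball \<gamma> x] by metis
  qed
  obtain \<phi> where \<phi>: "smooth_on ?B \<phi>" "\<And>x. x \<in> ?B \<Longrightarrow> (\<phi> has_derivative \<alpha> x) (at x)"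
    using poincare_lemma_ball[OF sm\<alpha> lin closed] by blast
  define W where "W = {q \<in> cdom c. cmap c q \<in> ?B}"
  define g where "g q = cis (\<phi> (cmap c q)) *s h q" for q
  have W: "openin (mtop M) W" unfolding W_def by (rule openin_chart_preimage[OF sm cc(1) open_ball])
  have pW: "p \<in> W" using cc(2) r(1) by (simp add: W_def)
  have WV: "W \<subseteq> V"
  proof
    fix q assume "q \<in> W"
    then have "q \<in> cdom c" "cmap c q \<in> ?B" by (auto simp: W_def)
    then show "q \<in> V" using pt(1)[of "cmap c q"] inj by simp
  qed
  have img: "cmap c ` W = ?B"
  proof
    show "?B \<subseteq> cmap c ` W"
    proof
      fix x assume x: "x \<in> ?B"
      then show "x \<in> cmap c ` W"
        using pt[OF x] by (intro image_eqI[of _ _ "cinv c x"]) (auto simp: W_def charts_at_def)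
    qed
  qed (auto simp: W_def)
  have gx: "g (cinv c x) = cis (\<phi> x) *s \<gamma> x" if "x \<in> ?B" for x
    using pt(3)[OF that] by (simp add: g_def \<gamma>_def)
  have smg: "smooth_on ?B (\<lambda>x. cis (\<phi> x) *s \<gamma> x)"
    by (intro smooth_on_bilinear[OF _ bounded_bilinear_scale] smooth_on_cis \<phi>(1) \<gamma> open_ball)
  have g: "smooth_fun M W g"
  proof (rule smooth_funI_chart[OF sm cc(1) W])
    show "W \<subseteq> cdom c" by (auto simp: W_def)
    show "smooth_on (cmap c ` W) (\<lambda>x. g (cinv c x))"
      unfolding img by (rule smooth_on_cong[OF open_ball _ smg]) (simp add: gx)
  qed
  have cc1: "cis t * cnj (cis t) = 1" for t by (simp add: cis_cnj cis_mult)
  show thesis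
  proof (rule that[OF W pW g])
    fix q assume q: "q \<in> W"
    have hq: "norm (h q) = 1" "f q = cline (h q)" using h(2,3) q WV by blast+
    have "herm (g q) (g q) = 1"
      using hq(1) cc1[of "\<phi> (cmap c q)"]
      unfolding g_def herm_scale_left herm_scale_right by (simp add: herm_self_norm mult.commute)
    then show "norm (g q) = 1"
      by (simp add: norm_eq_1 Re_herm[symmetric])
    show "f q = cline (g q)" using hq(2) by (simp add: g_def cline_scale)
    fix X assume X: "X \<in> tangent_space M q"
    let ?x = "cmap c q"
    have x: "?x \<in> ?B" and cq: "c \<in> charts_at M q" using q cc(1) by (auto simp: W_def charts_at_def)
    have "((\<lambda>x. cis (\<phi> x) *s \<gamma> x) has_derivative
        (\<lambda>v. cis (\<phi> ?x) *s ?D ?x v + (of_real (\<alpha> ?x v) * (\<i> * cis (\<phi> ?x))) *s \<gamma> ?x)) (at ?x)"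
      by (rule bounded_bilinear.FDERIV[OF bounded_bilinear_scale
            has_derivative_compose[OF \<phi>(2)[OF x] has_derivative_cis] D[OF x]])
    then have "((\<lambda>x. g (cinv c x)) has_derivative
        (\<lambda>v. cis (\<phi> ?x) *s ?D ?x v + (of_real (\<alpha> ?x v) * (\<i> * cis (\<phi> ?x))) *s \<gamma> ?x)) (at ?x)"
      by (rule has_derivative_transform_within_open[OF _ open_ball x]) (simp add: gx)
    from frechet_derivative_at[OF this, symmetric]
    have "vdiff M g q X = cis (\<phi> ?x) *s ?D ?x (X c) + (of_real (\<alpha> ?x (X c)) * (\<i> * cis (\<phi> ?x))) *s \<gamma> ?x"
      unfolding vdiff_chart[OF sm W q g cq X] by simp
    moreover have "g q = cis (\<phi> ?x) *s \<gamma> ?x"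
      using gx[OF x] by (simp add: cinv_cmap[OF sm cq])
    moreover have "herm (\<gamma> ?x) (\<gamma> ?x) = 1"
      using hq(1) by (simp add: \<gamma>_def cinv_cmap[OF sm cq] herm_self_norm)
    moreover have "herm (?D ?x (X c)) (\<gamma> ?x) = \<i> * of_real (- \<alpha> ?x (X c))"
      using re[OF x, of "X c"] by (simp add: complex_eq_iff \<alpha>_def)
    ultimately have "herm (vdiff M g q X) (g q)
        = (cis (\<phi> ?x) * cnj (cis (\<phi> ?x))) * (\<i> * of_real (- \<alpha> ?x (X c)) + of_real (\<alpha> ?x (X c)) * \<i>)"
      by (simp add: herm_simps algebra_simps)
    then show "herm (vdiff M g q X) (g q) = 0" by (simp add: mult.commute)
  qed
qed

section \<open>From lifts to hypersurfaces\<close>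

text \<open>
  A pair \<open>(a, b)\<close> as in a hypersurface, except that only the pair has to be immersive. Such pairs
  correspond to horizontal lifts of Lagrangian immersions, and they can be rotated freely. The symmetry
  of \<open>db \<bullet> da\<close> expresses that the immersion is Lagrangian.
\<close>

definition legendre_pair :: "('a, real ^ 'n::finite) manifold \<Rightarrow> ('a \<Rightarrow> 'n option cp) \<Rightarrow> 'a set
    \<Rightarrow> ('a \<Rightarrow> real ^ 'n option option) \<Rightarrow> ('a \<Rightarrow> real ^ 'n option option) \<Rightarrow> bool" where
  "legendre_pair M f U a b \<longleftrightarrow>
     openin (mtop M) U \<and> smooth_fun M U a \<and> smooth_fun M U b \<and>
     (\<forall>q\<in>U. f q = gauss_map a b q \<and> norm (a q) = 1 \<and> norm (b q) = 1 \<and> b q \<bullet> a q = 0 \<and>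
       (\<forall>X\<in>tangent_space M q. b q \<bullet> vdiff M a q X = 0 \<and> a q \<bullet> vdiff M b q X = 0 \<and>
          a q \<bullet> vdiff M a q X = 0 \<and> b q \<bullet> vdiff M b q X = 0 \<and>
          (vdiff M a q X = 0 \<longrightarrow> vdiff M b q X = 0 \<longrightarrow> X = tzero)) \<and>
       (\<forall>X\<in>tangent_space M q. \<forall>Y\<in>tangent_space M q.
          vdiff M b q X \<bullet> vdiff M a q Y = vdiff M b q Y \<bullet> vdiff M a q X))"

lemma vdiff_tzero:
  assumes "smooth_manifold M" "openin (mtop M) W" "p \<in> W" "smooth_fun M W a"
  shows "vdiff M a p tzero = 0"
  using vdiff_tscale[OF assms, of 0 tzero] by (simp add: tscale_def tzero_def)

lemma inj_on_vdiff_kernel: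
  assumes "smooth_manifold M" "openin (mtop M) W" "p \<in> W" "smooth_fun M W a"
  shows "inj_on (vdiff M a p) (tangent_space M p) \<longleftrightarrow> (\<forall>X\<in>tangent_space M p. vdiff M a p X = 0 \<longrightarrow> X = tzero)"
proof
  assume "inj_on (vdiff M a p) (tangent_space M p)"
  then show "\<forall>X\<in>tangent_space M p. vdiff M a p X = 0 \<longrightarrow> X = tzero"
    using vdiff_nonzero[OF assms] by blast
next
  assume k: "\<forall>X\<in>tangent_space M p. vdiff M a p X = 0 \<longrightarrow> X = tzero"
  have p: "p \<in> carrier M" using assms(2,3) openin_subset by blast
  have "v = 0" if v: "vderiv M a p v = 0" for v
  proof -
    obtain X where X: "X \<in> tangent_space M p" "X (pchart M p) = v"
      using tangent_space_exists[OF assms(1) pchart_in_charts_at[OF assms(1) p]] .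
    then have "X = tzero" using k v by (simp add: vdiff_eq_vderiv)
    then show ?thesis using X(2) by (simp add: tzero_def)
  qed
  then have "inj (vderiv M a p)"
    using linear_injective_0[OF linear_vderiv[OF assms]] by blast
  then show "inj_on (vdiff M a p) (tangent_space M p)"
    using inj_on_vdiff_iff[OF assms(1) p] by blast
qed

definition vRe :: "complex ^ 'm \<Rightarrow> real ^ 'm" where "vRe z = (\<chi> j. Re (z $ j))"
definition vIm :: "complex ^ 'm \<Rightarrow> real ^ 'm" where "vIm z = (\<chi> j. Im (z $ j))"

lemma cvec_vRe_vIm: "cvec (vRe z) (vIm z) = z"
  by (simp add: cvec_def vRe_def vIm_def vec_eq_iff)

lemma bounded_linear_vRe: "bounded_linear (vRe :: complex ^ 'm::finite \<Rightarrow> _)"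
  and bounded_linear_vIm: "bounded_linear (vIm :: complex ^ 'm::finite \<Rightarrow> _)"
  by (auto intro!: linear_conv_bounded_linear[THEN iffD1] linearI simp: vRe_def vIm_def vec_eq_iff)

lemma legendre_pair_exists:
  fixes M :: "('a, real ^ 'n::finite) manifold" and f :: "'a \<Rightarrow> 'n option cp"
  assumes sm: "smooth_manifold M" and lag: "lagrangian_immersion M f" and p: "p \<in> carrier M"
  obtains U a b where "p \<in> U" "legendre_pair M f U a b"
proof -
  obtain U g where U: "openin (mtop M) U" "p \<in> U" and g: "smooth_fun M U g"
    "\<And>q. q \<in> U \<Longrightarrow> norm (g q) = 1" "\<And>q. q \<in> U \<Longrightarrow> f q = cline (g q)"
    and hor: "\<And>q X. q \<in> U \<Longrightarrow> X \<in> tangent_space M q \<Longrightarrow> herm (vdiff M g q X) (g q) = 0"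
    using horizontal_lift_exists[OF sm lag p] by metis
  define a where "a q = sqrt 2 *\<^sub>R vRe (g q)" for q
  define b where "b q = sqrt 2 *\<^sub>R vIm (g q)" for q
  have blr: "bounded_linear (\<lambda>z :: complex ^ 'n option option. sqrt 2 *\<^sub>R vRe z)"
    and bli: "bounded_linear (\<lambda>z :: complex ^ 'n option option. sqrt 2 *\<^sub>R vIm z)"
    by (intro bounded_linear_const_scaleR bounded_linear_vRe bounded_linear_vIm)+
  have sa: "smooth_fun M U a"
    unfolding a_def[abs_def] by (intro smooth_funI[OF sm U(1)] smooth_on_bounded_linear[OF _ blr] smooth_funD[OF g(1)])
  have sb: "smooth_fun M U b"
    unfolding b_def[abs_def] by (intro smooth_funI[OF sm U(1)] smooth_on_bounded_linear[OF _ bli] smooth_funD[OF g(1)])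
  have gg: "glift a b = g"
    by (rule ext) (simp add: glift_def a_def b_def cvec_simps cvec_vRe_vIm)
  have vg: "vdiff M g q X = (1 / sqrt 2) *\<^sub>R cvec (vdiff M a q X) (vdiff M b q X)" if "q \<in> U" for q X
    using vdiff_glift[OF sm U(1) that sa sb, of X] unfolding gg .
  have gq: "g q = (1 / sqrt 2) *\<^sub>R cvec (a q) (b q)" for q
    using fun_cong[OF gg, of q] by (simp add: glift_def)
  have on: "a q \<bullet> a q = 1" "b q \<bullet> b q = 1" "b q \<bullet> a q = 0" if q: "q \<in> U" for q
  proof -
    have "g q \<noteq> 0" using g(2)[OF q] by auto
    moreover have "f q \<in> Quadric"
      using lag q openin_subset[OF U(1)]
      unfolding lagrangian_immersion_def immersion_into_quadric_def by blast
    ultimately have "herm (g q) (cconj (g q)) = 0"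
      using cline_in_Quadric_iff g(3)[OF q] by metis
    then have 1: "a q \<bullet> a q = b q \<bullet> b q" "b q \<bullet> a q = 0"
      by (auto simp: gq cconj_simps cvec_simps(4) herm_simps herm_cvec complex_eq_iff inner_commute)
    have "g q \<bullet> g q = 1" using g(2)[OF q] by (simp add: norm_eq_1)
    then have "a q \<bullet> a q + b q \<bullet> b q = 2" by (simp add: gq inner_cvec)
    then show "a q \<bullet> a q = 1" "b q \<bullet> b q = 1" "b q \<bullet> a q = 0" using 1 by simp_all
  qed
  have d: "F q \<bullet> vdiff M G q X + vdiff M F q X \<bullet> G q = 0"
    if F: "smooth_fun M U F" and G: "smooth_fun M U G" and k: "\<And>q. q \<in> U \<Longrightarrow> F q \<bullet> G q = k" and q: "q \<in> U"
    for F G :: "'a \<Rightarrow> real ^ 'n option option" and q X k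
  proof -
    have s: "smooth_fun M U (\<lambda>q. F q \<bullet> G q)"
      by (intro smooth_funI[OF sm U(1)] smooth_on_inner smooth_funD[OF F] smooth_funD[OF G])
    show ?thesis
      using vdiff_bilinear[OF sm U(1) q F G bounded_bilinear_inner, of X]
        vdiff_const[OF sm U(1) q s k, of X] by simp
  qed
  have "legendre_pair M f U a b"
    unfolding legendre_pair_def
  proof (intro conjI ballI impI U(1) sa sb)
    fix q assume q: "q \<in> U"
    show "f q = gauss_map a b q" unfolding gauss_map_glift gg by (rule g(3)[OF q])
    show "norm (a q) = 1" "norm (b q) = 1" "b q \<bullet> a q = 0" using on[OF q] by (simp_all add: norm_eq_1)
    fix X assume X: "X \<in> tangent_space M q"
    show aa: "a q \<bullet> vdiff M a q X = 0" using d[OF sa sa on(1) q, of X] by (simp add: inner_commute)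
    show bb: "b q \<bullet> vdiff M b q X = 0" using d[OF sb sb on(2) q, of X] by (simp add: inner_commute)
    have "vdiff M b q X \<bullet> a q = vdiff M a q X \<bullet> b q"
      using hor[OF q X] unfolding vg[OF q] gq
      by (simp add: herm_simps herm_cvec complex_eq_iff)
    then show "b q \<bullet> vdiff M a q X = 0" "a q \<bullet> vdiff M b q X = 0"
      using d[OF sb sa on(3) q, of X] by (simp_all add: inner_commute)
    show "vdiff M b q X \<bullet> vdiff M a q Y = vdiff M b q Y \<bullet> vdiff M a q X" if Y: "Y \<in> tangent_space M q" for Y
      using lagrangian_lift_isotropic(2)[OF sm lag U(1) g q X Y] unfolding vg[OF q]
      by (simp add: herm_simps herm_cvec inner_commute)
    assume z: "vdiff M a q X = 0" "vdiff M b q X = 0"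
    have "vdiff M g q X = vdiff M g q tzero"
      unfolding vg[OF q] z vdiff_tzero[OF sm U(1) q sa] vdiff_tzero[OF sm U(1) q sb] ..
    moreover have "mdiff M CP f q Z = dhopf (g q) (vdiff M g q Z)" for Z
      by (rule mdiff_cline[OF sm U(1) q g(1,3)])
    ultimately have "mdiff M CP f q X = mdiff M CP f q tzero" by simp
    moreover have "inj_on (mdiff M CP f q) (tangent_space M q)"
      using lag q openin_subset[OF U(1)]
      unfolding lagrangian_immersion_def immersion_into_quadric_def by blast
    ultimately show "X = tzero"
      using X tzero_in_tangent_space[OF sm] by (meson inj_onD)
  qed
  then show thesis using that U(2) by blast
qed

lemma legendre_pair_of_hypersurface:
  fixes M :: "('a, real ^ 'n::finite) manifold"
  assumes sm: "smooth_manifold M" and h: "hypersurface M U a b" and f: "\<And>q. q \<in> U \<Longrightarrow> f q = gauss_map a b q"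
  shows "legendre_pair M f U a b"
proof -
  note hf = hypersurface_facts[OF sm h]
  have U: "openin (mtop M) U" and s: "smooth_fun M U a" "smooth_fun M U b"
    using h by (auto simp: hypersurface_def)
  show ?thesis
    unfolding legendre_pair_def
  proof (intro conjI ballI impI U s)
    fix q assume q: "q \<in> U"
    show "f q = gauss_map a b q" "norm (a q) = 1" "norm (b q) = 1" "b q \<bullet> a q = 0"
      using f[OF q] hf(5-7)[OF q] by blast+
    fix X assume X: "X \<in> tangent_space M q"
    show "b q \<bullet> vdiff M a q X = 0" "a q \<bullet> vdiff M b q X = 0" "a q \<bullet> vdiff M a q X = 0"
      "b q \<bullet> vdiff M b q X = 0"
      using hf(9-12)[OF q X] by blast+
    show "X = tzero" if "vdiff M a q X = 0"
      using inj_on_vdiff_kernel[OF sm U q s(1)] hf(8)[OF q] X that by blast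
    show "vdiff M b q X \<bullet> vdiff M a q Y = vdiff M b q Y \<bullet> vdiff M a q X" if "Y \<in> tangent_space M q" for Y
      by (rule second_fundamental_form_symmetric[OF sm h q X that])
  qed
qed

lemma rotate_cvec: "cvec (c *\<^sub>R u - s *\<^sub>R v) (s *\<^sub>R u + c *\<^sub>R v) = Complex c s *s cvec u v"
  by (simp add: cvec_def vec_eq_iff complex_eq_iff)

lemma vdiff_linear_combination:
  assumes "smooth_manifold M" "openin (mtop M) U" "smooth_fun M U a" "smooth_fun M U b"
  shows "smooth_fun M U (\<lambda>q. c *\<^sub>R a q + s *\<^sub>R b q)"
    and "q \<in> U \<Longrightarrow> vdiff M (\<lambda>q. c *\<^sub>R a q + s *\<^sub>R b q) q X = c *\<^sub>R vdiff M a q X + s *\<^sub>R vdiff M b q X"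
proof -
  have sc: "smooth_fun M U (\<lambda>q. r *\<^sub>R F q)" if "smooth_fun M U F" for r and F :: "'a \<Rightarrow> 'c"
    by (intro smooth_funI[OF assms(1,2)] smooth_on_scaleR smooth_on_const smooth_funD[OF that])
  show "smooth_fun M U (\<lambda>q. c *\<^sub>R a q + s *\<^sub>R b q)"
    by (intro smooth_funI[OF assms(1,2)] smooth_on_add smooth_on_scaleR smooth_on_const
        smooth_funD[OF assms(3)] smooth_funD[OF assms(4)])
  show "vdiff M (\<lambda>q. c *\<^sub>R a q + s *\<^sub>R b q) q X = c *\<^sub>R vdiff M a q X + s *\<^sub>R vdiff M b q X" if q: "q \<in> U"
    by (simp add: vdiff_add[OF assms(1,2) q sc[OF assms(3)] sc[OF assms(4)]]
        vdiff_linear_map[OF assms(1,2) q assms(3) bounded_linear_scaleR_right]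
        vdiff_linear_map[OF assms(1,2) q assms(4) bounded_linear_scaleR_right])
qed

text \<open>
  A rotation of the pair multiplies \<open>a + ib\<close> by a complex number of modulus one, so the line is unchanged.
\<close>

lemma legendre_pair_rotate:
  fixes M :: "('a, real ^ 'n::finite) manifold"
  assumes sm: "smooth_manifold M" and l: "legendre_pair M f U a b" and cs: "c\<^sup>2 + s\<^sup>2 = (1::real)"
  shows "legendre_pair M f U (\<lambda>q. c *\<^sub>R a q + (- s) *\<^sub>R b q) (\<lambda>q. s *\<^sub>R a q + c *\<^sub>R b q)"
proof -
  have U: "openin (mtop M) U" and sa: "smooth_fun M U a" and sb: "smooth_fun M U b"
    using l by (auto simp: legendre_pair_def)
  note lc = vdiff_linear_combination[OF sm U sa sb]
  have cs': "c * c + s * s = 1" using cs by (simp add: power2_eq_square)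
  show ?thesis
    unfolding legendre_pair_def
  proof (intro conjI ballI impI U lc(1))
    fix q assume q: "q \<in> U"
    have n: "a q \<bullet> a q = 1" "b q \<bullet> b q = 1" "b q \<bullet> a q = 0" "a q \<bullet> b q = 0" and fq: "f q = gauss_map a b q"
      using l q unfolding legendre_pair_def by (auto simp: norm_eq_1 inner_commute)
    have "Complex c s \<noteq> 0" using cs by (auto simp: complex_eq_iff)
    then show "f q = gauss_map (\<lambda>q. c *\<^sub>R a q + (- s) *\<^sub>R b q) (\<lambda>q. s *\<^sub>R a q + c *\<^sub>R b q) q"
      using rotate_cvec[of c "a q" s "b q"] fq by (simp add: gauss_map_def cline_scale)
    show "norm (c *\<^sub>R a q + (- s) *\<^sub>R b q) = 1" "norm (s *\<^sub>R a q + c *\<^sub>R b q) = 1"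
      "(s *\<^sub>R a q + c *\<^sub>R b q) \<bullet> (c *\<^sub>R a q + (- s) *\<^sub>R b q) = 0"
      using n cs' by (simp_all add: norm_eq_1 algebra_simps)
    fix X assume X: "X \<in> tangent_space M q"
    have t: "b q \<bullet> vdiff M a q X = 0" "a q \<bullet> vdiff M b q X = 0" "a q \<bullet> vdiff M a q X = 0" "b q \<bullet> vdiff M b q X = 0"
      and tz: "vdiff M a q X = 0 \<Longrightarrow> vdiff M b q X = 0 \<Longrightarrow> X = tzero"
      using l q X unfolding legendre_pair_def by blast+
    show "(s *\<^sub>R a q + c *\<^sub>R b q) \<bullet> vdiff M (\<lambda>q. c *\<^sub>R a q + (- s) *\<^sub>R b q) q X = 0"
      "(c *\<^sub>R a q + (- s) *\<^sub>R b q) \<bullet> vdiff M (\<lambda>q. s *\<^sub>R a q + c *\<^sub>R b q) q X = 0"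
      "(c *\<^sub>R a q + (- s) *\<^sub>R b q) \<bullet> vdiff M (\<lambda>q. c *\<^sub>R a q + (- s) *\<^sub>R b q) q X = 0"
      "(s *\<^sub>R a q + c *\<^sub>R b q) \<bullet> vdiff M (\<lambda>q. s *\<^sub>R a q + c *\<^sub>R b q) q X = 0"
      unfolding lc(2)[OF q] using t
      by (simp_all add: inner_add_left inner_add_right inner_diff_left inner_diff_right)
    show "vdiff M (\<lambda>q. s *\<^sub>R a q + c *\<^sub>R b q) q X \<bullet> vdiff M (\<lambda>q. c *\<^sub>R a q + (- s) *\<^sub>R b q) q Y
        = vdiff M (\<lambda>q. s *\<^sub>R a q + c *\<^sub>R b q) q Y \<bullet> vdiff M (\<lambda>q. c *\<^sub>R a q + (- s) *\<^sub>R b q) q X"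
      if Y: "Y \<in> tangent_space M q" for Y
    proof -
      have "vdiff M b q X \<bullet> vdiff M a q Y = vdiff M b q Y \<bullet> vdiff M a q X"
        using l q X Y unfolding legendre_pair_def by blast
      then show ?thesis
        unfolding lc(2)[OF q] by (simp add: inner_add_left inner_add_right inner_commute algebra_simps)
    qed
    assume z: "vdiff M (\<lambda>q. c *\<^sub>R a q + (- s) *\<^sub>R b q) q X = 0" "vdiff M (\<lambda>q. s *\<^sub>R a q + c *\<^sub>R b q) q X = 0"
    have z1: "c *\<^sub>R vdiff M a q X = s *\<^sub>R vdiff M b q X" and z2: "s *\<^sub>R vdiff M a q X = - c *\<^sub>R vdiff M b q X"
      using z unfolding lc(2)[OF q] by (simp_all add: eq_neg_iff_add_eq_0)
    have "(c * c + s * s) *\<^sub>R vdiff M a q X = c *\<^sub>R (c *\<^sub>R vdiff M a q X) + s *\<^sub>R (s *\<^sub>R vdiff M a q X)"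
      by (simp add: scaleR_add_left)
    also have "\<dots> = 0" unfolding z1 z2 by (simp add: mult.commute)
    finally have za: "vdiff M a q X = 0" using cs' by simp
    have "(c * c + s * s) *\<^sub>R vdiff M b q X = c *\<^sub>R (c *\<^sub>R vdiff M b q X) + s *\<^sub>R (s *\<^sub>R vdiff M b q X)"
      by (simp add: scaleR_add_left)
    also have "\<dots> = 0"
      unfolding z1[symmetric] using z2 by (simp add: za)
    finally have "vdiff M b q X = 0" using cs' by simp
    with za show "X = tzero" by (rule tz)
  qed
qed

text \<open>
  An injective linear map is bounded below by \<open>B |v|\<close>. The neighbourhood is chosen such that the derivative
  changes by at most \<open>B / (2 DIM('a))\<close> on every basis vector, hence by at most \<open>(B / 2) |v|\<close> on \<open>v\<close>.
\<close>

lemma open_inj_derivative: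
  fixes F :: "'a::euclidean_space \<Rightarrow> 'b::euclidean_space"
  assumes S: "open S" "x0 \<in> S" and F: "smooth_on S F" and inj: "inj (frechet_derivative F (at x0))"
  obtains T where "open T" "x0 \<in> T" "T \<subseteq> S" "\<And>x. x \<in> T \<Longrightarrow> inj (frechet_derivative F (at x))"
proof -
  let ?D = "\<lambda>x. frechet_derivative F (at x)"
  have lin: "linear (?D x)" if "x \<in> S" for x
    by (rule has_derivative_linear[OF smooth_on_imp_has_derivative[OF F that]])
  obtain B where B: "B > 0" "\<And>v. B * norm v \<le> norm (?D x0 v)"
    using linear_inj_bounded_below_pos[OF lin[OF S(2)] inj] by blast
  define e where "e = B / (2 * DIM('a))"
  have e: "e > 0" using B(1) by (simp add: e_def)
  define T where "T = S \<inter> (\<Inter>b\<in>Basis. S \<inter> (\<lambda>x. ?D x b) -` ball (?D x0 b) e)"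
  have oT: "open (S \<inter> (\<lambda>x. ?D x b) -` ball (?D x0 b) e)" for b
    by (rule continuous_open_preimage[OF smooth_on_imp_continuous_on[OF smooth_on_frechet_derivative_const[OF F]]
          S(1) open_ball])
  have "open T"
    unfolding T_def by (rule open_Int[OF S(1) open_INT[OF finite_Basis]]) (use oT in blast)
  moreover have "x0 \<in> T" using S(2) e by (simp add: T_def)
  moreover have "inj (?D x)" if x: "x \<in> T" for x
  proof -
    have xS: "x \<in> S" using x by (simp add: T_def)
    have "v = 0" if v: "?D x v = 0" for v
    proof -
      have "norm (?D x0 v) = norm (?D x v - ?D x0 v)" using v by simp
      also have "?D x v - ?D x0 v = (\<Sum>b\<in>Basis. (v \<bullet> b) *\<^sub>R (?D x b - ?D x0 b))"
        using linear_eq_sum_Basis[OF lin[OF xS], of v] linear_eq_sum_Basis[OF lin[OF S(2)], of v]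
        by (simp add: sum_subtractf scaleR_diff_right)
      also have "norm \<dots> \<le> (\<Sum>b\<in>Basis. norm ((v \<bullet> b) *\<^sub>R (?D x b - ?D x0 b)))" by (rule norm_sum)
      also have "\<dots> \<le> (\<Sum>b\<in>(Basis :: 'a set). norm v * e)"
      proof (rule sum_mono)
        fix b :: 'a assume b: "b \<in> Basis"
        have "norm (?D x b - ?D x0 b) \<le> e"
          using x b by (auto simp: T_def dist_norm norm_minus_commute)
        then show "norm ((v \<bullet> b) *\<^sub>R (?D x b - ?D x0 b)) \<le> norm v * e"
          using Basis_le_norm[OF b, of v] by (simp add: mult_mono)
      qed
      also have "\<dots> = B / 2 * norm v" by (simp add: e_def)
      finally have "B * norm v \<le> B / 2 * norm v" using B(2)[of v] by linarith
      then have "B / 2 * norm v \<le> 0" by (simp add: algebra_simps)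
      then show ?thesis using B(1) by (simp add: mult_le_0_iff)
    qed
    then show ?thesis using linear_injective_0[OF lin[OF xS]] by blast
  qed
  ultimately show thesis using that[of T] by (auto simp: T_def)
qed

lemma hypersurface_of_legendre_pair:
  fixes M :: "('a, real ^ 'n::finite) manifold"
  assumes sm: "smooth_manifold M" and l: "legendre_pair M f U a b" and p: "p \<in> U"
    and inj: "\<And>X. X \<in> tangent_space M p \<Longrightarrow> vdiff M a p X = 0 \<Longrightarrow> X = tzero"
  obtains V where "p \<in> V" "V \<subseteq> U" "hypersurface M V a b"
proof -
  have U: "openin (mtop M) U" and sa: "smooth_fun M U a" and sb: "smooth_fun M U b"
    using l by (auto simp: legendre_pair_def)
  have pM: "p \<in> carrier M" using openin_subset[OF U] p by blast
  obtain c where c: "c \<in> charts_at M p" using exists_chart_at[OF sm pM] .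
  note cc = charts_atD[OF c]
  let ?S = "cmap c ` (cdom c \<inter> U)" and ?F = "\<lambda>x. a (cinv c x)"
  have oS: "open ?S" "cmap c p \<in> ?S"
    using open_chart_image[OF sm cc(1) U] cc(2) p by blast+
  have vd: "vdiff M a q X = frechet_derivative ?F (at (cmap c q)) (X c)"
    if "q \<in> U" "c \<in> charts_at M q" "X \<in> tangent_space M q" for q X
    by (rule vdiff_chart[OF sm U that(1) sa that(2,3)])
  have smF: "smooth_on ?S ?F" by (rule smooth_funD[OF sa cc(1)])
  have "inj (frechet_derivative ?F (at (cmap c p)))"
  proof -
    have "v = 0" if v: "frechet_derivative ?F (at (cmap c p)) v = 0" for v
    proof -
      obtain X where X: "X \<in> tangent_space M p" "X c = v" using tangent_space_exists[OF sm c] .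
      then have "X = tzero" using inj vd[OF p c] v by simp
      then show ?thesis using X(2) by (simp add: tzero_def)
    qed
    then show ?thesis
      using linear_injective_0[OF has_derivative_linear[OF smooth_on_imp_has_derivative[OF smF oS(2)]]] by blast
  qed
  then obtain T where T: "open T" "cmap c p \<in> T" "T \<subseteq> ?S" "\<And>x. x \<in> T \<Longrightarrow> inj (frechet_derivative ?F (at x))"
    using open_inj_derivative[OF oS smF] by blast
  define V where "V = {q \<in> cdom c. cmap c q \<in> T} \<inter> U"
  have V: "openin (mtop M) V"
    unfolding V_def by (intro openin_Int openin_chart_preimage[OF sm cc(1) T(1)] U)
  have VU: "V \<subseteq> U" by (simp add: V_def)
  have "hypersurface M V a b"
    unfolding hypersurface_def
  proof (intro conjI ballI V smooth_fun_subset[OF sa VU] smooth_fun_subset[OF sb VU])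
    fix q assume q: "q \<in> V"
    then have qU: "q \<in> U" and cq: "c \<in> charts_at M q" and qT: "cmap c q \<in> T"
      using cc(1) by (auto simp: V_def charts_at_def)
    show "norm (a q) = 1" "norm (b q) = 1" "b q \<bullet> a q = 0"
      using l qU unfolding legendre_pair_def by blast+
    show "b q \<bullet> vdiff M a q X = 0" if "X \<in> tangent_space M q" for X
      using l qU that unfolding legendre_pair_def by blast
    show "inj_on (vdiff M a q) (tangent_space M q)"
    proof (rule inj_onI)
      fix X Y assume XY: "X \<in> tangent_space M q" "Y \<in> tangent_space M q" "vdiff M a q X = vdiff M a q Y"
      have "X c = Y c"
        using XY(3) unfolding vd[OF qU cq XY(1)] vd[OF qU cq XY(2)] by (rule injD[OF T(4)[OF qT]])
      then show "X = Y" using tangent_space_determined[OF XY(1,2) cq] by blast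
    qed
  qed
  moreover have "p \<in> V" using p cc(2) T(2) by (simp add: V_def)
  ultimately show thesis using that VU by blast
qed

text \<open>
  The directions that a rotation of the pair makes singular are mutually orthogonal for different
  rotation angles, hence only finitely many angles in \<open>[0, \<pi>)\<close> are excluded.
\<close>

lemma finite_singular_rotations:
  fixes A B :: "'v \<Rightarrow> 'w::euclidean_space"
  assumes joint: "\<And>X. X \<in> T \<Longrightarrow> A X = 0 \<Longrightarrow> B X = 0 \<Longrightarrow> X = z"
    and sym: "\<And>X Y. X \<in> T \<Longrightarrow> Y \<in> T \<Longrightarrow> B X \<bullet> A Y = B Y \<bullet> A X"
  shows "finite {t \<in> {0..<pi}. \<exists>X\<in>T. X \<noteq> z \<and> cos t *\<^sub>R A X = sin t *\<^sub>R B X}" (is "finite ?E")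
proof -
  have "\<forall>t\<in>?E. \<exists>X. X \<in> T \<and> X \<noteq> z \<and> cos t *\<^sub>R A X = sin t *\<^sub>R B X" by blast
  from bchoice[OF this]
  obtain X where X: "\<And>t. t \<in> ?E \<Longrightarrow> X t \<in> T \<and> X t \<noteq> z \<and> cos t *\<^sub>R A (X t) = sin t *\<^sub>R B (X t)"
    by (elim exE) (rule that, erule bspec)
  \<comment> \<open>\<open>w t\<close> is the common direction of \<open>A (X t)\<close> and \<open>B (X t)\<close>.\<close>
  define w where "w t = sin t *\<^sub>R A (X t) + cos t *\<^sub>R B (X t)" for t
  have sc: "sin t * sin t + cos t * cos t = (1::real)" for t
    using sin_cos_squared_add[of t] by (simp add: power2_eq_square)
  have Aw: "A (X t) = sin t *\<^sub>R w t" and Bw: "B (X t) = cos t *\<^sub>R w t" if t: "t \<in> ?E" for t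
  proof -
    have e: "cos t *\<^sub>R A (X t) = sin t *\<^sub>R B (X t)" using X[OF t] by blast
    have "sin t *\<^sub>R w t = (sin t * sin t) *\<^sub>R A (X t) + cos t *\<^sub>R (sin t *\<^sub>R B (X t))"
      by (simp add: w_def scaleR_add_right mult.commute)
    also have "\<dots> = (sin t * sin t + cos t * cos t) *\<^sub>R A (X t)"
      unfolding e[symmetric] by (simp add: scaleR_add_left)
    finally show "A (X t) = sin t *\<^sub>R w t" by (simp add: sc)
    have "cos t *\<^sub>R w t = sin t *\<^sub>R (cos t *\<^sub>R A (X t)) + (cos t * cos t) *\<^sub>R B (X t)"
      by (simp add: w_def scaleR_add_right mult.commute)
    also have "\<dots> = (sin t * sin t + cos t * cos t) *\<^sub>R B (X t)"
      unfolding e by (simp add: scaleR_add_left)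
    finally show "B (X t) = cos t *\<^sub>R w t" by (simp add: sc)
  qed
  have w0: "w t \<noteq> 0" if t: "t \<in> ?E" for t
  proof
    assume "w t = 0"
    then have "X t = z" using joint[of "X t"] X[OF t] Aw[OF t] Bw[OF t] by simp
    then show False using X[OF t] by blast
  qed
  have orth: "w s \<bullet> w t = 0" if s: "s \<in> ?E" and t: "t \<in> ?E" and ne: "s \<noteq> t" for s t
  proof -
    have "B (X s) \<bullet> A (X t) = B (X t) \<bullet> A (X s)" using sym X[OF s] X[OF t] by blast
    then have "(cos s * sin t - cos t * sin s) * (w s \<bullet> w t) = 0"
      unfolding Aw[OF s] Bw[OF s] Aw[OF t] Bw[OF t] by (simp add: inner_commute algebra_simps)
    moreover have "cos s * sin t - cos t * sin s = sin (t - s)" by (simp add: sin_diff mult.commute)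
    moreover have "sin (t - s) \<noteq> 0"
    proof (cases "s < t")
      case True
      then have "sin (t - s) > 0" using s t by (intro sin_gt_zero) auto
      then show ?thesis by simp
    next
      case False
      then have "sin (s - t) > 0" using s t ne by (intro sin_gt_zero) auto
      then show ?thesis using sin_minus[of "s - t"] by simp
    qed
    ultimately show ?thesis by simp
  qed
  have "inj_on w ?E"
  proof (rule inj_onI)
    fix s t assume st: "s \<in> ?E" "t \<in> ?E" "w s = w t"
    show "s = t"
    proof (rule ccontr)
      assume "s \<noteq> t"
      then have "w s \<bullet> w s = 0" using orth[OF st(1,2)] st(3) by simp
      then show False using w0[OF st(1)] by simp
    qed
  qed
  moreover have "finite (w ` ?E)"
  proof (rule independent_imp_finite[OF pairwise_orthogonal_independent])
    show "pairwise orthogonal (w ` ?E)"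
      unfolding pairwise_def orthogonal_def
    proof (intro ballI impI)
      fix x y assume "x \<in> w ` ?E" "y \<in> w ` ?E" "x \<noteq> y"
      then obtain s t where "x = w s" "s \<in> ?E" "y = w t" "t \<in> ?E" "s \<noteq> t" by (elim imageE) blast
      then show "x \<bullet> y = 0" using orth[of s t] by blast
    qed
    show "0 \<notin> w ` ?E"
    proof
      assume "0 \<in> w ` ?E"
      then obtain t where t: "0 = w t" "t \<in> ?E" by (rule imageE)
      show False using w0[OF t(2)] t(1)[symmetric] by (rule notE)
    qed
  qed
  ultimately show ?thesis by (rule finite_imageD[rotated])
qed

lemma hypersurface_exists:
  fixes M :: "('a, real ^ 'n::finite) manifold" and f :: "'a \<Rightarrow> 'n option cp"
  assumes sm: "smooth_manifold M" and lag: "lagrangian_immersion M f" and p: "p \<in> carrier M"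
  obtains U a b where "p \<in> U" "hypersurface M U a b" "\<And>q. q \<in> U \<Longrightarrow> f q = gauss_map a b q"
proof -
  obtain U a b where pU: "p \<in> U" and l: "legendre_pair M f U a b"
    using legendre_pair_exists[OF sm lag p] .
  have U: "openin (mtop M) U" and sa: "smooth_fun M U a" and sb: "smooth_fun M U b"
    using l by (auto simp: legendre_pair_def)
  let ?E = "{t \<in> {0..<pi}. \<exists>X\<in>tangent_space M p. X \<noteq> tzero \<and> cos t *\<^sub>R vdiff M a p X = sin t *\<^sub>R vdiff M b p X}"
  have "finite ?E"
    by (rule finite_singular_rotations) (use l pU in \<open>unfold legendre_pair_def, blast\<close>)+
  moreover have "infinite {0..<pi}" by (simp add: infinite_Ico)
  ultimately have "{0..<pi} - ?E \<noteq> {}"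
    by (intro infinite_imp_nonempty Diff_infinite_finite)
  then obtain t where t: "t \<in> {0..<pi}" "t \<notin> ?E" by blast
  let ?a = "\<lambda>q. cos t *\<^sub>R a q + (- sin t) *\<^sub>R b q" and ?b = "\<lambda>q. sin t *\<^sub>R a q + cos t *\<^sub>R b q"
  have l': "legendre_pair M f U ?a ?b"
    by (rule legendre_pair_rotate[OF sm l]) simp
  have inj: "X = tzero" if X: "X \<in> tangent_space M p" "vdiff M ?a p X = 0" for X
  proof -
    have "cos t *\<^sub>R vdiff M a p X = sin t *\<^sub>R vdiff M b p X"
      using X(2) unfolding vdiff_linear_combination(2)[OF sm U sa sb pU] by simp
    then show ?thesis using t X(1) by blast
  qed
  obtain V where V: "p \<in> V" "V \<subseteq> U" "hypersurface M V ?a ?b"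
    using hypersurface_of_legendre_pair[OF sm l' pU inj] by blast
  show thesis
  proof (rule that[OF V(1,3)])
    fix q assume "q \<in> V"
    then show "f q = gauss_map ?a ?b q" using V(2) l' unfolding legendre_pair_def by blast
  qed
qed

section \<open>Different hypersurfaces with the same Gauss map\<close>

lemma principal_curvatures_iff:
  fixes M :: "('a, real ^ 'n::finite) manifold"
  assumes "smooth_manifold M" "hypersurface M U a b" "p \<in> U"
  shows "\<kappa> \<in> principal_curvatures M a b p \<longleftrightarrow>
    (\<exists>e\<in>tangent_space M p. e \<noteq> tzero \<and> vdiff M b p e = - \<kappa> *\<^sub>R vdiff M a p e)"
  unfolding principal_curvatures_def using shape_op_eq_iff[OF assms] by auto

text \<open>
  A maximum of \<open>\<langle>Hx, Fx\<rangle>\<close> under the constraint \<open>|Fx| = 1\<close> is attained at an eigenvector, because the form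
  \<open>m \<langle>Fx, Fy\<rangle> - \<langle>Hx, Fy\<rangle>\<close> is then positive semidefinite and degenerate there.
\<close>

lemma maximal_eigenvector:
  fixes F H :: "'a::euclidean_space \<Rightarrow> 'b::euclidean_space"
  assumes F: "linear F" "inj F" and H: "linear H" "range H \<subseteq> range F"
    and sym: "\<And>x y. H x \<bullet> F y = H y \<bullet> F x"
  obtains m x0 where "x0 \<noteq> 0" "H x0 = m *\<^sub>R F x0" "\<And>x. H x \<bullet> F x \<le> m * (F x \<bullet> F x)"
proof -
  let ?K = "{x. F x \<bullet> F x = 1}"
  note bl = linear_conv_bounded_linear[THEN iffD1, OF F(1)] linear_conv_bounded_linear[THEN iffD1, OF H(1)]
  have cont: "continuous_on S F" "continuous_on S H" for S
    using bl by (simp_all add: linear_continuous_on)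
  have F0: "F x = 0 \<longleftrightarrow> x = 0" for x
    using linear_injective_0[OF F(1)] F linear_0[OF F(1)] by metis
  obtain B where B: "B > 0" "\<And>x. B * norm x \<le> norm (F x)"
    using linear_inj_bounded_below_pos[OF F] by blast
  have "closed ?K" by (intro closed_Collect_eq continuous_intros cont)
  moreover have "bounded ?K"
    unfolding bounded_iff
  proof (intro exI ballI)
    fix x assume "x \<in> ?K"
    then have "norm (F x) = 1" by (simp add: norm_eq_1)
    then show "norm x \<le> 1 / B" using B(1) B(2)[of x] by (simp add: field_simps)
  qed
  ultimately have "compact ?K" by (simp add: compact_eq_bounded_closed)
  moreover have "?K \<noteq> {}"
  proof -
    obtain b :: 'a where "b \<in> Basis" using nonempty_Basis by blast
    then have "F b \<noteq> 0" using F0 nonzero_Basis by blast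
    then have "F ((1 / norm (F b)) *\<^sub>R b) \<bullet> F ((1 / norm (F b)) *\<^sub>R b) = 1"
      by (simp add: linear_cmul[OF F(1)] power2_norm_eq_inner[symmetric] power2_eq_square)
    then show ?thesis by blast
  qed
  ultimately obtain x0 where x0: "x0 \<in> ?K" "\<And>x. x \<in> ?K \<Longrightarrow> H x \<bullet> F x \<le> H x0 \<bullet> F x0"
    using continuous_attains_sup[of ?K "\<lambda>x. H x \<bullet> F x"] by (auto intro!: continuous_intros cont)
  define m where "m = H x0 \<bullet> F x0"
  have max: "H x \<bullet> F x \<le> m * (F x \<bullet> F x)" for x
  proof (cases "x = 0")
    case False
    define r where "r = norm (F x)"
    have r: "r > 0" using False F0 by (simp add: r_def)
    have "(1 / r) *\<^sub>R x \<in> ?K"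
      using r by (simp add: linear_cmul[OF F(1)] r_def power2_norm_eq_inner[symmetric] power2_eq_square)
    then have "H ((1 / r) *\<^sub>R x) \<bullet> F ((1 / r) *\<^sub>R x) \<le> m" using x0(2) by (simp add: m_def)
    then have "(H x \<bullet> F x) / (r * r) \<le> m" by (simp add: linear_cmul[OF F(1)] linear_cmul[OF H(1)])
    then show ?thesis
      using r by (simp add: field_simps r_def power2_norm_eq_inner[symmetric] power2_eq_square)
  qed (simp add: linear_0[OF F(1)])
  have deg: "(m *\<^sub>R F x0 - H x0) \<bullet> F y = 0" for y
  proof (rule ccontr)
    define u where "u = (m *\<^sub>R F x0 - H x0) \<bullet> F y"
    define v where "v = m * (F y \<bullet> F y) - H y \<bullet> F y"
    assume "(m *\<^sub>R F x0 - H x0) \<bullet> F y \<noteq> 0"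
    then have u0: "u \<noteq> 0" by (simp add: u_def)
    have v0: "v \<ge> 0" using max[of y] by (simp add: v_def)
    have q: "0 \<le> 2 * s * u + s * s * v" for s
    proof -
      have "0 \<le> m * (F (x0 + s *\<^sub>R y) \<bullet> F (x0 + s *\<^sub>R y)) - H (x0 + s *\<^sub>R y) \<bullet> F (x0 + s *\<^sub>R y)"
        using max[of "x0 + s *\<^sub>R y"] by simp
      also have "\<dots> = (m * (F x0 \<bullet> F x0) - H x0 \<bullet> F x0) + 2 * s * u + s * s * v"
        using sym[of y x0]
        by (simp add: linear_add[OF F(1)] linear_add[OF H(1)] linear_cmul[OF F(1)] linear_cmul[OF H(1)]
            u_def v_def inner_add_left inner_add_right inner_diff_left algebra_simps)
          (simp add: inner_commute)
      also have "m * (F x0 \<bullet> F x0) - H x0 \<bullet> F x0 = 0" using x0(1) by (simp add: m_def)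
      finally show ?thesis by simp
    qed
    have "2 * (- u / w) * u + (- u / w) * (- u / w) * (w - 1) = - (u * u) * (w + 1) / (w * w)"
      if "w \<noteq> 0" for w :: real
      using that by (simp add: field_simps)
    from this[of "v + 1"] have "2 * (- u / (v + 1)) * u + (- u / (v + 1)) * (- u / (v + 1)) * v
        = - (u * u) * (v + 1 + 1) / ((v + 1) * (v + 1))"
      using v0 by simp
    also have "\<dots> < 0"
      using u0 v0 by (intro divide_neg_pos mult_neg_pos) (auto simp: zero_less_mult_iff linorder_neq_iff)
    finally show False using q[of "- u / (v + 1)"] by linarith
  qed
  obtain y where y: "F y = m *\<^sub>R F x0 - H x0"
  proof -
    obtain x1 where "H x0 = F x1" using H(2) by blast
    then have "F (m *\<^sub>R x0 - x1) = m *\<^sub>R F x0 - H x0"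
      by (simp add: linear_diff[OF F(1)] linear_cmul[OF F(1)])
    then show thesis using that by blast
  qed
  have "H x0 = m *\<^sub>R F x0" using deg[of y] unfolding y by simp
  moreover have "x0 \<noteq> 0" using x0(1) by (auto simp: linear_0[OF F(1)])
  ultimately show thesis using that max by blast
qed

text \<open>
  For \<open>\<tau> = 1\<close> the number \<open>m\<close> is the largest principal curvature, for \<open>\<tau> = - 1\<close> it is minus the smallest one.
\<close>

lemma extremal_curvature:
  fixes M :: "('a, real ^ 'n::finite) manifold"
  assumes sm: "smooth_manifold M" and h: "hypersurface M U a b" and p: "p \<in> U" and \<tau>: "\<tau> = 1 \<or> \<tau> = (-1::real)"
  obtains m e where "e \<in> tangent_space M p" "e \<noteq> tzero" "vdiff M b p e = - (\<tau> * m) *\<^sub>R vdiff M a p e"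
    "\<And>X. X \<in> tangent_space M p \<Longrightarrow>
      - \<tau> * (vdiff M b p X \<bullet> vdiff M a p X) \<le> m * (vdiff M a p X \<bullet> vdiff M a p X)"
proof -
  note hf = hypersurface_facts[OF sm h p]
  let ?F = "vderiv M a p" and ?H = "\<lambda>v. - \<tau> *\<^sub>R vderiv M b p v"
  have linF: "linear ?F" and linb: "linear (vderiv M b p)"
    by (rule linear_vderiv[OF sm hf(1) p hf(3)], rule linear_vderiv[OF sm hf(1) p hf(4)])
  have linH: "linear ?H" using linb by (intro linear_compose_scale_right)
  have injF: "inj ?F" using hf(8) inj_on_vdiff_iff[OF sm hf(2)] by blast
  have rep: "\<exists>X\<in>tangent_space M p. vdiff M a p X = vderiv M a p v \<and> vdiff M b p X = vderiv M b p v \<and> X (pchart M p) = v" for v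
  proof -
    obtain X where "X \<in> tangent_space M p" "X (pchart M p) = v"
      using tangent_space_exists[OF sm pchart_in_charts_at[OF sm hf(2)]] .
    then show ?thesis by (auto simp: vdiff_eq_vderiv)
  qed
  have ran: "range ?H \<subseteq> range ?F"
  proof
    fix y assume "y \<in> range ?H"
    then obtain v where "y = - \<tau> *\<^sub>R vderiv M b p v" by blast
    moreover obtain X where "X \<in> tangent_space M p" "vdiff M b p X = vderiv M b p v" using rep by blast
    ultimately have "y \<in> {y. a p \<bullet> y = 0 \<and> b p \<bullet> y = 0}" using hf(11,12)[of X] by simp
    then show "y \<in> range ?F" unfolding hf(13)[symmetric] vdiff_image[OF sm hf(2)] .
  qed
  have sym: "?H x \<bullet> ?F y = ?H y \<bullet> ?F x" for x y
  proof -
    obtain X Y where XY: "X \<in> tangent_space M p" "Y \<in> tangent_space M p" "vdiff M a p X = ?F x" "vdiff M a p Y = ?F y"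
      "vdiff M b p X = vderiv M b p x" "vdiff M b p Y = vderiv M b p y"
      using rep[of x] rep[of y] by blast
    then show ?thesis using second_fundamental_form_symmetric[OF sm h p XY(1,2)] by simp
  qed
  obtain m x0 where m: "x0 \<noteq> 0" "?H x0 = m *\<^sub>R ?F x0" "\<And>x. ?H x \<bullet> ?F x \<le> m * (?F x \<bullet> ?F x)"
    using maximal_eigenvector[OF linF injF linH ran sym] by metis
  obtain e where e: "e \<in> tangent_space M p" "vdiff M a p e = ?F x0" "vdiff M b p e = vderiv M b p x0" "e (pchart M p) = x0"
    using rep[of x0] by blast
  have "e \<noteq> tzero" using e(4) m(1) by (auto simp: tzero_def)
  moreover have "vdiff M b p e = - (\<tau> * m) *\<^sub>R vdiff M a p e"
    unfolding e(2,3) using m(2) \<tau> by (auto simp: minus_equation_iff[of "vderiv M b p x0"])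
  moreover have "- \<tau> * (vdiff M b p X \<bullet> vdiff M a p X) \<le> m * (vdiff M a p X \<bullet> vdiff M a p X)"
    if "X \<in> tangent_space M p" for X
    using m(3)[of "X (pchart M p)"] by (simp add: vdiff_eq_vderiv)
  ultimately show thesis using that e(1) by blast
qed

text \<open>
  Rotating the pair \<open>(a, b)\<close> by the angle \<open>t\<close> moves a principal curvature \<open>cot \<theta>\<close> to \<open>cot (\<theta> + t)\<close>. Here \<open>t\<close> is
  negative and such that the largest principal curvature \<open>m\<close> becomes a number \<open>N\<close> larger than the absolute
  values of all principal curvatures. As \<open>m\<close> is the largest one, none of them passes through infinity on
  the way, so that the rotated map is still an immersion.
\<close>

lemma another_hypersurface:
  fixes M :: "('a, real ^ 'n::finite) manifold" and f :: "'a \<Rightarrow> 'n option cp"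
  assumes sm: "smooth_manifold M" and h: "hypersurface M U a b" and p: "p \<in> U"
    and f: "\<And>q. q \<in> U \<Longrightarrow> f q = gauss_map a b q"
  obtains V a' b' where "p \<in> V" "V \<subseteq> U" "hypersurface M V a' b'" "\<And>q. q \<in> V \<Longrightarrow> f q = gauss_map a' b' q"
    "a p \<noteq> a' p" "principal_curvatures M a b p \<noteq> principal_curvatures M a' b' p"
    "principal_curvatures M a b p \<noteq> uminus ` principal_curvatures M a' b' p"
proof -
  note hf = hypersurface_facts[OF sm h p]
  have ab: "a p \<bullet> a p = 1" "b p \<bullet> b p = 1" "a p \<bullet> b p = 0"
    using hf(5-7) by (simp_all add: norm_eq_1 inner_commute)
  obtain m e where e: "e \<in> tangent_space M p" "e \<noteq> tzero" "vdiff M b p e = - (1 * m) *\<^sub>R vdiff M a p e"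
    and m: "\<And>X. X \<in> tangent_space M p \<Longrightarrow>
      - 1 * (vdiff M b p X \<bullet> vdiff M a p X) \<le> m * (vdiff M a p X \<bullet> vdiff M a p X)"
    using extremal_curvature[OF sm h p, of 1] by metis
  obtain m' where m': "\<And>X. X \<in> tangent_space M p \<Longrightarrow>
      - (- 1) * (vdiff M b p X \<bullet> vdiff M a p X) \<le> m' * (vdiff M a p X \<bullet> vdiff M a p X)"
    using extremal_curvature[OF sm h p, of "-1"] by metis
  have pos: "vdiff M a p X \<bullet> vdiff M a p X > 0" if "X \<in> tangent_space M p" "X \<noteq> tzero" for X
    using vdiff_nonzero[OF sm hf(1) p hf(3,8) that] by simp
  have bound: "\<kappa> \<le> m" "- m' \<le> \<kappa>" if "\<kappa> \<in> principal_curvatures M a b p" for \<kappa>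
  proof -
    obtain X where X: "X \<in> tangent_space M p" "X \<noteq> tzero" "vdiff M b p X = - \<kappa> *\<^sub>R vdiff M a p X"
      using \<open>\<kappa> \<in> principal_curvatures M a b p\<close> principal_curvatures_iff[OF sm h p] by blast
    have "\<kappa> * (vdiff M a p X \<bullet> vdiff M a p X) \<le> m * (vdiff M a p X \<bullet> vdiff M a p X)"
      "- \<kappa> * (vdiff M a p X \<bullet> vdiff M a p X) \<le> m' * (vdiff M a p X \<bullet> vdiff M a p X)"
      using m[OF X(1)] m'[OF X(1)] X(3) by simp_all
    then have "\<kappa> \<le> m" "- \<kappa> \<le> m'" using mult_right_le_imp_le[OF _ pos[OF X(1,2)]] by blast+
    then show "\<kappa> \<le> m" "- m' \<le> \<kappa>" by simp_all
  qed
  define N where "N = \<bar>m\<bar> + \<bar>m'\<bar> + 1"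
  \<comment> \<open>A solution of \<open>(m cos t - sin t) / (cos t + m sin t) = N\<close>, where \<open>c = cos t\<close> and \<open>s = sin t\<close>.\<close>
  define R where "R = sqrt ((1 + N * m)\<^sup>2 + (m - N)\<^sup>2)"
  define c where "c = (1 + N * m) / R"
  define s where "s = (m - N) / R"
  have mN: "m - N < 0" unfolding N_def by linarith
  have Rp: "(1 + N * m)\<^sup>2 + (m - N)\<^sup>2 > 0" using mN by (simp add: add_nonneg_pos)
  then have R: "R > 0" "R * R = (1 + N * m)\<^sup>2 + (m - N)\<^sup>2" by (simp_all add: R_def)
  have cs: "c\<^sup>2 + s\<^sup>2 = 1"
    unfolding c_def s_def power_divide add_divide_distrib[symmetric] R(2)[symmetric]
    using R(1) by (simp add: power2_eq_square)
  have s0: "s \<noteq> 0" using mN R(1) by (simp add: s_def)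
  let ?a = "\<lambda>q. c *\<^sub>R a q + (- s) *\<^sub>R b q" and ?b = "\<lambda>q. s *\<^sub>R a q + c *\<^sub>R b q"
  have l: "legendre_pair M f U ?a ?b"
    by (rule legendre_pair_rotate[OF sm legendre_pair_of_hypersurface[OF sm h f] cs])
  note lc = vdiff_linear_combination(2)[OF sm hf(1,3,4) p]
  have inj: "X = tzero" if X: "X \<in> tangent_space M p" "vdiff M ?a p X = 0" for X
  proof (rule ccontr)
    assume "X \<noteq> tzero"
    then have q: "vdiff M a p X \<bullet> vdiff M a p X > 0" by (rule pos[OF X(1)])
    have "c *\<^sub>R vdiff M a p X = s *\<^sub>R vdiff M b p X" using X(2) unfolding lc by simp
    then have "c * (vdiff M a p X \<bullet> vdiff M a p X) = s * (vdiff M b p X \<bullet> vdiff M a p X)"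
      by (metis inner_scaleR_left)
    then have "(1 + N * m) * (vdiff M a p X \<bullet> vdiff M a p X) = (m - N) * (vdiff M b p X \<bullet> vdiff M a p X)"
      using R(1) by (simp add: c_def s_def)
    also have "\<dots> = (N - m) * (- 1 * (vdiff M b p X \<bullet> vdiff M a p X))" by (simp add: algebra_simps)
    also have "\<dots> \<le> (N - m) * (m * (vdiff M a p X \<bullet> vdiff M a p X))"
      by (rule mult_left_mono[OF m[OF X(1)]]) (use mN in simp)
    finally have "(1 + m * m) * (vdiff M a p X \<bullet> vdiff M a p X) \<le> 0" by (simp add: algebra_simps)
    moreover have "1 + m * m > 0" by (simp add: add_pos_nonneg)
    ultimately show False using q by (simp add: mult_le_0_iff)
  qed
  obtain V where V: "p \<in> V" "V \<subseteq> U" "hypersurface M V ?a ?b"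
    using hypersurface_of_legendre_pair[OF sm l p inj] by blast
  have NS: "N \<in> principal_curvatures M ?a ?b p"
    unfolding principal_curvatures_iff[OF sm V(3,1)]
  proof (intro bexI conjI)
    show "e \<noteq> tzero" "e \<in> tangent_space M p" by (fact e)+
    have "s - c * m = - N * (c + s * m)"
      using R(1) by (simp add: c_def s_def field_simps)
    then have "(s - c * m) *\<^sub>R vdiff M a p e = (- N * (c + s * m)) *\<^sub>R vdiff M a p e" by simp
    then show "vdiff M ?b p e = - N *\<^sub>R vdiff M ?a p e"
      unfolding lc e(3) by (simp add: algebra_simps)
  qed
  have "N \<notin> principal_curvatures M a b p" "- N \<notin> principal_curvatures M a b p"
    using bound[of N] bound[of "- N"] unfolding N_def by linarith+
  then have "principal_curvatures M a b p \<noteq> principal_curvatures M ?a ?b p"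
    "principal_curvatures M a b p \<noteq> uminus ` principal_curvatures M ?a ?b p"
    using NS by blast+
  moreover have "a p \<noteq> ?a p"
  proof
    assume "a p = ?a p"
    then have "b p \<bullet> a p = b p \<bullet> ?a p" by simp
    then show False using ab s0 by (simp add: inner_commute inner_diff_right)
  qed
  moreover have "f q = gauss_map ?a ?b q" if "q \<in> V" for q
    using l V(2) that unfolding legendre_pair_def by blast
  ultimately show thesis using that[OF V] by blast
qed

lemma hypersurface_subset:
  assumes "hypersurface M U a b" "openin (mtop M) V" "V \<subseteq> U"
  shows "hypersurface M V a b"
  using assms smooth_fun_subset unfolding hypersurface_def by blast

section \<open>Angle functions for an arbitrary shape operator\<close>

lemma cis_arctan_quotient:
  assumes "norm d = 1" "Re d > 0"
  shows "cis (arctan (Im d / Re d)) = d"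
proof -
  let ?t = "Im d / Re d"
  have "(Re d)\<^sup>2 + (Im d)\<^sup>2 = 1" using assms(1) by (simp add: cmod_def)
  then have "1 + ?t\<^sup>2 = (1 / Re d)\<^sup>2"
    using assms(2) by (simp add: power_divide field_simps)
  then have "sqrt (1 + ?t\<^sup>2) = 1 / Re d" using assms(2) by simp
  then show ?thesis
    using assms(2) by (simp add: complex_eq_iff cos_arctan sin_arctan)
qed

text \<open>
  Along the image of \<open>[a + ib]\<close> a unit normal field is the projection of \<open>c cconj (a + ib) / \<surd>2\<close> with a smooth
  function \<open>c\<close> of modulus one. A smooth local argument \<open>\<psi>\<close> of \<open>c\<close> is obtained from the arctangent of the slope of
  \<open>c / c(p)\<close>, which has positive real part near \<open>p\<close>. The field \<open>\<xi>\<close> around \<open>f(p)\<close> provides smoothness, but the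
  operator at another point is defined by another extension of \<open>\<zeta>\<close>; both have the same value there.
\<close>

lemma shape_operator_along_gauss_map:
  fixes M :: "('a, real ^ 'n::finite) manifold" and f :: "'a \<Rightarrow> 'n option cp"
  assumes sm: "smooth_manifold M" and h: "hypersurface M U a b" and f: "\<And>q. q \<in> U \<Longrightarrow> f q = gauss_map a b q"
    and DA: "(D, A) \<in> shape_operators" and fD: "f ` U \<subseteq> D" and p: "p \<in> U"
  obtains V \<psi> where "openin (mtop M) V" "p \<in> V" "V \<subseteq> U" "smooth_fun M V (\<psi> :: 'a \<Rightarrow> real)"
    "\<And>x v. x \<in> V \<Longrightarrow> v \<in> qhor (glift a b x) \<Longrightarrow>
      A (f x) (dhopf (glift a b x) v) = - dhopf (glift a b x) (cis (\<psi> x) *s cconj v)"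
proof -
  note hf = hypersurface_facts[OF sm h p] and gf = glift_facts[OF sm h]
  let ?g = "glift a b"
  have fg: "f x = cline (?g x)" if "x \<in> U" for x using f[OF that] by (simp add: gauss_map_glift)
  have sg: "smooth_fun M U ?g" by (rule smooth_fun_glift[OF sm hf(1,3,4)])
  obtain \<zeta> where \<zeta>: "\<And>q. q \<in> D \<Longrightarrow> \<exists>W \<xi>. q \<in> W \<and> unit_normal_field W \<xi> \<and> (\<forall>x\<in>D \<inter> W. \<xi> x = \<zeta> x) \<and>
        (\<forall>X\<in>quadric_tangent q. A q X = - tangential q (levi_civita CP gFS q X \<xi>))"
    using DA unfolding shape_operators_def by blast
  have "f p \<in> D" using fD p by blast
  from \<zeta>[OF this] obtain W \<xi> where W: "f p \<in> W" "unit_normal_field W \<xi>" "\<And>x. x \<in> D \<Longrightarrow> x \<in> W \<Longrightarrow> \<xi> x = \<zeta> x"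
    by blast
  have oW: "openin (mtop CP) W" and sW: "smooth_field CP W \<xi>"
    using W(2) by (auto simp: unit_normal_field_def)
  obtain \<sigma> :: "'n option option \<Rightarrow> 'n option option" where s: "bij \<sigma>" "?g p $ \<sigma> None \<noteq> 0"
    using exists_affine_chart[OF gf(2)[OF p]] .
  let ?Y = "\<lambda>x. \<xi> (cinv (affine_chart \<sigma>) x) (affine_chart \<sigma>)"
  let ?O = "cmap (affine_chart \<sigma>) ` (cdom (affine_chart \<sigma>) \<inter> W)"
  have sY: "smooth_on ?O ?Y"
    using sW s(1) unfolding smooth_field_def charts_CP by blast
  have oO: "open ?O"
  proof -
    have "continuous_on UNIV (alift \<sigma> :: _ \<Rightarrow> complex ^ 'n option option)"
      using has_derivative_continuous[OF has_derivative_alift[OF s(1)]] by (simp add: continuous_at_imp_continuous_on)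
    from open_vimage[OF open_cone[OF oW] this]
    show ?thesis unfolding cmap_image_affine_chart[OF s(1)] using s(1) by (simp add: vimage_def)
  qed
  define V0 where "V0 = {x \<in> U. ?g x \<in> {z. z \<noteq> 0 \<and> cline z \<in> W} \<inter> {z. z $ \<sigma> None \<noteq> 0}}"
  have "open {z :: complex ^ 'n option option. z $ \<sigma> None \<noteq> 0}"
    by (intro open_Collect_neq continuous_intros)
  then have V0: "openin (mtop M) V0"
    unfolding V0_def by (intro openin_smooth_preimage[OF sm hf(1) sg] open_Int open_cone[OF oW])
  have pV0: "p \<in> V0" using p W(1) s(2) gf(2)[OF p] fg[OF p] by (simp add: V0_def)
  have inV0: "x \<in> U" "cline (?g x) \<in> W" "?g x $ \<sigma> None \<noteq> 0" if "x \<in> V0" for x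
    using that by (auto simp: V0_def)
  have V0U: "V0 \<subseteq> U" by (auto simp: V0_def)
  define c where "c x = ncoeff \<sigma> (?g x) (?Y (acoord \<sigma> (?g x)))" for x
  have c: "norm (c x) = 1" "\<xi> (cline (?g x)) = dhopf (?g x) (c x *s cconj (?g x))" if x: "x \<in> V0" for x
  proof -
    note xU = inV0(1)[OF x] and xW = inV0(2)[OF x] and xs = inV0(3)[OF x]
    obtain d where d: "norm d = 1" "\<xi> (cline (?g x)) = dhopf (?g x) (d *s cconj (?g x))"
      using unit_normal_field_eq[OF W(2) gf(2,3)[OF xU] xW] .
    have "?Y (acoord \<sigma> (?g x)) = \<xi> (cline (?g x)) (affine_chart \<sigma>)"
      using s xs by (simp add: cinv_affine_chart alift_acoord cline_scale)
    then have "c x = d"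
      unfolding c_def d(2) using ncoeff_dhopf[OF gf(2,3)[OF xU] s(1) xs] by metis
    then show "norm (c x) = 1" "\<xi> (cline (?g x)) = dhopf (?g x) (c x *s cconj (?g x))" using d by simp_all
  qed
  have Aop: "A (f x) (dhopf (?g x) v) = - dhopf (?g x) (c x *s cconj v)"
    if x: "x \<in> V0" and v: "v \<in> qhor (?g x)" for x v
  proof -
    note xU = inV0(1)[OF x]
    have xD: "f x \<in> D" using fD xU by blast
    from \<zeta>[OF this] obtain W' \<xi>' where W': "f x \<in> W'" "unit_normal_field W' \<xi>'" "\<And>y. y \<in> D \<Longrightarrow> y \<in> W' \<Longrightarrow> \<xi>' y = \<zeta> y"
      "\<And>X. X \<in> quadric_tangent (f x) \<Longrightarrow> A (f x) X = - tangential (f x) (levi_civita CP gFS (f x) X \<xi>')"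
      by blast
    have "\<xi>' (f x) = \<xi> (f x)" using W'(3)[OF xD W'(1)] W(3)[OF xD] inV0(2)[OF x] fg[OF xU] by simp
    then have \<xi>': "\<xi>' (cline (?g x)) = dhopf (?g x) (c x *s cconj (?g x))"
      using c(2)[OF x] fg[OF xU] by simp
    have "dhopf (?g x) v \<in> quadric_tangent (f x)"
      unfolding fg[OF xU] by (rule dhopf_in_quadric_tangent[OF gf(2,3)[OF xU] v])
    from W'(4)[OF this] show ?thesis
      using shape_operator_formula[OF W'(2) gf(1,3)[OF xU] _ \<xi>' v] W'(1) unfolding fg[OF xU] by simp
  qed
  have sc: "smooth_fun M V0 c"
  proof (rule smooth_funI[OF sm V0])
    fix d assume d: "d \<in> charts M" "open (cmap d ` (cdom d \<inter> V0))"
    let ?S = "cmap d ` (cdom d \<inter> V0)" and ?h = "\<lambda>x. ?g (cinv d x)"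
    have inS: "cinv d x \<in> V0" if "x \<in> ?S" for x
      using cinv_in_cdom[OF that _ chart_facts(3)[OF sm d(1)]] by blast
    have sh: "smooth_on ?S ?h" by (rule smooth_funD[OF smooth_fun_subset[OF sg V0U] d(1)])
    have sa: "smooth_on ?S (\<lambda>x. acoord \<sigma> (?h x))"
      by (rule smooth_on_acoord[OF d(2) sh]) (use inS inV0(3) in blast)
    have "(\<lambda>x. acoord \<sigma> (?h x)) ` ?S \<subseteq> ?O"
    proof
      fix y assume "y \<in> (\<lambda>x. acoord \<sigma> (?h x)) ` ?S"
      then obtain x where x: "x \<in> ?S" "y = acoord \<sigma> (?h x)" by (rule imageE)
      show "y \<in> ?O"
        using inV0(2,3)[OF inS[OF x(1)]] s(1)
        by (simp add: x(2) cmap_image_affine_chart alift_acoord cline_scale)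
    qed
    then have "smooth_on ?S (\<lambda>x. ?Y (acoord \<sigma> (?h x)))"
      by (rule smooth_on_compose[OF d(2) oO sa sY])
    then show "smooth_on ?S (\<lambda>x. c (cinv d x))"
      unfolding c_def ncoeff_def
      by (intro smooth_on_divide smooth_on_mult smooth_on_sum smooth_on_vec_nth
          smooth_on_bilinear[OF _ bounded_bilinear_herm] sh d(2))
        (use gf(2) inV0(1) inS in auto)
  qed
  define d where "d x = c x * cnj (c p)" for x
  have sd: "smooth_fun M V0 d"
    unfolding d_def by (intro smooth_funI[OF sm V0] smooth_on_mult smooth_on_const smooth_funD[OF sc])
  define V where "V = {x \<in> V0. d x \<in> {z. Re z > 0}}"
  have V: "openin (mtop M) V"
    unfolding V_def by (rule openin_smooth_preimage[OF sm V0 sd open_halfspace_Re_gt])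
  have cp: "c p * cnj (c p) = 1" using c(1)[OF pV0] by (simp add: complex_norm_square[symmetric])
  have "d p = 1" unfolding d_def by (rule cp)
  then have pV: "p \<in> V" using pV0 by (simp add: V_def)
  have VV0: "V \<subseteq> V0" by (auto simp: V_def)
  define \<psi> where "\<psi> x = Arg (c p) + arctan (Im (d x) / Re (d x))" for x
  have s\<psi>: "smooth_fun M V \<psi>"
  proof (rule smooth_funI[OF sm V])
    fix k assume k: "k \<in> charts M" "open (cmap k ` (cdom k \<inter> V))"
    have "smooth_on (cmap k ` (cdom k \<inter> V)) (\<lambda>x. d (cinv k x))"
      by (rule smooth_funD[OF smooth_fun_subset[OF sd VV0] k(1)])
    moreover have "Re (d (cinv k x)) \<noteq> 0" if "x \<in> cmap k ` (cdom k \<inter> V)" for x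
      using cinv_in_cdom[OF that _ chart_facts(3)[OF sm k(1)]] by (auto simp: V_def)
    ultimately show "smooth_on (cmap k ` (cdom k \<inter> V)) (\<lambda>x. \<psi> (cinv k x))"
      unfolding \<psi>_def
      by (intro smooth_on_add smooth_on_const smooth_on_arctan smooth_on_divide
          smooth_on_bounded_linear[OF _ bounded_linear_Im] smooth_on_bounded_linear[OF _ bounded_linear_Re] k(2))
  qed
  have cis\<psi>: "cis (\<psi> x) = c x" if x: "x \<in> V" for x
  proof -
    have "norm (d x) = 1" using c(1)[OF pV0] c(1)[of x] x VV0 by (simp add: d_def norm_mult subset_iff)
    moreover have "Re (d x) > 0" using x by (simp add: V_def)
    ultimately have "cis (arctan (Im (d x) / Re (d x))) = d x" by (rule cis_arctan_quotient)
    moreover have "cis (Arg (c p)) = c p"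
      using c(1)[OF pV0] rcis_cmod_Arg[of "c p"] by (simp add: rcis_def)
    ultimately have "cis (\<psi> x) = c p * d x" by (simp add: \<psi>_def cis_mult[symmetric])
    also have "\<dots> = c x" using cp by (simp add: d_def mult_ac)
    finally show ?thesis .
  qed
  show thesis
  proof (rule that[OF V pV _ s\<psi>])
    show "V \<subseteq> U" using VV0 V0U by blast
    show "A (f x) (dhopf (?g x) v) = - dhopf (?g x) (cis (\<psi> x) *s cconj v)"
      if "x \<in> V" "v \<in> qhor (?g x)" for x v
      using Aop[of x v] that VV0 cis\<psi> by (simp add: subset_iff)
  qed
qed

lemma smooth_fun_vdiff_field:
  assumes sm: "smooth_manifold M" and U: "openin (mtop M) U" and a: "smooth_fun M U a"
    and e: "smooth_field M U e"
  shows "smooth_fun M U (\<lambda>x. vdiff M a x (e x))"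
proof (rule smooth_funI[OF sm U])
  fix c assume c: "c \<in> charts M" "open (cmap c ` (cdom c \<inter> U))"
  let ?S = "cmap c ` (cdom c \<inter> U)"
  have "smooth_on ?S (\<lambda>x. e (cinv c x) c)" using e c(1) by (auto simp: smooth_field_def)
  then have "smooth_on ?S (\<lambda>x. frechet_derivative (\<lambda>x. a (cinv c x)) (at x) (e (cinv c x) c))"
    by (rule smooth_on_frechet_derivative[OF c(2) smooth_funD[OF a c(1)]])
  then show "smooth_on ?S (\<lambda>x. vdiff M a (cinv c x) (e (cinv c x)))"
  proof (rule smooth_on_cong[OF c(2), rotated])
    fix x assume "x \<in> ?S"
    then obtain q where q: "q \<in> cdom c" "q \<in> U" "x = cmap c q" by blast
    have cq: "c \<in> charts_at M q" using c(1) q(1) by (simp add: charts_at_def)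
    have "e q \<in> tangent_space M q" using e q(2) by (simp add: smooth_field_def)
    from vdiff_chart[OF sm U q(2) a cq this]
    show "frechet_derivative (\<lambda>x. a (cinv c x)) (at x) (e (cinv c x) c) = vdiff M a (cinv c x) (e (cinv c x))"
      unfolding q(3) cinv_cmap[OF sm cq] by simp
  qed
qed

lemma hypersurface_scale_normal:
  fixes M :: "('a, real ^ 'n::finite) manifold"
  assumes sm: "smooth_manifold M" and h: "hypersurface M U a b" and \<sigma>: "\<sigma> \<in> {1, -1::real}"
  shows "hypersurface M U a (\<lambda>x. \<sigma> *\<^sub>R b x)"
    and "q \<in> U \<Longrightarrow> vdiff M (\<lambda>x. \<sigma> *\<^sub>R b x) q X = \<sigma> *\<^sub>R vdiff M b q X"
proof -
  have U: "openin (mtop M) U" and sb: "smooth_fun M U b" using h by (auto simp: hypersurface_def)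
  have "smooth_fun M U (\<lambda>x. \<sigma> *\<^sub>R b x)"
    by (intro smooth_funI[OF sm U] smooth_on_scaleR smooth_on_const smooth_funD[OF sb])
  then show "hypersurface M U a (\<lambda>x. \<sigma> *\<^sub>R b x)"
    using h \<sigma> unfolding hypersurface_def by auto
  show "vdiff M (\<lambda>x. \<sigma> *\<^sub>R b x) q X = \<sigma> *\<^sub>R vdiff M b q X" if "q \<in> U"
    by (rule vdiff_linear_map[OF sm U that sb bounded_linear_scaleR_right])
qed

text \<open>
  The principal curvatures with respect to \<open>b\<close> itself are \<open>\<sigma> \<kappa>\<^sub>j\<close>, and the angles are \<open>arccot (\<sigma> \<kappa>\<^sub>j) - \<psi> / 2\<close> up to
  multiples of \<open>\<pi>\<close>. The addition theorem for the cotangent gives the relation, with the sign \<open>- \<sigma>\<close>.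
\<close>

lemma principal_frame_adapted:
  fixes M :: "('a, real ^ 'n::finite) manifold" and f :: "'a \<Rightarrow> 'n option cp"
    and e :: "'n \<Rightarrow> 'a \<Rightarrow> ('a, real ^ 'n) tvec"
  assumes sm: "smooth_manifold M" and h: "hypersurface M U a b" and f: "\<And>q. q \<in> U \<Longrightarrow> f q = gauss_map a b q"
    and \<sigma>: "\<sigma> \<in> {1, -1::real}" and W: "openin (mtop M) W" "W \<subseteq> U"
    and e: "\<And>j. smooth_field M W (e j)"
    and pf: "\<And>q. q \<in> W \<Longrightarrow> principal_frame_at M a (\<lambda>x. \<sigma> *\<^sub>R b x) q (\<lambda>j. e j q) (\<lambda>j. \<kappa> j q)"
    and DA: "(D, A) \<in> shape_operators" and fD: "f ` U \<subseteq> D" and q: "q \<in> W"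
  shows "\<exists>W' \<theta>. openin (mtop M) W' \<and> q \<in> W' \<and> W' \<subseteq> W \<and> (\<forall>j. smooth_fun M W' (\<theta> j :: 'a \<Rightarrow> real)) \<and>
      (\<forall>x\<in>W'. \<forall>j. has_angle M f (A (f x)) x (e j x) (\<theta> j x))"
    and "(\<And>j. has_angle M f (A (f q)) q (e j q) (\<theta> j)) \<Longrightarrow> \<kappa> j q \<noteq> \<kappa> k q \<Longrightarrow>
      sin (\<theta> j - \<theta> k) \<noteq> 0 \<and>
      cot (\<theta> j - \<theta> k) = - 1 * \<sigma> * ((\<kappa> j q * \<kappa> k q + 1) / (\<kappa> j q - \<kappa> k q))"
proof -
  have qU: "q \<in> U" using q W(2) by blast
  note hf = hypersurface_facts[OF sm h]
  obtain V \<psi> where V: "openin (mtop M) V" "q \<in> V" "V \<subseteq> U" and s\<psi>: "smooth_fun M V (\<psi> :: 'a \<Rightarrow> real)"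
    and A: "\<And>x v. x \<in> V \<Longrightarrow> v \<in> qhor (glift a b x) \<Longrightarrow>
      A (f x) (dhopf (glift a b x) v) = - dhopf (glift a b x) (cis (\<psi> x) *s cconj v)"
    using shape_operator_along_gauss_map[OF sm h f DA fD qU] by metis
  have \<sigma>\<sigma>: "\<sigma> * \<sigma> = 1" using \<sigma> by auto
  have ej: "e j x \<in> tangent_space M x" "e j x \<noteq> tzero" and
    db: "vdiff M b x (e j x) = - (\<sigma> * \<kappa> j x) *\<^sub>R vdiff M a x (e j x)" if x: "x \<in> W" for x j
  proof -
    have xU: "x \<in> U" using x W(2) by blast
    have fr: "frame_at M x (\<lambda>j. e j x)" and so: "shape_op M a (\<lambda>x. \<sigma> *\<^sub>R b x) x (e j x) = tscale (\<kappa> j x) (e j x)"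
      using pf[OF x] by (auto simp: principal_frame_at_def)
    show t: "e j x \<in> tangent_space M x" "e j x \<noteq> tzero" using frame_at_nonzero[OF fr sm] by blast+
    have "\<sigma> *\<^sub>R vdiff M b x (e j x) = - \<kappa> j x *\<^sub>R vdiff M a x (e j x)"
      using shape_op_eq_iff[OF sm hypersurface_scale_normal(1)[OF sm h \<sigma>] xU t(1), of "\<kappa> j x"] so
      unfolding hypersurface_scale_normal(2)[OF sm h \<sigma> xU] by blast
    then have "\<sigma> *\<^sub>R \<sigma> *\<^sub>R vdiff M b x (e j x) = \<sigma> *\<^sub>R (- \<kappa> j x *\<^sub>R vdiff M a x (e j x))" by simp
    then show "vdiff M b x (e j x) = - (\<sigma> * \<kappa> j x) *\<^sub>R vdiff M a x (e j x)" by (simp add: \<sigma>\<sigma>)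
  qed
  have nz: "vdiff M a x (e j x) \<noteq> 0" if x: "x \<in> W" for x j
  proof -
    have xU: "x \<in> U" using x W(2) by blast
    show ?thesis by (rule vdiff_nonzero[OF sm hf(1)[OF xU] xU hf(3,8)[OF xU] ej[OF x]])
  qed
  have ang: "has_angle M f (A (f x)) x (e j x) t \<longleftrightarrow> cos (t + \<psi> x / 2) = \<sigma> * \<kappa> j x * sin (t + \<psi> x / 2)"
    if x: "x \<in> V" "x \<in> W" for x j t
  proof -
    have xU: "x \<in> U" using x V(3) by blast
    have "has_angle M f (A (f x)) x (e j x) t \<longleftrightarrow>
        cos (t + \<psi> x / 2) *\<^sub>R vdiff M a x (e j x) + sin (t + \<psi> x / 2) *\<^sub>R vdiff M b x (e j x) = 0"
      by (rule has_angle_iff[OF sm h xU f A[OF x(1)] ej(1)[OF x(2)]])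
    also have "\<dots> \<longleftrightarrow>
        (cos (t + \<psi> x / 2) - \<sigma> * \<kappa> j x * sin (t + \<psi> x / 2)) *\<^sub>R vdiff M a x (e j x) = 0"
      unfolding db[OF x(2)] by (simp add: algebra_simps)
    finally have "has_angle M f (A (f x)) x (e j x) t \<longleftrightarrow>
        (cos (t + \<psi> x / 2) - \<sigma> * \<kappa> j x * sin (t + \<psi> x / 2)) *\<^sub>R vdiff M a x (e j x) = 0" .
    then show ?thesis using nz[OF x(2), of j] by simp
  qed
  show "\<exists>W' \<theta>. openin (mtop M) W' \<and> q \<in> W' \<and> W' \<subseteq> W \<and> (\<forall>j. smooth_fun M W' (\<theta> j :: 'a \<Rightarrow> real)) \<and>
      (\<forall>x\<in>W'. \<forall>j. has_angle M f (A (f x)) x (e j x) (\<theta> j x))"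
  proof (intro exI conjI allI ballI)
    let ?l = "\<lambda>j x. - (vdiff M b x (e j x) \<bullet> vdiff M a x (e j x)) / (vdiff M a x (e j x) \<bullet> vdiff M a x (e j x))"
    let ?\<theta> = "\<lambda>j x. pi / 2 - arctan (?l j x) - \<psi> x / 2"
    have WV: "V \<inter> W \<subseteq> W" "V \<inter> W \<subseteq> V" by auto
    show o: "openin (mtop M) (V \<inter> W)" by (rule openin_Int[OF V(1) W(1)])
    show "q \<in> V \<inter> W" "V \<inter> W \<subseteq> W" using q V(2) by auto
    have sv: "smooth_fun M (V \<inter> W) (\<lambda>x. vdiff M F x (e j x))" if "smooth_fun M U F" for F :: "'a \<Rightarrow> real ^ 'n option option" and j
      using smooth_fun_subset[OF smooth_fun_vdiff_field[OF sm W(1) smooth_fun_subset[OF that W(2)] e] WV(1)] .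
    have "smooth_fun M (V \<inter> W) (\<lambda>x. pi / 2 + - arctan (?l j x) + - (\<psi> x * (1 / 2)))" for j
    proof (rule smooth_funI[OF sm o])
      fix c assume c: "c \<in> charts M" "open (cmap c ` (cdom c \<inter> (V \<inter> W)))"
      have "cinv c x \<in> W" if "x \<in> cmap c ` (cdom c \<inter> (V \<inter> W))" for x
        using cinv_in_cdom[OF that _ chart_facts(3)[OF sm c(1)]] by blast
      then show "smooth_on (cmap c ` (cdom c \<inter> (V \<inter> W)))
          (\<lambda>x. pi / 2 + - arctan (?l j (cinv c x)) + - (\<psi> (cinv c x) * (1 / 2)))"
        using nz
        by (intro smooth_on_add smooth_on_minus smooth_on_const smooth_on_arctan smooth_on_divide smooth_on_inner
            smooth_on_mult c(2) smooth_funD[OF sv[OF hf(3)[OF qU]] c(1)] smooth_funD[OF sv[OF hf(4)[OF qU]] c(1)]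
            smooth_funD[OF smooth_fun_subset[OF s\<psi> WV(2)] c(1)]) auto
    qed
    then show "smooth_fun M (V \<inter> W) (?\<theta> j)" for j by simp
    fix x j assume x: "x \<in> V \<inter> W"
    have l: "?l j x = \<sigma> * \<kappa> j x" using x nz by (simp add: db)
    show "has_angle M f (A (f x)) x (e j x) (?\<theta> j x)"
      unfolding ang[OF IntD1[OF x] IntD2[OF x]] l using cos_arccot[of "\<sigma> * \<kappa> j x"] by simp
  qed
  assume \<theta>: "\<And>j. has_angle M f (A (f q)) q (e j q) (\<theta> j)" and ne: "\<kappa> j q \<noteq> \<kappa> k q"
  have ne': "\<sigma> * \<kappa> j q \<noteq> \<sigma> * \<kappa> k q" using ne \<sigma> by auto
  have cs: "cos (\<theta> i + \<psi> q / 2) = \<sigma> * \<kappa> i q * sin (\<theta> i + \<psi> q / 2)" for i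
    using ang[OF V(2) q] \<theta> by blast
  have d: "\<theta> j + \<psi> q / 2 - (\<theta> k + \<psi> q / 2) = \<theta> j - \<theta> k" by simp
  show "sin (\<theta> j - \<theta> k) \<noteq> 0 \<and>
      cot (\<theta> j - \<theta> k) = - 1 * \<sigma> * ((\<kappa> j q * \<kappa> k q + 1) / (\<kappa> j q - \<kappa> k q))"
  proof
    show "sin (\<theta> j - \<theta> k) \<noteq> 0" using cot_diff_of_cos_eq(1)[OF cs cs ne'] unfolding d .
    have "cot (\<theta> j - \<theta> k) = - ((\<sigma> * \<kappa> j q * (\<sigma> * \<kappa> k q) + 1) / (\<sigma> * \<kappa> j q - \<sigma> * \<kappa> k q))"
      using cot_diff_of_cos_eq(2)[OF cs cs ne'] unfolding d .
    also have "\<dots> = - 1 * \<sigma> * ((\<kappa> j q * \<kappa> k q + 1) / (\<kappa> j q - \<kappa> k q))"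
    proof -
      have "\<kappa> k q - \<kappa> j q \<noteq> 0" "\<kappa> j q - \<kappa> k q \<noteq> 0" using ne by auto
      then show ?thesis using \<sigma> by (auto simp: field_simps)
    qed
    finally show "cot (\<theta> j - \<theta> k) = - 1 * \<sigma> * ((\<kappa> j q * \<kappa> k q + 1) / (\<kappa> j q - \<kappa> k q))" .
  qed
qed

section \<open>The correspondence\<close>

theorem theorem3p1:
  fixes M :: "('a, real ^ 'n::finite) manifold"
  assumes "smooth_manifold M"
  shows
    "(\<forall>a b. hypersurface M (carrier M) a b \<longrightarrow>
        (let G = gauss_map a b;
             Gh = (\<lambda>p. (1 / sqrt 2) *\<^sub>R cvec (a p) (b p));
             A = (\<lambda>p. lift_shape_operator (Gh p))
         in lagrangian_immersion M G \<and>
            horizontal_lift M G Gh \<and>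
            (\<forall>p\<in>carrier M. \<forall>(e :: 'n \<Rightarrow> ('a, real ^ 'n) tvec).
               (\<forall>\<kappa> \<theta>. principal_frame_at M a b p e \<kappa> \<and> (\<forall>j. has_angle M G (A p) p (e j) (\<theta> j))
                  \<longrightarrow> (\<forall>j. sin (\<theta> j) \<noteq> 0 \<and> \<kappa> j = cot (\<theta> j))) \<and>
               (\<forall>\<kappa>. principal_frame_at M a b p e \<kappa>
                  \<longrightarrow> (\<exists>\<theta>. \<forall>j. has_angle M G (A p) p (e j) (\<theta> j))) \<and>
               (\<forall>\<theta>. frame_at M p e \<and> (\<forall>j. has_angle M G (A p) p (e j) (\<theta> j))
                  \<longrightarrow> (\<exists>\<kappa>. principal_frame_at M a b p e \<kappa>)))))
     \<and>
     (\<forall>f. lagrangian_immersion M f \<longrightarrow>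
        (\<forall>p\<in>carrier M. \<exists>U a b. p \<in> U \<and> hypersurface M U a b \<and> (\<forall>q\<in>U. f q = gauss_map a b q)) \<and>
        (\<forall>p\<in>carrier M. \<exists>U a b a' b'. p \<in> U \<and>
           hypersurface M U a b \<and> (\<forall>q\<in>U. f q = gauss_map a b q) \<and>
           hypersurface M U a' b' \<and> (\<forall>q\<in>U. f q = gauss_map a' b' q) \<and>
           (\<exists>q\<in>U. a q \<noteq> a' q) \<and>
           principal_curvatures M a b p \<noteq> principal_curvatures M a' b' p \<and>
           principal_curvatures M a b p \<noteq> uminus ` principal_curvatures M a' b' p) \<and>
        (\<forall>U a b. hypersurface M U a b \<and> (\<forall>q\<in>U. f q = gauss_map a b q) \<longrightarrow>
           (\<exists>\<epsilon>\<in>{1, -1}. \<forall>\<sigma>\<in>{1, -1}. \<forall>W (e :: 'n \<Rightarrow> 'a \<Rightarrow> ('a, real ^ 'n) tvec) \<kappa>.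
              openin (mtop M) W \<and> W \<subseteq> U \<and> (\<forall>j. smooth_field M W (e j)) \<and>
              (\<forall>q\<in>W. principal_frame_at M a (\<lambda>x. \<sigma> *\<^sub>R b x) q (\<lambda>j. e j q) (\<lambda>j. \<kappa> j q)) \<longrightarrow>
              (\<forall>(D, A)\<in>shape_operators. f ` U \<subseteq> D \<longrightarrow>
                 (\<forall>q\<in>W. \<exists>W' \<theta>. openin (mtop M) W' \<and> q \<in> W' \<and> W' \<subseteq> W \<and>
                    (\<forall>j. smooth_fun M W' (\<theta> j :: 'a \<Rightarrow> real)) \<and>
                    (\<forall>x\<in>W'. \<forall>j. has_angle M f (A (f x)) x (e j x) (\<theta> j x))) \<and>
                 (\<forall>q\<in>W. \<forall>\<theta>. (\<forall>j. has_angle M f (A (f q)) q (e j q) (\<theta> j)) \<longrightarrow>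
                    (\<forall>j k. \<kappa> j q \<noteq> \<kappa> k q \<longrightarrow>
                       sin (\<theta> j - \<theta> k) \<noteq> 0 \<and>
                       cot (\<theta> j - \<theta> k) = \<epsilon> * \<sigma> * ((\<kappa> j q * \<kappa> k q + 1) / (\<kappa> j q - \<kappa> k q))))))))"
proof (intro conjI allI impI ballI, goal_cases)
  case (1 a b)
  have gl: "(\<lambda>p. (1 / sqrt 2) *\<^sub>R cvec (a p) (b p)) = glift a b"
    by (simp add: glift_def[abs_def])
  show ?case
    unfolding Let_def gl
    using lagrangian_gauss_map[OF assms 1] horizontal_lift_glift[OF assms 1] gauss_map_angles[OF assms 1]
    by (intro conjI ballI allI impI) blast+
next
  case (2 f p)
  then show ?case using hypersurface_exists[OF assms] by metis
next
  case (3 f p)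
  obtain U a b where U: "p \<in> U" "hypersurface M U a b" "\<And>q. q \<in> U \<Longrightarrow> f q = gauss_map a b q"
    using hypersurface_exists[OF assms 3] by blast
  obtain V a' b' where V: "p \<in> V" "V \<subseteq> U" "hypersurface M V a' b'" "\<And>q. q \<in> V \<Longrightarrow> f q = gauss_map a' b' q"
    "a p \<noteq> a' p" "principal_curvatures M a b p \<noteq> principal_curvatures M a' b' p"
    "principal_curvatures M a b p \<noteq> uminus ` principal_curvatures M a' b' p"
    using another_hypersurface[OF assms U(2,1,3)] by blast
  show ?case
  proof (intro exI conjI)
    show "hypersurface M V a b"
      by (rule hypersurface_subset[OF U(2) _ V(2)]) (use V(3) in \<open>simp add: hypersurface_def\<close>)
    show "p \<in> V" "hypersurface M V a' b'" "principal_curvatures M a b p \<noteq> principal_curvatures M a' b' p"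
      "principal_curvatures M a b p \<noteq> uminus ` principal_curvatures M a' b' p"
      by (rule V)+
    show "\<forall>q\<in>V. f q = gauss_map a b q" "\<forall>q\<in>V. f q = gauss_map a' b' q"
      using U(3) V(2,4) by blast+
    show "\<exists>q\<in>V. a q \<noteq> a' q" using V(5,1) by blast
  qed
next
  case (4 f U a b)
  then have h: "hypersurface M U a b" and f: "\<And>q. q \<in> U \<Longrightarrow> f q = gauss_map a b q" by blast+
  show ?case
  proof (rule bexI[of _ "- 1"], rule ballI, intro allI impI)
    fix \<sigma> :: real and W and e :: "'n \<Rightarrow> 'a \<Rightarrow> ('a, real ^ 'n) tvec" and \<kappa> :: "'n \<Rightarrow> 'a \<Rightarrow> real"
    assume \<sigma>: "\<sigma> \<in> {1, - 1}" and "openin (mtop M) W \<and> W \<subseteq> U \<and> (\<forall>j. smooth_field M W (e j)) \<and>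
              (\<forall>q\<in>W. principal_frame_at M a (\<lambda>x. \<sigma> *\<^sub>R b x) q (\<lambda>j. e j q) (\<lambda>j. \<kappa> j q))"
    then have W: "openin (mtop M) W" "W \<subseteq> U" and e: "\<And>j. smooth_field M W (e j)"
      and pf: "\<And>q. q \<in> W \<Longrightarrow> principal_frame_at M a (\<lambda>x. \<sigma> *\<^sub>R b x) q (\<lambda>j. e j q) (\<lambda>j. \<kappa> j q)"
      by blast+
    show "\<forall>(D, A)\<in>shape_operators. f ` U \<subseteq> D \<longrightarrow>
                 (\<forall>q\<in>W. \<exists>W' \<theta>. openin (mtop M) W' \<and> q \<in> W' \<and> W' \<subseteq> W \<and>
                    (\<forall>j. smooth_fun M W' (\<theta> j :: 'a \<Rightarrow> real)) \<and>
                    (\<forall>x\<in>W'. \<forall>j. has_angle M f (A (f x)) x (e j x) (\<theta> j x))) \<and>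
                 (\<forall>q\<in>W. \<forall>\<theta>. (\<forall>j. has_angle M f (A (f q)) q (e j q) (\<theta> j)) \<longrightarrow>
                    (\<forall>j k. \<kappa> j q \<noteq> \<kappa> k q \<longrightarrow>
                       sin (\<theta> j - \<theta> k) \<noteq> 0 \<and>
                       cot (\<theta> j - \<theta> k) = - 1 * \<sigma> * ((\<kappa> j q * \<kappa> k q + 1) / (\<kappa> j q - \<kappa> k q))))"
    proof (clarify, intro conjI[of "Ball _ _"] ballI allI impI, goal_cases)
      case (1 D A q)
      show ?case by (rule principal_frame_adapted(1)[OF assms h f \<sigma> W e pf 1])
    next
      case (2 D A q \<theta> j k)
      show ?case
        by (rule principal_frame_adapted(2)[OF assms h f \<sigma> W e pf 2(1-3) spec[OF 2(4)] 2(5)])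
    qed
  qed simp
qed

end
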